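(* Let $(M,\tau)$ be a finite von Neumann algebra with separable pre-dual, with specified trace $\tau$, and let $\omega$ be a non-principal ultrafilter on $\mathbb{N}=\{1,2,3,\dots\}$. Then there exists a sequence $(A_n,\tau_n)_{n\in\mathbb{N}}$ of trace-reduced tracial $*$-algebras such that: (1) for every $n\in\mathbb{N}$, the complex algebra $A_n$ embeds as a complex algebra into the ring of $n\times n$-matrices over a commutative complex algebra; and (2) there exists a trace-preserving embedding (an injective $*$-algebra homomorphism preserving the traces) $$\iota\colon (M,\tau)\hookrightarrow \prod_{n\to\omega}(A_n,\tau_n)$$ into the metric ultraproduct.
   Context: A tracial $*$-algebra $(A,\tau)$ is a unital complex algebra $A$ with involution together with a $\mathbb{C}$-linear functional $\tau\colon A\to\mathbb{C}$ (a "positive trace") with $\tau(1)=1$, $\tau(a^*a)\ge 0$ and $\tau(ab)=\tau(ba)$ for all $a,b\in A$. It is trace-reduced if $\tau$ is faithful, i.e. $\tau(a^*a)=0$ implies $a=0$. The specified trace on a finite von Neumann algebra is a faithful normal tracial state. Embeddings of $A_n$ into matrix rings are injective homomorphisms of complex algebras that are not required to preserve the unit. For even $p\ge 2$ put $\|a\|_p=\tau((a^*a)^{p/2})^{1/p}$. Metric ultraproduct: given tracial $*$-algebras $(A_i,\tau_i)$, $i\in I$, and an ultrafilter $\omega$ on $I$, let $\widetilde{\prod}_{i}(A_i,\tau_i)$ be the $*$-algebra of all $(a_i)_i\in\prod_i A_i$ such that $(\|a_i\|_p)_{i\in I}$ is bounded for every even $p$. On it, $\tau_\omega((a_i)_i)=\lim_{i\to\omega}\tau_i(a_i)$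 is a positive trace, $Z_{\tau_\omega}=\{x : \tau_\omega(x^*x)=0\}$ is a two-sided $*$-ideal on which $\tau_\omega$ vanishes, and the metric ultraproduct is $\prod_{i\to\omega}(A_i,\tau_i):=\widetilde{\prod}_i(A_i,\tau_i)/Z_{\tau_\omega}$ with the trace induced by $\tau_\omega$. *)

theory Defs
  imports
    "HOL-Analysis.Analysis"
    "HOL-Algebra.Module"
    "HOL-Algebra.QuotRing"
begin

section \<open>Complex algebras, traces and matrix algebras\<close>

definition complex_ring :: "complex ring" where
  "complex_ring = \<lparr>carrier = UNIV, mult = (*), one = 1, zero = 0, add = (+)\<rparr>"

text \<open>The library locale \<^locale>\<open>Module.algebra\<close> is restricted to commutative algebras, so the
  general (unital, associative) notion is introduced here. The library locale is used for the
  commutative algebras over which matrices are taken.\<close>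

locale complex_algebra = ring A + Module.module complex_ring A for A (structure) +
  assumes smult_mult_left:
      "\<lbrakk>x \<in> carrier A; y \<in> carrier A\<rbrakk> \<Longrightarrow> (c \<odot> x) \<otimes> y = c \<odot> (x \<otimes> y)"
    and smult_mult_right:
      "\<lbrakk>x \<in> carrier A; y \<in> carrier A\<rbrakk> \<Longrightarrow> x \<otimes> (c \<odot> y) = c \<odot> (x \<otimes> y)"

record 'a star_algebra = "(complex, 'a) module" +
  star :: "'a \<Rightarrow> 'a"

locale complex_star_algebra = complex_algebra A for A :: "('a, 'm) star_algebra_scheme" (structure) +
  assumes star_closed: "x \<in> carrier A \<Longrightarrow> star A x \<in> carrier A"
    and star_star: "x \<in> carrier A \<Longrightarrow> star A (star A x) = x"
    and star_add: "\<lbrakk>x \<in> carrier A; y \<in> carrier A\<rbrakk> \<Longrightarrow> star A (x \<oplus> y) = star A x \<oplus> star A y"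
    and star_smult: "x \<in> carrier A \<Longrightarrow> star A (c \<odot> x) = cnj c \<odot> star A x"
    and star_mult: "\<lbrakk>x \<in> carrier A; y \<in> carrier A\<rbrakk> \<Longrightarrow> star A (x \<otimes> y) = star A y \<otimes> star A x"

definition linear_functional :: "(complex, 'a, 'm) module_scheme \<Rightarrow> ('a \<Rightarrow> complex) \<Rightarrow> bool" where
  "linear_functional A \<phi> \<longleftrightarrow>
     (\<forall>x\<in>carrier A. \<forall>y\<in>carrier A. \<phi> (x \<oplus>\<^bsub>A\<^esub> y) = \<phi> x + \<phi> y) \<and>
     (\<forall>c. \<forall>x\<in>carrier A. \<phi> (c \<odot>\<^bsub>A\<^esub> x) = c * \<phi> x)"

definition positive_trace :: "('a, 'm) star_algebra_scheme \<Rightarrow> ('a \<Rightarrow> complex) \<Rightarrow> bool" where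
  "positive_trace A \<tau> \<longleftrightarrow>
     linear_functional A \<tau> \<and>
     \<tau> \<one>\<^bsub>A\<^esub> = 1 \<and>
     (\<forall>a\<in>carrier A. \<tau> (star A a \<otimes>\<^bsub>A\<^esub> a) \<in> \<real>\<^sub>\<ge>\<^sub>0) \<and>
     (\<forall>a\<in>carrier A. \<forall>b\<in>carrier A. \<tau> (a \<otimes>\<^bsub>A\<^esub> b) = \<tau> (b \<otimes>\<^bsub>A\<^esub> a))"

definition faithful :: "('a, 'm) star_algebra_scheme \<Rightarrow> ('a \<Rightarrow> complex) \<Rightarrow> bool" where
  "faithful A \<tau> \<longleftrightarrow> (\<forall>a\<in>carrier A. \<tau> (star A a \<otimes>\<^bsub>A\<^esub> a) = 0 \<longrightarrow> a = \<zero>\<^bsub>A\<^esub>)"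

definition tracial_star_algebra :: "('a, 'm) star_algebra_scheme \<Rightarrow> ('a \<Rightarrow> complex) \<Rightarrow> bool" where
  "tracial_star_algebra A \<tau> \<longleftrightarrow> complex_star_algebra A \<and> positive_trace A \<tau>"

definition trace_reduced :: "('a, 'm) star_algebra_scheme \<Rightarrow> ('a \<Rightarrow> complex) \<Rightarrow> bool" where
  "trace_reduced A \<tau> \<longleftrightarrow> tracial_star_algebra A \<tau> \<and> faithful A \<tau>"

text \<open>Homomorphisms of complex algebras that need not preserve the unit.\<close>

definition complex_alg_hom ::
  "(complex, 'a, 'm) module_scheme \<Rightarrow> (complex, 'b, 'n) module_scheme \<Rightarrow> ('a \<Rightarrow> 'b) \<Rightarrow> bool" where
  "complex_alg_hom A B h \<longleftrightarrow>
     h \<in> carrier A \<rightarrow> carrier B \<and>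
     (\<forall>x\<in>carrier A. \<forall>y\<in>carrier A. h (x \<oplus>\<^bsub>A\<^esub> y) = h x \<oplus>\<^bsub>B\<^esub> h y) \<and>
     (\<forall>x\<in>carrier A. \<forall>y\<in>carrier A. h (x \<otimes>\<^bsub>A\<^esub> y) = h x \<otimes>\<^bsub>B\<^esub> h y) \<and>
     (\<forall>c. \<forall>x\<in>carrier A. h (c \<odot>\<^bsub>A\<^esub> x) = c \<odot>\<^bsub>B\<^esub> h x)"

definition complex_alg_embedding ::
  "(complex, 'a, 'm) module_scheme \<Rightarrow> (complex, 'b, 'n) module_scheme \<Rightarrow> ('a \<Rightarrow> 'b) \<Rightarrow> bool" where
  "complex_alg_embedding A B h \<longleftrightarrow> complex_alg_hom A B h \<and> inj_on h (carrier A)"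

definition trace_preserving_embedding ::
  "('a, 'm) star_algebra_scheme \<Rightarrow> ('a \<Rightarrow> complex) \<Rightarrow>
   ('b, 'n) star_algebra_scheme \<Rightarrow> ('b \<Rightarrow> complex) \<Rightarrow> ('a \<Rightarrow> 'b) \<Rightarrow> bool" where
  "trace_preserving_embedding A \<tau> B \<sigma> h \<longleftrightarrow>
     complex_alg_embedding A B h \<and>
     h \<one>\<^bsub>A\<^esub> = \<one>\<^bsub>B\<^esub> \<and>
     (\<forall>x\<in>carrier A. h (star A x) = star B (h x)) \<and>
     (\<forall>x\<in>carrier A. \<sigma> (h x) = \<tau> x)"

text \<open>The type-level matrices of the library need a type class for the entries, and their size is
  not a term; here both the base algebra and the size vary. Entries are indexed by
  \<open>{..<n} \<times> {..<n}\<close>.\<close>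

definition matrix_algebra ::
  "nat \<Rightarrow> (complex, 'c, 'm) module_scheme \<Rightarrow> (complex, nat \<times> nat \<Rightarrow> 'c) module" where
  "matrix_algebra n C =
    \<lparr>carrier = ({..<n} \<times> {..<n}) \<rightarrow>\<^sub>E carrier C,
     mult = (\<lambda>X Y. \<lambda>(i, j) \<in> {..<n} \<times> {..<n}. \<Oplus>\<^bsub>C\<^esub>k\<in>{..<n}. X (i, k) \<otimes>\<^bsub>C\<^esub> Y (k, j)),
     one = (\<lambda>(i, j) \<in> {..<n} \<times> {..<n}. if i = j then \<one>\<^bsub>C\<^esub> else \<zero>\<^bsub>C\<^esub>),
     zero = (\<lambda>(i, j) \<in> {..<n} \<times> {..<n}. \<zero>\<^bsub>C\<^esub>),
     add = (\<lambda>X Y. \<lambda>(i, j) \<in> {..<n} \<times> {..<n}. X (i, j) \<oplus>\<^bsub>C\<^esub> Y (i, j)),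
     smult = (\<lambda>c X. \<lambda>(i, j) \<in> {..<n} \<times> {..<n}. c \<odot>\<^bsub>C\<^esub> X (i, j))\<rparr>"


section \<open>Metric ultraproducts\<close>

text \<open>A filter on the set \<open>I\<close> is a filter on the ambient type that contains \<open>I\<close>.\<close>

definition ultrafilter_on :: "'i set \<Rightarrow> 'i filter \<Rightarrow> bool" where
  "ultrafilter_on I \<omega> \<longleftrightarrow>
     \<omega> \<noteq> bot \<and> eventually (\<lambda>i. i \<in> I) \<omega> \<and>
     (\<forall>P. eventually P \<omega> \<or> eventually (\<lambda>i. \<not> P i) \<omega>)"

definition nonprincipal :: "'i filter \<Rightarrow> bool" where
  "nonprincipal \<omega> \<longleftrightarrow> (\<forall>i. \<omega> \<noteq> principal {i})"

text \<open>For even \<open>p\<close> the trace below is real and nonnegative, so taking its real part loses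
  nothing. The definition is only used for even \<open>p \<ge> 2\<close>.\<close>

definition trace_norm ::
  "('a, 'm) star_algebra_scheme \<Rightarrow> ('a \<Rightarrow> complex) \<Rightarrow> nat \<Rightarrow> 'a \<Rightarrow> real" where
  "trace_norm A \<tau> p a = root p (Re (\<tau> ((star A a \<otimes>\<^bsub>A\<^esub> a) [^]\<^bsub>A\<^esub> (p div 2))))"

definition bounded_families ::
  "'i set \<Rightarrow> ('i \<Rightarrow> ('a, 'm) star_algebra_scheme) \<Rightarrow> ('i \<Rightarrow> 'a \<Rightarrow> complex) \<Rightarrow> ('i \<Rightarrow> 'a) set" where
  "bounded_families I A \<tau> =
     {a \<in> (\<Pi>\<^sub>E i\<in>I. carrier (A i)).
        \<forall>p\<ge>2. even p \<longrightarrow> bounded ((\<lambda>i. trace_norm (A i) (\<tau> i) p (a i)) ` I)}"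

definition bounded_product ::
  "'i set \<Rightarrow> ('i \<Rightarrow> ('a, 'm) star_algebra_scheme) \<Rightarrow> ('i \<Rightarrow> 'a \<Rightarrow> complex) \<Rightarrow> ('i \<Rightarrow> 'a) star_algebra" where
  "bounded_product I A \<tau> =
    \<lparr>carrier = bounded_families I A \<tau>,
     mult = (\<lambda>a b. \<lambda>i\<in>I. a i \<otimes>\<^bsub>A i\<^esub> b i),
     one = (\<lambda>i\<in>I. \<one>\<^bsub>A i\<^esub>),
     zero = (\<lambda>i\<in>I. \<zero>\<^bsub>A i\<^esub>),
     add = (\<lambda>a b. \<lambda>i\<in>I. a i \<oplus>\<^bsub>A i\<^esub> b i),
     smult = (\<lambda>c a. \<lambda>i\<in>I. c \<odot>\<^bsub>A i\<^esub> a i),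
     star = (\<lambda>a. \<lambda>i\<in>I. star (A i) (a i))\<rparr>"

definition limit_trace :: "'i filter \<Rightarrow> ('i \<Rightarrow> 'a \<Rightarrow> complex) \<Rightarrow> ('i \<Rightarrow> 'a) \<Rightarrow> complex" where
  "limit_trace \<omega> \<tau> a = Lim \<omega> (\<lambda>i. \<tau> i (a i))"

definition trace_kernel :: "('a, 'm) star_algebra_scheme \<Rightarrow> ('a \<Rightarrow> complex) \<Rightarrow> 'a set" where
  "trace_kernel A \<tau> = {x \<in> carrier A. \<tau> (star A x \<otimes>\<^bsub>A\<^esub> x) = 0}"

text \<open>The quotient by a two-sided \<open>*\<close>-ideal: the library quotient ring, whose elements are
  cosets, with the induced scalar multiplication and involution; and the functional induced by one
  that vanishes on the ideal, hence is constant on every coset.\<close>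

definition quotient_star_algebra :: "('a, 'm) star_algebra_scheme \<Rightarrow> 'a set \<Rightarrow> 'a set star_algebra" where
  "quotient_star_algebra A J =
    \<lparr>carrier = carrier (A Quot J),
     mult = mult (A Quot J),
     one = one (A Quot J),
     zero = zero (A Quot J),
     add = add (A Quot J),
     smult = (\<lambda>c X. \<Union>x\<in>X. J +>\<^bsub>A\<^esub> (c \<odot>\<^bsub>A\<^esub> x)),
     star = (\<lambda>X. \<Union>x\<in>X. J +>\<^bsub>A\<^esub> star A x)\<rparr>"

definition induced_trace :: "('a \<Rightarrow> complex) \<Rightarrow> 'a set \<Rightarrow> complex" where
  "induced_trace \<tau> X = the_elem (\<tau> ` X)"

definition metric_ultraproduct ::
  "'i set \<Rightarrow> 'i filter \<Rightarrow> ('i \<Rightarrow> ('a, 'm) star_algebra_scheme) \<Rightarrow> ('i \<Rightarrow> 'a \<Rightarrow> complex) \<Rightarrow>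
   ('i \<Rightarrow> 'a) set star_algebra" where
  "metric_ultraproduct I \<omega> A \<tau> =
     quotient_star_algebra (bounded_product I A \<tau>)
       (trace_kernel (bounded_product I A \<tau>) (limit_trace \<omega> \<tau>))"

definition metric_ultraproduct_trace ::
  "'i filter \<Rightarrow> ('i \<Rightarrow> 'a \<Rightarrow> complex) \<Rightarrow> ('i \<Rightarrow> 'a) set \<Rightarrow> complex" where
  "metric_ultraproduct_trace \<omega> \<tau> = induced_trace (limit_trace \<omega> \<tau>)"


section \<open>Von Neumann algebras\<close>

text \<open>Complex Hilbert spaces; the inner product is linear in the first argument.\<close>

class complex_hilbert_space = banach +
  fixes scaleC :: "complex \<Rightarrow> 'a \<Rightarrow> 'a" (infixr "*\<^sub>C" 75)
    and cinner :: "'a \<Rightarrow> 'a \<Rightarrow> complex"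
  assumes scaleC_add_right: "c *\<^sub>C (x + y) = c *\<^sub>C x + c *\<^sub>C y"
    and scaleC_add_left: "(c + d) *\<^sub>C x = c *\<^sub>C x + d *\<^sub>C x"
    and scaleC_scaleC: "c *\<^sub>C (d *\<^sub>C x) = (c * d) *\<^sub>C x"
    and scaleR_scaleC: "r *\<^sub>R x = of_real r *\<^sub>C x"
    and cinner_commute: "cinner x y = cnj (cinner y x)"
    and cinner_add_left: "cinner (x + y) z = cinner x z + cinner y z"
    and cinner_scaleC_left: "cinner (c *\<^sub>C x) y = c * cinner x y"
    and cinner_self: "cinner x x = of_real ((norm x)\<^sup>2)"

text \<open>The library type of bounded operators is that of the real-linear ones; complex linearity is
  imposed separately.\<close>

definition complex_linear_op :: "('h::complex_hilbert_space \<Rightarrow>\<^sub>L 'h) \<Rightarrow> bool" where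
  "complex_linear_op T \<longleftrightarrow> (\<forall>c x. T (c *\<^sub>C x) = c *\<^sub>C T x)"

definition scale_op :: "complex \<Rightarrow> ('h::complex_hilbert_space \<Rightarrow>\<^sub>L 'h) \<Rightarrow> 'h \<Rightarrow>\<^sub>L 'h" where
  "scale_op c T = Blinfun (\<lambda>x. c *\<^sub>C T x)"

definition adjoint_op :: "('h::complex_hilbert_space \<Rightarrow>\<^sub>L 'h) \<Rightarrow> 'h \<Rightarrow>\<^sub>L 'h" where
  "adjoint_op T = (THE S. \<forall>x y. cinner (blinfun_apply T x) y = cinner x (blinfun_apply S y))"

definition operator_algebra :: "('h::complex_hilbert_space \<Rightarrow>\<^sub>L 'h) set \<Rightarrow> ('h \<Rightarrow>\<^sub>L 'h) star_algebra" where
  "operator_algebra M =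
    \<lparr>carrier = M, mult = (o\<^sub>L), one = id_blinfun, zero = 0, add = (+),
     smult = scale_op, star = adjoint_op\<rparr>"

definition von_neumann_algebra :: "('h::complex_hilbert_space \<Rightarrow>\<^sub>L 'h) set \<Rightarrow> bool" where
  "von_neumann_algebra M \<longleftrightarrow>
     (\<forall>T\<in>M. complex_linear_op T) \<and>
     id_blinfun \<in> M \<and>
     (\<forall>S\<in>M. \<forall>T\<in>M. S + T \<in> M) \<and>
     (\<forall>c. \<forall>T\<in>M. scale_op c T \<in> M) \<and>
     (\<forall>S\<in>M. \<forall>T\<in>M. S o\<^sub>L T \<in> M) \<and>
     (\<forall>T\<in>M. adjoint_op T \<in> M) \<and>
     closedin strong_operator_topology M"

text \<open>Finiteness: every isometry in the algebra is unitary.\<close>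

definition finite_von_neumann_algebra :: "('h::complex_hilbert_space \<Rightarrow>\<^sub>L 'h) set \<Rightarrow> bool" where
  "finite_von_neumann_algebra M \<longleftrightarrow>
     von_neumann_algebra M \<and>
     (\<forall>V\<in>M. adjoint_op V o\<^sub>L V = id_blinfun \<longrightarrow> V o\<^sub>L adjoint_op V = id_blinfun)"

text \<open>The ultraweak topology is the initial topology of the functionals
  \<open>T \<mapsto> (\<Sum>k. cinner (T (x k)) (y k))\<close> for square-summable sequences \<open>x\<close> and \<open>y\<close> of vectors. The
  constant coordinates of the other pairs do not affect the initial topology.\<close>

definition square_summable :: "(nat \<Rightarrow> 'h::real_normed_vector) \<Rightarrow> bool" where
  "square_summable x \<longleftrightarrow> summable (\<lambda>k. (norm (x k))\<^sup>2)"

definition ultraweak_topology :: "('h::complex_hilbert_space \<Rightarrow>\<^sub>L 'h) topology" where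
  "ultraweak_topology = pullback_topology UNIV
     (\<lambda>T (x, y). if square_summable x \<and> square_summable y then \<Sum>k. cinner (blinfun_apply T (x k)) (y k) else 0)
     euclidean"

definition normal_functional ::
  "('h::complex_hilbert_space \<Rightarrow>\<^sub>L 'h) set \<Rightarrow> (('h \<Rightarrow>\<^sub>L 'h) \<Rightarrow> complex) \<Rightarrow> bool" where
  "normal_functional M \<phi> \<longleftrightarrow>
     linear_functional (operator_algebra M) \<phi> \<and>
     continuous_map (subtopology ultraweak_topology M) euclidean \<phi>"

definition predual ::
  "('h::complex_hilbert_space \<Rightarrow>\<^sub>L 'h) set \<Rightarrow> (('h \<Rightarrow>\<^sub>L 'h) \<Rightarrow> complex) set" where
  "predual M = {\<phi> \<in> extensional M. normal_functional M \<phi>}"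

definition functional_norm ::
  "('h::complex_hilbert_space \<Rightarrow>\<^sub>L 'h) set \<Rightarrow> (('h \<Rightarrow>\<^sub>L 'h) \<Rightarrow> complex) \<Rightarrow> real" where
  "functional_norm M \<phi> = (SUP T\<in>{T \<in> M. norm T \<le> 1}. cmod (\<phi> T))"

definition separable_predual :: "('h::complex_hilbert_space \<Rightarrow>\<^sub>L 'h) set \<Rightarrow> bool" where
  "separable_predual M \<longleftrightarrow>
     (\<exists>D. countable D \<and> D \<subseteq> predual M \<and>
       (\<forall>\<phi>\<in>predual M. \<forall>\<epsilon>>0. \<exists>\<psi>\<in>D. functional_norm M (\<lambda>T. \<phi> T - \<psi> T) < \<epsilon>))"

definition faithful_normal_tracial_state ::
  "('h::complex_hilbert_space \<Rightarrow>\<^sub>L 'h) set \<Rightarrow> (('h \<Rightarrow>\<^sub>L 'h) \<Rightarrow> complex) \<Rightarrow> bool" where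
  "faithful_normal_tracial_state M \<tau> \<longleftrightarrow>
     positive_trace (operator_algebra M) \<tau> \<and>
     faithful (operator_algebra M) \<tau> \<and>
     normal_functional M \<tau>"

text \<open>HOL cannot quantify existentially over types, so the algebras whose existence is asserted get
  carriers inside one fixed type of cardinality of the continuum. Nothing is lost: an algebra with
  separable predual has at most continuum many elements, so in a metric ultraproduct containing it
  one may replace each factor by the unital \<open>*\<close>-subalgebra generated by the coordinates of chosen
  representatives, and each commutative algebra of matrix entries by the unital subalgebra
  generated by the entries that occur.\<close>

type_synonym point = "nat \<Rightarrow> complex"

end

theory Submission
  imports Defs "HOL-Library.Poly_Mapping"
begin

text \<open>
  Choose a sequence \<open>g\<close> in \<open>M\<close> that is 2-norm dense in every operator norm ball, and let the free
  \<open>*\<close>-algebra on letters \<open>x\<^sub>0, x\<^sub>1, \<dots>\<close> act on \<open>M\<close> by \<open>x\<^sub>j \<mapsto> g j\<close> for \<open>j < n\<close> and \<open>x\<^sub>j \<mapsto> 0\<close>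
  otherwise. Up to degree \<open>n - 1\<close> the free \<open>*\<close>-algebra is faithfully represented by \<open>n \<times> n\<close>
  matrices. Truncate the moments of \<open>\<tau>\<close> at that degree and add a small multiple of the trace of these
  representations, weighted by a factor that grows very fast with the degree of a word. Positivity
  is not lost: the weights make the diagonal blocks of the moment matrix dominate. The resulting
  positive trace \<open>\<tau>\<^sub>n\<close> is within \<open>1 / n\<close> of \<open>\<tau>\<close> on the words of length below \<open>n\<close>, and its kernel
  consists exactly of the elements all of whose homogeneous components vanish in the matrix
  representations. Hence the quotient \<open>A\<^sub>n\<close> of the free \<open>*\<close>-algebra by this kernel is
  trace-reduced and embeds into \<open>n \<times> n\<close> matrices. An element \<open>x\<close> of \<open>M\<close> is mapped to the class of
  \<open>(x\<^sub>s\<^sub>(\<^sub>n\<^sub>))\<^sub>n\<close>, where \<open>g (s n)\<close> is bounded and converges to \<open>x\<close> in 2-norm with \<open>s n < n\<close>.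
\<close>

section \<open>Tracial star-algebras and their reduction\<close>

text \<open>Letting \<tau>_n be the trace of a matrix representation would ask for matrix models of
  \<open>M\<close> in the sense of Connes. Here the matrices determine only the kernel of \<tau>_n,
  while its values on long words are left to grow. Hence no operator norm bound holds in A_n: the
  moments of a coordinate are bounded because each of them converges, and closure of bounded
  families under sums and products rests on a reflection estimate for traces of words. Truncation
  deletes the blocks i + j > D of the moment matrix, where D = n - 1, and keeps only the corner i, j
  \<le> D / 2 as a genuine moment matrix. The factor 8^(t^2) pushes the weight at i + j below the
  geometric mean of the weights at 2i and 2j by at least 8^(-|i - j|), and a jump by powers of S
  beyond degree D controls the surviving blocks outside the corner. S does not enter the weights in
  degrees up to D, so it can be chosen after the small factor. As the weight depends on the degree,
  the kernel is graded, although the kernel of a single matrix representation is not. This is why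
  the matrix entries lie in a commutative algebra: it carries a scaling parameter that separates
  degrees.\<close>

lemma complex_ring_simps [simp]:
  "carrier complex_ring = UNIV" "mult complex_ring = (*)" "one complex_ring = 1"
  "zero complex_ring = 0" "add complex_ring = (+)"
  by (simp_all add: complex_ring_def)

lemma cring_complex_ring: "cring complex_ring"
proof (rule cringI)
  show "abelian_group complex_ring"
  proof (rule abelian_groupI)
    fix x :: complex
    show "\<exists>y\<in>carrier complex_ring. y \<oplus>\<^bsub>complex_ring\<^esub> x = \<zero>\<^bsub>complex_ring\<^esub>"
      by (auto intro!: exI[of _ "- x"])
  qed (auto simp: algebra_simps)
  show "comm_monoid complex_ring"
    by (rule comm_monoidI) (auto simp: algebra_simps)
qed (auto simp: algebra_simps)

lemma (in complex_algebra) smult_carrier [simp, intro]: "x \<in> carrier A \<Longrightarrow> c \<odot> x \<in> carrier A"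
  by (simp add: smult_closed)

lemma (in complex_algebra) ring_A: "ring A"
  using complex_algebra_axioms by (rule complex_algebra.axioms)

lemma (in complex_algebra) monoid_A: "Group.monoid A"
  using ring_A by (rule ring.is_monoid)

lemma (in complex_algebra) A_l_distr:
  "\<lbrakk>x \<in> carrier A; y \<in> carrier A; z \<in> carrier A\<rbrakk> \<Longrightarrow> (x \<oplus> y) \<otimes> z = x \<otimes> z \<oplus> y \<otimes> z"
  and A_r_distr:
  "\<lbrakk>x \<in> carrier A; y \<in> carrier A; z \<in> carrier A\<rbrakk> \<Longrightarrow> z \<otimes> (x \<oplus> y) = z \<otimes> x \<oplus> z \<otimes> y"
  and A_m_assoc:
  "\<lbrakk>x \<in> carrier A; y \<in> carrier A; z \<in> carrier A\<rbrakk> \<Longrightarrow> (x \<otimes> y) \<otimes> z = x \<otimes> (y \<otimes> z)"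
  and A_m_closed [simp, intro]: "\<lbrakk>x \<in> carrier A; y \<in> carrier A\<rbrakk> \<Longrightarrow> x \<otimes> y \<in> carrier A"
  and A_l_one [simp]: "x \<in> carrier A \<Longrightarrow> \<one> \<otimes> x = x"
  and A_r_one [simp]: "x \<in> carrier A \<Longrightarrow> x \<otimes> \<one> = x"
  and A_one_closed [simp, intro]: "\<one> \<in> carrier A"
  using ring_A by (auto simp: ring.ring_simprules)

lemma (in complex_algebra) cscale_add_left: "x \<in> carrier A \<Longrightarrow> (c + d) \<odot> x = c \<odot> x \<oplus> d \<odot> x"
  and cscale_add_right: "\<lbrakk>x \<in> carrier A; y \<in> carrier A\<rbrakk> \<Longrightarrow> c \<odot> (x \<oplus> y) = c \<odot> x \<oplus> c \<odot> y"
  and cscale_assoc: "x \<in> carrier A \<Longrightarrow> (c * d) \<odot> x = c \<odot> (d \<odot> x)"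
  and cscale_one [simp]: "x \<in> carrier A \<Longrightarrow> 1 \<odot> x = x"
  and cscale_zero [simp]: "x \<in> carrier A \<Longrightarrow> 0 \<odot> x = \<zero>"
  using smult_l_distr smult_r_distr smult_assoc1 smult_one smult_l_null by auto

lemma (in complex_algebra) neg_add:
  assumes "x \<in> carrier A" shows "(-1) \<odot> x \<oplus> x = \<zero>"
  using assms cscale_add_left[of x "-1" 1] by simp

lemma (in complex_algebra) smult_neg: "x \<in> carrier A \<Longrightarrow> \<ominus> x = (-1) \<odot> x"
  using neg_add abelian_group.minus_equality[OF ring.is_abelian_group[OF ring_A]] by simp

lemma (in complex_algebra) eq_if_diff_zero:
  assumes "x \<in> carrier A" "y \<in> carrier A" "x \<oplus> (-1) \<odot> y = \<zero>" shows "x = y"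
proof -
  have "x = x \<oplus> ((-1) \<odot> y \<oplus> y)" using assms neg_add ring.ring_simprules[OF ring_A] by simp
  also have "\<dots> = (x \<oplus> (-1) \<odot> y) \<oplus> y"
    by (rule ring.ring_simprules(7)[OF ring_A, symmetric]) (use assms in auto)
  finally show ?thesis using assms ring.ring_simprules[OF ring_A] by simp
qed

lemma (in complex_star_algebra) star_zero [simp]: "star A \<zero> = \<zero>"
  using star_smult[of \<zero> 0] smult_l_null[of "star A \<zero>"] smult_l_null[of \<zero>] star_closed by simp

lemma (in complex_star_algebra) star_one [simp]: "star A \<one> = \<one>"
  using star_mult[of "star A \<one>" \<one>] star_star[of \<one>] star_closed[of \<one>] by simp

declare (in complex_star_algebra) star_closed [simp, intro] star_star [simp]

lemma (in complex_star_algebra) star_pow: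
  "x \<in> carrier A \<Longrightarrow> star A (x [^] (m::nat)) = star A x [^] m"
  by (induction m) (auto simp: star_mult monoid.nat_pow_closed[OF monoid_A] simp flip: monoid.nat_pow_Suc2[OF monoid_A])

section \<open>Cauchy--Schwarz for positive traces and the quotient by the kernel\<close>

locale tracial_algebra = complex_star_algebra A for A :: "('a, 'm) star_algebra_scheme" (structure) +
  fixes \<tau> :: "'a \<Rightarrow> complex"
  assumes positive_trace: "positive_trace A \<tau>"
begin

lemma tr_add: "x \<in> carrier A \<Longrightarrow> y \<in> carrier A \<Longrightarrow> \<tau> (x \<oplus> y) = \<tau> x + \<tau> y"
  and tr_smult: "x \<in> carrier A \<Longrightarrow> \<tau> (c \<odot> x) = c * \<tau> x"
  and tr_one [simp]: "\<tau> \<one> = 1"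
  and tr_pos: "x \<in> carrier A \<Longrightarrow> \<tau> (star A x \<otimes> x) \<in> \<real>\<^sub>\<ge>\<^sub>0"
  and tr_comm: "x \<in> carrier A \<Longrightarrow> y \<in> carrier A \<Longrightarrow> \<tau> (x \<otimes> y) = \<tau> (y \<otimes> x)"
  using positive_trace by (auto simp: positive_trace_def linear_functional_def)

lemma tr_zero [simp]: "\<tau> \<zero> = 0"
  using tr_smult[of \<zero> 0] smult_l_null[of \<zero>] by simp

lemma tr_expand:
  assumes "x \<in> carrier A" "y \<in> carrier A"
  shows "\<tau> (star A (x \<oplus> c \<odot> y) \<otimes> (x \<oplus> c \<odot> y)) =
    \<tau> (star A x \<otimes> x) + c * \<tau> (star A x \<otimes> y) + cnj c * \<tau> (star A y \<otimes> x) + cnj c * c * \<tau> (star A y \<otimes> y)"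
  using assms by (simp add: star_add star_smult A_l_distr A_r_distr tr_add tr_smult smult_mult_left smult_mult_right algebra_simps)

text \<open>Polarisation: the form is real at \<open>\<one> \<oplus> x\<close> and at
  \<open>\<one> \<oplus> \<i> \<odot> x\<close>, which yields the imaginary and the real part of the
  identity respectively.\<close>

lemma tr_star:
  assumes "x \<in> carrier A" shows "\<tau> (star A x) = cnj (\<tau> x)"
proof -
  have *: "Im (\<tau> (star A y \<otimes> y)) = 0" if "y \<in> carrier A" for y
    using tr_pos[OF that] by (simp add: complex_nonneg_Reals_iff)
  from *[of "\<one> \<oplus> 1 \<odot> x"] *[of "\<one> \<oplus> \<i> \<odot> x"] *[of x] show ?thesis
    using assms tr_expand[of \<one> x 1] tr_expand[of \<one> x \<i>] by (simp add: complex_eq_iff)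
qed

lemma tr_cs_form:
  assumes "x \<in> carrier A" "y \<in> carrier A"
  shows "(cmod (\<tau> (star A x \<otimes> y)))\<^sup>2 \<le> Re (\<tau> (star A x \<otimes> x)) * Re (\<tau> (star A y \<otimes> y))"
proof -
  define X where "X = Re (\<tau> (star A x \<otimes> x))"
  define Y where "Y = Re (\<tau> (star A y \<otimes> y))"
  define B where "B = \<tau> (star A x \<otimes> y)"
  have B': "\<tau> (star A y \<otimes> x) = cnj B"
    using tr_star[of "star A x \<otimes> y"] assms by (simp add: B_def star_mult)
  have pos: "0 \<le> Re (\<tau> (star A z \<otimes> z))" if "z \<in> carrier A" for z
    using tr_pos[OF that] by (simp add: complex_nonneg_Reals_iff)
  have "0 \<le> X" "0 \<le> Y" using pos assms by (auto simp: X_def Y_def)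
  have BB: "Re (B * cnj B) = (cmod B)\<^sup>2" "Re (cnj B * B) = (cmod B)\<^sup>2"
    by (simp_all add: complex_norm_square[symmetric] mult.commute flip: of_real_power)
  have key: "0 \<le> X - 2 * t * (cmod B)\<^sup>2 + t\<^sup>2 * (cmod B)\<^sup>2 * Y" for t :: real
  proof -
    \<comment> \<open>The phase of \<open>B\<close> is absorbed into \<open>c\<close>, so both cross
      terms become \<open>- t * (cmod B)\<^sup>2\<close> and a real quadratic in \<open>t\<close>
      remains.\<close>
    define c where "c = - (of_real t * cnj B)"
    have yI: "\<tau> (star A y \<otimes> y) = of_real Y"
      using tr_pos[OF assms(2)] by (simp add: complex_nonneg_Reals_iff Y_def complex_eq_iff)
    have "0 \<le> Re (\<tau> (star A (x \<oplus> c \<odot> y) \<otimes> (x \<oplus> c \<odot> y)))"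
      using pos assms by simp
    also have "\<dots> = Re (\<tau> (star A x \<otimes> x)) + Re (c * B) + Re (cnj c * cnj B) + Re (cnj c * c * of_real Y)"
      using assms B' yI by (simp add: tr_expand B_def)
    also have "Re (c * B) = - t * (cmod B)\<^sup>2"
      by (simp add: c_def cmod_def power2_eq_square algebra_simps)
    also have "Re (cnj c * cnj B) = - t * (cmod B)\<^sup>2"
      by (simp add: c_def cmod_def power2_eq_square algebra_simps)
    also have "Re (cnj c * c * of_real Y) = t\<^sup>2 * (cmod B)\<^sup>2 * Y"
      by (simp add: c_def cmod_def power2_eq_square algebra_simps)
    finally show ?thesis by (simp add: X_def)
  qed
  show ?thesis
  proof (cases "Y = 0")
    case True
    have "cmod B = 0"
    proof (rule ccontr)
      assume "cmod B \<noteq> 0"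
      then have "0 < (cmod B)\<^sup>2" by simp
      \<comment> \<open>For \<open>Y = 0\<close> the quadratic is linear in \<open>t\<close>, and
        this \<open>t\<close> brings it to \<open>- X - 2\<close>, which is negative.\<close>
      moreover have "0 \<le> X - 2 * ((X + 1) / (cmod B)\<^sup>2) * (cmod B)\<^sup>2"
        using key[of "(X + 1) / (cmod B)\<^sup>2"] True by simp
      ultimately show False using \<open>0 \<le> X\<close> by simp
    qed
    then show ?thesis using \<open>0 \<le> X\<close> \<open>0 \<le> Y\<close> by (simp add: B_def[symmetric] X_def[symmetric] Y_def[symmetric])
  next
    case False
    with \<open>0 \<le> Y\<close> have "Y > 0" by simp
    with key[of "1 / Y"] have "0 \<le> X - (cmod B)\<^sup>2 / Y" by (simp add: power2_eq_square field_simps)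
    then show ?thesis using \<open>Y > 0\<close> by (simp add: B_def[symmetric] X_def[symmetric] Y_def[symmetric] field_simps)
  qed
qed

lemma tr_real_pos: "x \<in> carrier A \<Longrightarrow> 0 \<le> Re (\<tau> (star A x \<otimes> x))"
  "x \<in> carrier A \<Longrightarrow> \<tau> (star A x \<otimes> x) = of_real (Re (\<tau> (star A x \<otimes> x)))"
  using tr_pos[of x] by (auto simp: complex_nonneg_Reals_iff complex_eq_iff)

lemma tr_cs:
  assumes "x \<in> carrier A" "y \<in> carrier A"
  shows "cmod (\<tau> (star A x \<otimes> y)) \<le> sqrt (Re (\<tau> (star A x \<otimes> x))) * sqrt (Re (\<tau> (star A y \<otimes> y)))"
  using tr_cs_form[OF assms] by (metis real_le_rsqrt real_sqrt_mult)


lemma kernel_iff: "x \<in> trace_kernel A \<tau> \<longleftrightarrow> x \<in> carrier A \<and> \<tau> (star A x \<otimes> x) = 0"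
  by (simp add: trace_kernel_def)

lemma kernel_carrier: "x \<in> trace_kernel A \<tau> \<Longrightarrow> x \<in> carrier A"
  by (simp add: kernel_iff)

text \<open>Cauchy--Schwarz: a null vector is orthogonal to everything. This makes
  \<open>trace_kernel\<close> a two-sided ideal and lets \<tau> descend to the quotient.\<close>

lemma kernel_orthogonal:
  assumes "x \<in> trace_kernel A \<tau>" "y \<in> carrier A"
  shows "\<tau> (star A x \<otimes> y) = 0" "\<tau> (y \<otimes> x) = 0" "\<tau> (star A y \<otimes> x) = 0" "\<tau> x = 0"
proof -
  have 1: "\<tau> (star A x \<otimes> y) = 0" if "y \<in> carrier A" for y
    using tr_cs[of x y] assms(1) that by (simp add: kernel_iff)
  have 2: "\<tau> (y \<otimes> x) = 0" if "y \<in> carrier A" for y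
    using 1[of "star A y"] tr_star[of "y \<otimes> x"] assms(1) that by (simp add: kernel_iff star_mult)
  show "\<tau> (star A x \<otimes> y) = 0" "\<tau> (y \<otimes> x) = 0" "\<tau> (star A y \<otimes> x) = 0" "\<tau> x = 0"
    using 1[of y] 2[of y] 2[of "star A y"] 2[of \<one>] assms by (auto simp: kernel_iff)
qed

lemma kernel_smult: "x \<in> trace_kernel A \<tau> \<Longrightarrow> c \<odot> x \<in> trace_kernel A \<tau>"
  by (simp add: kernel_iff star_smult smult_mult_left smult_mult_right tr_smult)

lemma kernel_add: "x \<in> trace_kernel A \<tau> \<Longrightarrow> y \<in> trace_kernel A \<tau> \<Longrightarrow> x \<oplus> y \<in> trace_kernel A \<tau>"
  using tr_expand[of x y 1] kernel_orthogonal[of x y] kernel_orthogonal[of x x] kernel_orthogonal[of y x] kernel_orthogonal[of y y]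
  by (simp add: kernel_carrier) (simp add: kernel_iff)

text \<open>The pairing of \<open>y \<otimes> x\<close> with itself is that of \<open>x\<close> with
  \<open>star A y \<otimes> (y \<otimes> x)\<close>, and \<open>x\<close> is orthogonal to
  everything.\<close>

lemma kernel_mult_left:
  assumes "x \<in> trace_kernel A \<tau>" "y \<in> carrier A" shows "y \<otimes> x \<in> trace_kernel A \<tau>"
  using kernel_orthogonal(1)[of x "star A y \<otimes> (y \<otimes> x)"] assms by (simp add: kernel_iff star_mult A_m_assoc)

lemma kernel_star: "x \<in> trace_kernel A \<tau> \<Longrightarrow> star A x \<in> trace_kernel A \<tau>"
  using tr_comm[of x "star A x"] by (simp add: kernel_iff)

lemma kernel_mult_right:
  assumes "x \<in> trace_kernel A \<tau>" "y \<in> carrier A" shows "x \<otimes> y \<in> trace_kernel A \<tau>"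
  using kernel_star[OF kernel_mult_left[OF kernel_star[OF assms(1)], of "star A y"]] assms
  by (simp add: star_mult kernel_iff)

lemma kernel_ideal: "ideal (trace_kernel A \<tau>) A"
proof (rule idealI)
  have ag: "abelian_group A" using ring.is_abelian_group[OF ring_A] .
  show "subgroup (trace_kernel A \<tau>) (add_monoid A)"
  proof (rule group.subgroupI)
    show "Group.group (add_monoid A)" using abelian_group.a_group[OF ag] .
    have "\<zero> \<in> trace_kernel A \<tau>" by (simp add: kernel_iff)
    then show "trace_kernel A \<tau> \<noteq> {}" by blast
    show "inv\<^bsub>add_monoid A\<^esub> a \<in> trace_kernel A \<tau>" if "a \<in> trace_kernel A \<tau>" for a
      using kernel_smult[OF that, of "-1"] smult_neg[OF kernel_carrier[OF that]] by (simp add: a_inv_def)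
  qed (auto simp: kernel_carrier kernel_add)
qed (auto simp: kernel_mult_left kernel_mult_right ring_A)

lemma coset_eq_iff:
  assumes "x \<in> carrier A" "y \<in> carrier A"
  shows "trace_kernel A \<tau> +> x = trace_kernel A \<tau> +> y \<longleftrightarrow> x \<oplus> (-1) \<odot> y \<in> trace_kernel A \<tau>"
proof -
  interpret J: ideal "trace_kernel A \<tau>" A by (rule kernel_ideal)
  show ?thesis
    using J.a_rcos_module_minus[OF ring_A assms(2,1)] J.a_repr_independence'[of x y]
       J.a_repr_independenceD[of y x] assms
    by (metis J.a_rcos_self smult_neg a_minus_def)
qed

text \<open>Star, scalars and trace send all representatives of a coset to one coset or one value,
  so the unions and the image in the definitions of quotient and induced trace collapse.\<close>

lemma coset_star:
  assumes x: "x \<in> carrier A"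
  shows "(\<Union>z\<in>trace_kernel A \<tau> +> x. trace_kernel A \<tau> +> star A z) = trace_kernel A \<tau> +> star A x"
    and "(\<Union>z\<in>trace_kernel A \<tau> +> x. trace_kernel A \<tau> +> (c \<odot> z)) = trace_kernel A \<tau> +> (c \<odot> x)"
    and "\<tau> ` (trace_kernel A \<tau> +> x) = {\<tau> x}"
proof -
  interpret J: ideal "trace_kernel A \<tau>" A by (rule kernel_ideal)
  have self: "x \<in> trace_kernel A \<tau> +> x" using x J.a_rcos_self by blast
  have z: "z \<in> carrier A \<and> z \<oplus> (-1) \<odot> x \<in> trace_kernel A \<tau>" if "z \<in> trace_kernel A \<tau> +> x" for z
    using that x J.a_repr_independenceD coset_eq_iff J.a_elemrcos_carrier J.a_repr_independence' by metis
  have "star A z \<oplus> (-1) \<odot> star A x \<in> trace_kernel A \<tau>" if "z \<in> trace_kernel A \<tau> +> x" for z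
    using kernel_star[OF conjunct2[OF z[OF that]]] z[OF that] x by (simp add: star_add star_smult)
  then have "trace_kernel A \<tau> +> star A z = trace_kernel A \<tau> +> star A x" if "z \<in> trace_kernel A \<tau> +> x" for z
    using that z x coset_eq_iff by simp
  with self show "(\<Union>z\<in>trace_kernel A \<tau> +> x. trace_kernel A \<tau> +> star A z) = trace_kernel A \<tau> +> star A x" by blast
  have "c \<odot> z \<oplus> (-1) \<odot> (c \<odot> x) \<in> trace_kernel A \<tau>" if "z \<in> trace_kernel A \<tau> +> x" for z
    using kernel_smult[OF conjunct2[OF z[OF that]], of c] z[OF that] x by (simp add: cscale_add_right flip: cscale_assoc)
  then have "trace_kernel A \<tau> +> (c \<odot> z) = trace_kernel A \<tau> +> (c \<odot> x)" if "z \<in> trace_kernel A \<tau> +> x" for z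
    using that z x coset_eq_iff by simp
  with self show "(\<Union>z\<in>trace_kernel A \<tau> +> x. trace_kernel A \<tau> +> (c \<odot> z)) = trace_kernel A \<tau> +> (c \<odot> x)" by blast
  have "\<tau> z = \<tau> x" if "z \<in> trace_kernel A \<tau> +> x" for z
    using kernel_orthogonal(4)[OF conjunct2[OF z[OF that]]] z[OF that] x by (simp add: tr_add tr_smult)
  with self show "\<tau> ` (trace_kernel A \<tau> +> x) = {\<tau> x}" by blast
qed

text \<open>The map \<open>r\<close> picks representatives and respects the operations only modulo
  the kernel; an independent choice of an approximating sequence for each element of
  \<open>B\<close> gives no more than that. Injectivity comes from preservation of the trace and
  faithfulness of \<sigma>.\<close>

lemma embedding_into_quotient:
  assumes B: "tracial_algebra B \<sigma>" "faithful B \<sigma>"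
    and r: "r \<in> carrier B \<rightarrow> carrier A"
    and add: "\<And>x y. x \<in> carrier B \<Longrightarrow> y \<in> carrier B \<Longrightarrow> r (x \<oplus>\<^bsub>B\<^esub> y) \<oplus> (-1) \<odot> (r x \<oplus> r y) \<in> trace_kernel A \<tau>"
    and mult: "\<And>x y. x \<in> carrier B \<Longrightarrow> y \<in> carrier B \<Longrightarrow> r (x \<otimes>\<^bsub>B\<^esub> y) \<oplus> (-1) \<odot> (r x \<otimes> r y) \<in> trace_kernel A \<tau>"
    and scale: "\<And>c x. x \<in> carrier B \<Longrightarrow> r (c \<odot>\<^bsub>B\<^esub> x) \<oplus> (-1) \<odot> (c \<odot> r x) \<in> trace_kernel A \<tau>"
    and star: "\<And>x. x \<in> carrier B \<Longrightarrow> r (star B x) \<oplus> (-1) \<odot> star A (r x) \<in> trace_kernel A \<tau>"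
    and one: "r \<one>\<^bsub>B\<^esub> \<oplus> (-1) \<odot> \<one> \<in> trace_kernel A \<tau>"
    and tr: "\<And>x. x \<in> carrier B \<Longrightarrow> \<tau> (r x) = \<sigma> x"
  shows "trace_preserving_embedding B \<sigma> (quotient_star_algebra A (trace_kernel A \<tau>)) (induced_trace \<tau>)
           (\<lambda>x. trace_kernel A \<tau> +> r x)"
proof -
  interpret J: ideal "trace_kernel A \<tau>" A by (rule kernel_ideal)
  interpret B: tracial_algebra B \<sigma> by (rule B)
  let ?J = "trace_kernel A \<tau>" and ?Q = "quotient_star_algebra A (trace_kernel A \<tau>)"
  let ?h = "\<lambda>x. trace_kernel A \<tau> +> r x"
  have rc [simp]: "r x \<in> carrier A" if "x \<in> carrier B" for x using r that by blast
  note Q = quotient_star_algebra_def FactRing_def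
  have hom: "?h \<in> carrier B \<rightarrow> carrier ?Q"
    using abelian_group.a_rcosetsI[OF ring.is_abelian_group[OF ring_A] J.a_subset rc] by (auto simp: Q)
  have hadd: "?h (x \<oplus>\<^bsub>B\<^esub> y) = ?h x \<oplus>\<^bsub>?Q\<^esub> ?h y" if "x \<in> carrier B" "y \<in> carrier B" for x y
    using add[OF that] that coset_eq_iff[of "r (x \<oplus>\<^bsub>B\<^esub> y)" "r x \<oplus> r y"] by (simp add: Q J.a_rcos_sum)
  have hmult: "?h (x \<otimes>\<^bsub>B\<^esub> y) = ?h x \<otimes>\<^bsub>?Q\<^esub> ?h y" if "x \<in> carrier B" "y \<in> carrier B" for x y
    using mult[OF that] that coset_eq_iff[of "r (x \<otimes>\<^bsub>B\<^esub> y)" "r x \<otimes> r y"] by (simp add: Q J.rcoset_mult_add)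
  have hscale: "?h (c \<odot>\<^bsub>B\<^esub> x) = c \<odot>\<^bsub>?Q\<^esub> ?h x" if "x \<in> carrier B" for c x
    using scale[OF that] that coset_eq_iff[of "r (c \<odot>\<^bsub>B\<^esub> x)" "c \<odot> r x"] by (simp add: Q coset_star)
  have hstar: "?h (star B x) = star ?Q (?h x)" if "x \<in> carrier B" for x
    using star[OF that] that coset_eq_iff[of "r (star B x)" "star A (r x)"] by (simp add: Q coset_star)
  have hone: "?h \<one>\<^bsub>B\<^esub> = \<one>\<^bsub>?Q\<^esub>"
    using one coset_eq_iff[of "r \<one>\<^bsub>B\<^esub>" \<one>] by (simp add: Q)
  have htr: "induced_trace \<tau> (?h x) = \<sigma> x" if "x \<in> carrier B" for x
    using that tr by (simp add: induced_trace_def coset_star)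
  have inj: "inj_on ?h (carrier B)"
  proof (rule inj_onI)
    fix x y assume xy: "x \<in> carrier B" "y \<in> carrier B" "?h x = ?h y"
    \<comment> \<open>If the cosets of \<open>r x\<close> and \<open>r y\<close> agree, then
      \<open>r d\<close> lies in the kernel, so \<tau> vanishes on \<open>r\<close> of
      \<open>star B d\<close> times \<open>d\<close>. This value is the \<sigma>-square of
      \<open>d\<close>.\<close>
    define d where "d = x \<oplus>\<^bsub>B\<^esub> (-1) \<odot>\<^bsub>B\<^esub> y"
    have d: "d \<in> carrier B" using xy by (simp add: d_def)
    have "?h d = ?h x \<oplus>\<^bsub>?Q\<^esub> (-1) \<odot>\<^bsub>?Q\<^esub> ?h x"
      unfolding d_def using hadd hscale xy by simp
    also have "\<dots> = ?J +> (r x \<oplus> (-1) \<odot> r x)"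
      using xy(1,2) by (simp add: Q coset_star J.a_rcos_sum)
    also have "r x \<oplus> (-1) \<odot> r x = \<zero>"
      using xy cscale_add_left[of "r x" 1 "-1"] by simp
    finally have "r d \<in> ?J"
      using d coset_eq_iff[of "r d" \<zero>] smult_r_null[of "-1"] by simp
    then have "star A (r d) \<otimes> r d \<in> ?J" using d kernel_mult_left by simp
    moreover have "r (star B d \<otimes>\<^bsub>B\<^esub> d) \<oplus> (-1) \<odot> (star A (r d) \<otimes> r d) \<in> ?J"
    proof -
      have "?h (star B d \<otimes>\<^bsub>B\<^esub> d) = ?J +> (star A (r d) \<otimes> r d)"
        using hmult[of "star B d" d] hstar[of d] d by (simp add: Q coset_star J.rcoset_mult_add)
      then show ?thesis using coset_eq_iff d by simp
    qed
    ultimately have "\<tau> (star A (r d) \<otimes> r d) = 0"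
      "\<tau> (r (star B d \<otimes>\<^bsub>B\<^esub> d) \<oplus> (-1) \<odot> (star A (r d) \<otimes> r d)) = 0"
      using kernel_orthogonal(4)[OF _ A_one_closed] by blast+
    then have "\<tau> (r (star B d \<otimes>\<^bsub>B\<^esub> d)) = 0"
      using d by (simp add: tr_add tr_smult)
    then have "d = \<zero>\<^bsub>B\<^esub>" using tr d B(2) by (simp add: faithful_def)
    then show "x = y"
      using xy(1,2) B.eq_if_diff_zero unfolding d_def by blast
  qed
  show ?thesis
    using hom hadd hmult hscale hstar hone htr inj
    by (simp add: trace_preserving_embedding_def complex_alg_embedding_def complex_alg_hom_def)
qed

end

lemma complex_star_algebraI:
  assumes "ring A"
    and "\<And>c x. x \<in> carrier A \<Longrightarrow> c \<odot>\<^bsub>A\<^esub> x \<in> carrier A"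
    and "\<And>c d x. x \<in> carrier A \<Longrightarrow> (c + d) \<odot>\<^bsub>A\<^esub> x = c \<odot>\<^bsub>A\<^esub> x \<oplus>\<^bsub>A\<^esub> d \<odot>\<^bsub>A\<^esub> x"
    and "\<And>c x y. \<lbrakk>x \<in> carrier A; y \<in> carrier A\<rbrakk> \<Longrightarrow> c \<odot>\<^bsub>A\<^esub> (x \<oplus>\<^bsub>A\<^esub> y) = c \<odot>\<^bsub>A\<^esub> x \<oplus>\<^bsub>A\<^esub> c \<odot>\<^bsub>A\<^esub> y"
    and "\<And>c d x. x \<in> carrier A \<Longrightarrow> (c * d) \<odot>\<^bsub>A\<^esub> x = c \<odot>\<^bsub>A\<^esub> (d \<odot>\<^bsub>A\<^esub> x)"
    and "\<And>x. x \<in> carrier A \<Longrightarrow> 1 \<odot>\<^bsub>A\<^esub> x = x"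
    and "\<And>c x y. \<lbrakk>x \<in> carrier A; y \<in> carrier A\<rbrakk> \<Longrightarrow> (c \<odot>\<^bsub>A\<^esub> x) \<otimes>\<^bsub>A\<^esub> y = c \<odot>\<^bsub>A\<^esub> (x \<otimes>\<^bsub>A\<^esub> y)"
    and "\<And>c x y. \<lbrakk>x \<in> carrier A; y \<in> carrier A\<rbrakk> \<Longrightarrow> x \<otimes>\<^bsub>A\<^esub> (c \<odot>\<^bsub>A\<^esub> y) = c \<odot>\<^bsub>A\<^esub> (x \<otimes>\<^bsub>A\<^esub> y)"
    and "\<And>x. x \<in> carrier A \<Longrightarrow> star A x \<in> carrier A"
    and "\<And>x. x \<in> carrier A \<Longrightarrow> star A (star A x) = x"
    and "\<And>x y. \<lbrakk>x \<in> carrier A; y \<in> carrier A\<rbrakk> \<Longrightarrow> star A (x \<oplus>\<^bsub>A\<^esub> y) = star A x \<oplus>\<^bsub>A\<^esub> star A y"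
    and "\<And>c x. x \<in> carrier A \<Longrightarrow> star A (c \<odot>\<^bsub>A\<^esub> x) = cnj c \<odot>\<^bsub>A\<^esub> star A x"
    and "\<And>x y. \<lbrakk>x \<in> carrier A; y \<in> carrier A\<rbrakk> \<Longrightarrow> star A (x \<otimes>\<^bsub>A\<^esub> y) = star A y \<otimes>\<^bsub>A\<^esub> star A x"
  shows "complex_star_algebra A"
proof -
  have "Module.module complex_ring A"
    by (rule moduleI) (use assms cring_complex_ring ring.is_abelian_group in auto)
  then show ?thesis
    using assms by (intro complex_star_algebra.intro complex_algebra.intro complex_star_algebra_axioms.intro complex_algebra_axioms.intro) auto
qed

text \<open>The operations of \<open>B\<close> may be given by arbitrary formulas in terms of chosen
  representatives; the listed equations along the surjection \<open>q\<close> already transport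
  every axiom.\<close>

lemma complex_star_algebra_image:
  fixes A :: "('a, 'm) star_algebra_scheme" and B :: "('b, 'n) star_algebra_scheme"
  assumes A: "complex_star_algebra A" and im: "carrier B = q ` carrier A"
    and add: "\<And>x y. x \<in> carrier A \<Longrightarrow> y \<in> carrier A \<Longrightarrow> q x \<oplus>\<^bsub>B\<^esub> q y = q (x \<oplus>\<^bsub>A\<^esub> y)"
    and mult: "\<And>x y. x \<in> carrier A \<Longrightarrow> y \<in> carrier A \<Longrightarrow> q x \<otimes>\<^bsub>B\<^esub> q y = q (x \<otimes>\<^bsub>A\<^esub> y)"
    and scale: "\<And>c x. x \<in> carrier A \<Longrightarrow> c \<odot>\<^bsub>B\<^esub> q x = q (c \<odot>\<^bsub>A\<^esub> x)"
    and star: "\<And>x. x \<in> carrier A \<Longrightarrow> star B (q x) = q (star A x)"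
    and zero: "\<zero>\<^bsub>B\<^esub> = q \<zero>\<^bsub>A\<^esub>" and one: "\<one>\<^bsub>B\<^esub> = q \<one>\<^bsub>A\<^esub>"
  shows "complex_star_algebra B"
proof -
  interpret A: complex_star_algebra A by (rule A)
  note R = ring.ring_simprules[OF A.ring_A]
  have "ring B"
  proof (rule ringI)
    show "abelian_group B"
    proof (rule abelian_groupI)
      fix x assume "x \<in> carrier B"
      then obtain x' where x': "x' \<in> carrier A" "x = q x'" by (auto simp: im)
      then have "q (\<ominus>\<^bsub>A\<^esub> x') \<oplus>\<^bsub>B\<^esub> x = \<zero>\<^bsub>B\<^esub>" by (simp add: add zero R)
      then show "\<exists>y\<in>carrier B. y \<oplus>\<^bsub>B\<^esub> x = \<zero>\<^bsub>B\<^esub>" using x' by (force simp: im R)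
    qed (auto simp: im add zero R)
    show "Group.monoid B"
      by (rule monoidI) (auto simp: im mult one R)
  qed (auto simp: im add mult R)
  then show ?thesis
    by (rule complex_star_algebraI)
       (auto simp: im add mult scale star A.cscale_add_left A.cscale_add_right A.cscale_assoc A.smult_mult_left
         A.smult_mult_right A.star_add A.star_smult A.star_mult)
qed


section \<open>Products of words with bounded moments\<close>

fun alternating :: "('a, 'm) star_algebra_scheme \<Rightarrow> 'a \<Rightarrow> nat \<Rightarrow> 'a list" where
  "alternating A c 0 = []"
| "alternating A c (Suc k) = c # alternating A (star A c) k"

definition list_star :: "('a, 'm) star_algebra_scheme \<Rightarrow> 'a list \<Rightarrow> 'a list" where
  "list_star A xs = rev (map (star A) xs)"

definition list_prod :: "('a, 'm) star_algebra_scheme \<Rightarrow> 'a list \<Rightarrow> 'a" where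
  "list_prod A xs = foldr (mult A) xs (one A)"

lemma length_alternating [simp]: "length (alternating A c k) = k"
  by (induction k arbitrary: c) auto

lemma take_alternating: "k \<le> l \<Longrightarrow> take k (alternating A c l) = alternating A c k"
proof (induction k arbitrary: c l)
  case (Suc k)
  then show ?case by (cases l) auto
qed simp

context complex_star_algebra
begin

lemma list_prod_simps [simp]: "list_prod A [] = \<one>" "list_prod A (x # xs) = x \<otimes> list_prod A xs"
  by (simp_all add: list_prod_def)

lemma list_prod_closed [simp, intro]: "set xs \<subseteq> carrier A \<Longrightarrow> list_prod A xs \<in> carrier A"
  by (induction xs) auto

lemma list_prod_append [simp]:
  "set xs \<subseteq> carrier A \<Longrightarrow> set ys \<subseteq> carrier A \<Longrightarrow> list_prod A (xs @ ys) = list_prod A xs \<otimes> list_prod A ys"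
  by (induction xs) (auto simp: A_m_assoc)

lemma list_star_closed: "set xs \<subseteq> carrier A \<Longrightarrow> set (list_star A xs) \<subseteq> carrier A"
  by (auto simp: list_star_def)

lemma list_prod_star: "set xs \<subseteq> carrier A \<Longrightarrow> list_prod A (list_star A xs) = star A (list_prod A xs)"
proof (induction xs)
  case (Cons x xs)
  then show ?case using list_star_closed[of xs] by (auto simp: list_star_def star_mult)
qed (simp add: list_star_def)

lemma alternating_snoc_even:
  "c \<in> carrier A \<Longrightarrow> alternating A c (2 * k) @ [c] = alternating A c (Suc (2 * k))"
  by (induction k arbitrary: c) auto

lemma alternating_snoc_odd:
  "c \<in> carrier A \<Longrightarrow> alternating A c (Suc (2 * k)) @ [star A c] = alternating A c (2 * Suc k)"
  using alternating_snoc_even[of "star A c" k] by simp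

text \<open>The last letter of the run is followed by its own star, so the alternation continues
  across the mirror, whatever the parity of \<open>k\<close>.\<close>

lemma alternating_reflect:
  "c \<in> carrier A \<Longrightarrow> alternating A c k @ list_star A (alternating A c k) = alternating A c (2 * k)"
proof (induction k arbitrary: c)
  case (Suc k)
  have "alternating A c (Suc k) @ list_star A (alternating A c (Suc k))
      = c # (alternating A (star A c) k @ list_star A (alternating A (star A c) k)) @ [star A c]"
    by (simp add: list_star_def)
  also have "\<dots> = c # alternating A (star A c) (2 * k) @ [star A c]"
    using Suc.IH[of "star A c"] Suc.prems by simp
  also have "\<dots> = alternating A c (2 * Suc k)"
    using alternating_snoc_even[of "star A c" k] Suc.prems by simp
  finally show ?case .
qed (simp add: list_star_def)

lemma set_alternating: "set (alternating A c k) \<subseteq> {c, star A c, star A (star A c)}" if "c \<in> carrier A"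
proof -
  have "set (alternating A c k) \<subseteq> {c, star A c}" if "c \<in> carrier A" for c k
    using that
  proof (induction k arbitrary: c)
    case (Suc k)
    then show ?case using Suc.IH[of "star A c"] by auto
  qed simp
  then show ?thesis using that by blast
qed

lemma list_prod_alternating:
  "c \<in> carrier A \<Longrightarrow> list_prod A (alternating A c (2 * m)) = (c \<otimes> star A c) [^] m"
proof (induction m)
  case (Suc m)
  have "list_prod A (alternating A c (2 * Suc m)) = c \<otimes> (star A c \<otimes> (c \<otimes> star A c) [^] m)"
    using Suc by simp
  then show ?case using Suc.prems monoid.nat_pow_Suc2[OF monoid_A, of "c \<otimes> star A c" m]
    by (simp add: A_m_assoc monoid.nat_pow_closed[OF monoid_A])
qed simp

end

context tracial_algebra
begin

lemma tr_rotate: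
  "set xs \<subseteq> carrier A \<Longrightarrow> set ys \<subseteq> carrier A \<Longrightarrow> \<tau> (list_prod A (xs @ ys)) = \<tau> (list_prod A (ys @ xs))"
  by (simp add: tr_comm)

text \<open>A chessboard estimate: among the words of length \<open>2 * m\<close> in finitely many letters, take one
  with maximal trace. Reflecting it (Cauchy--Schwarz) at the end of an alternating run \<open>c c\<^sup>* c \<dots>\<close>
  gives another maximal word, with a run of twice the length.\<close>

lemma chessboard:
  assumes S: "finite S" "S \<subseteq> carrier A" "\<And>c. c \<in> S \<Longrightarrow> star A c \<in> S"
    and K: "\<And>c. c \<in> S \<Longrightarrow> cmod (\<tau> ((c \<otimes> star A c) [^] m)) \<le> K"
    and w: "set w \<subseteq> S" "length w = 2 * m" and m: "m \<ge> 1"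
  shows "cmod (\<tau> (list_prod A w)) \<le> K"
proof -
  define W where "W = {xs. set xs \<subseteq> S \<and> length xs = 2 * m}"
  define f where "f xs = cmod (\<tau> (list_prod A xs))" for xs
  have fin: "finite (f ` W)" using finite_lists_length_eq[OF S(1)] by (simp add: W_def)
  have wW: "w \<in> W" using w by (simp add: W_def)
  define T where "T = Max (f ` W)"
  have le: "f xs \<le> T" if "xs \<in> W" for xs using that fin by (simp add: T_def)
  have "\<exists>xs\<in>W. f xs = T" using Max_in[OF fin] wW unfolding T_def by (metis empty_iff image_iff)
  then obtain xs0 where xs0: "xs0 \<in> W" "f xs0 = T" by blast
  have T0: "T \<ge> 0" using xs0(2) by (auto simp: f_def)
  have altS: "set (alternating A c k) \<subseteq> S" if "c \<in> S" for c k
    using set_alternating[of c k] that S by auto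
  have run: "\<exists>xs\<in>W. f xs = T \<and> (\<exists>c\<in>S. take k xs = alternating A c k)" if "1 \<le> k" "k \<le> 2 * m" for k
    using that
  proof (induction k rule: less_induct)
    case (less k)
    show ?case
    proof (cases "k = 1")
      case True
      have "xs0 \<noteq> []" using xs0 m by (auto simp: W_def)
      then obtain c ys where "xs0 = c # ys" by (cases xs0) auto
      then show ?thesis using xs0 True by (intro bexI[of _ xs0]) (auto simp: W_def)
    next
      case False
      \<comment> \<open>Half of \<open>k\<close> rounded up: reflecting a run of length
        \<open>j\<close> gives one of length \<open>2 * j \<ge> k\<close>, and \<open>j < k\<close>
        because \<open>k > 1\<close>.\<close>
      define j where "j = (k + 1) div 2"
      have j: "j < k" "1 \<le> j" "j \<le> m" "k \<le> 2 * j" using less.prems False unfolding j_def by auto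
      obtain xs c where xs: "xs \<in> W" "f xs = T" "c \<in> S" "take j xs = alternating A c j"
        using less.IH[of j] j by auto
      \<comment> \<open>Read cyclically, the word is \<open>r2\<close>, the run, \<open>r1\<close>.
        The cut before \<open>r1\<close> leaves two halves of length \<open>m\<close>, and the run
        ends the first half, where the reflection doubles it.\<close>
      define r1 where "r1 = take m (drop j xs)"
      define r2 where "r2 = drop m (drop j xs)"
      let ?a = "alternating A c j"
      have xs_eq: "xs = ?a @ r1 @ r2"
        by (simp only: r1_def r2_def xs(4)[symmetric] append_take_drop_id)
      have len: "length r1 = m" "length r2 = m - j" using xs(1) j by (auto simp: r1_def r2_def W_def)
      have sub: "set r1 \<subseteq> S" "set r2 \<subseteq> S" "set ?a \<subseteq> S" using xs(1) xs_eq unfolding W_def by auto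
      have subc: "set r1 \<subseteq> carrier A" "set r2 \<subseteq> carrier A" "set ?a \<subseteq> carrier A" using sub S(2) by auto
      have starS: "set (list_star A ys) \<subseteq> S" if "set ys \<subseteq> S" for ys
        using that S(3) by (auto simp: list_star_def)
      let ?u = "r2 @ ?a"
      let ?U = "?u @ list_star A ?u" and ?V = "list_star A r1 @ r1"
      have UW: "?U \<in> W" "?V \<in> W" using len j sub starS by (auto simp: W_def list_star_def dest: set_mp[OF starS])
      have uc: "list_prod A ?u \<in> carrier A" "list_prod A r1 \<in> carrier A" using subc by auto
      have su: "set ?u \<subseteq> carrier A" using subc by auto
      have "T = f (?u @ r1)"
        using tr_rotate[of "?a @ r1" r2] subc unfolding xs(2)[symmetric] f_def by (subst xs_eq) simp
      then have "T = cmod (\<tau> (star A (star A (list_prod A ?u)) \<otimes> list_prod A r1))"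
        using subc uc su list_prod_append[OF su subc(1)] by (simp add: f_def del: list_prod_append)
      then have "T\<^sup>2 \<le> Re (\<tau> (list_prod A ?u \<otimes> star A (list_prod A ?u))) * Re (\<tau> (star A (list_prod A r1) \<otimes> list_prod A r1))"
        using tr_cs_form[of "star A (list_prod A ?u)" "list_prod A r1"] uc by (simp del: list_prod_append)
      also have "\<dots> = Re (\<tau> (list_prod A ?U)) * Re (\<tau> (list_prod A ?V))"
      proof -
        have "list_prod A ?U = list_prod A ?u \<otimes> star A (list_prod A ?u)"
          using list_prod_append[OF su list_star_closed[OF su]] list_prod_star[OF su] by simp
        moreover have "list_prod A ?V = star A (list_prod A r1) \<otimes> list_prod A r1"
          using list_prod_append[OF list_star_closed[OF subc(1)] subc(1)] list_prod_star[OF subc(1)] by simp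
        ultimately show ?thesis by simp
      qed
      also have "\<dots> \<le> f ?U * f ?V"
      proof -
        have "Re (\<tau> (list_prod A ?U)) * Re (\<tau> (list_prod A ?V)) \<le> \<bar>Re (\<tau> (list_prod A ?U))\<bar> * \<bar>Re (\<tau> (list_prod A ?V))\<bar>"
          by (metis abs_ge_self abs_mult)
        also have "\<dots> \<le> f ?U * f ?V" unfolding f_def by (intro mult_mono abs_Re_le_cmod) auto
        finally show ?thesis .
      qed
      also have "\<dots> \<le> f ?U * T" using le[OF UW(2)] by (intro mult_left_mono) (auto simp: f_def)
      finally have "T * T \<le> f ?U * T" by (simp add: power2_eq_square)
      \<comment> \<open>The other inequality is maximality of \<open>T\<close>. If
        \<open>T = 0\<close>, nothing can be cancelled, but then \<open>f ?U\<close> is squeezed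
        between 0 and \<open>T\<close>.\<close>
      then have fU: "f ?U = T"
        using le[OF UW(1)] T0 by (cases "T = 0") (auto simp: f_def intro: antisym)
      have U_eq: "?U = r2 @ alternating A c (2 * j) @ list_star A r2"
        using alternating_reflect[of c j] xs(3) S(2) by (auto simp: list_star_def)
      \<comment> \<open>A rotation brings the doubled run back to the front, where
        \<open>take k\<close> looks for it.\<close>
      let ?Z = "alternating A c (2 * j) @ list_star A r2 @ r2"
      have aS: "set (alternating A c (2*j)) \<subseteq> S" using altS xs(3) by blast
      have "set (alternating A c (2 * j) @ list_star A r2) \<subseteq> carrier A"
        using aS starS[OF sub(2)] S(2) by auto
      then have "f ?Z = T"
        using tr_rotate[of r2 "alternating A c (2 * j) @ list_star A r2"] subc fU U_eq by (simp add: f_def)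
      moreover have "?Z \<in> W" using aS starS[OF sub(2)] sub j len by (auto simp: W_def list_star_def)
      moreover have "take k ?Z = alternating A c k" using j(4) by (simp add: take_alternating)
      ultimately show ?thesis using xs(3) by blast
    qed
  qed
  obtain xs c where xs: "xs \<in> W" "f xs = T" "c \<in> S" "take (2 * m) xs = alternating A c (2 * m)"
    using run[of "2 * m"] m by auto
  then have "xs = alternating A c (2 * m)" by (simp add: W_def)
  then have "T = cmod (\<tau> ((c \<otimes> star A c) [^] m))"
    using xs(2,3) S(2) list_prod_alternating[of c m] by (auto simp: f_def)
  then show ?thesis using le[OF wW] K[OF xs(3)] by (simp add: f_def)
qed

end


section \<open>Moments of sums, products and scalar multiples\<close>

context tracial_algebra
begin

text \<open>Write the moment as the trace of an alternating word and move its first letter to the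
  end.\<close>

lemma tr_moment_star:
  assumes "c \<in> carrier A" shows "\<tau> ((c \<otimes> star A c) [^] m) = \<tau> ((star A c \<otimes> c) [^] (m::nat))"
proof (cases m)
  case (Suc k)
  have "\<tau> (list_prod A (alternating A c (2 * m))) = \<tau> (list_prod A (alternating A (star A c) (Suc (2 * k)) @ [c]))"
    using tr_rotate[of "[c]" "alternating A (star A c) (Suc (2 * k))"] set_alternating[of "star A c" "Suc (2 * k)"] assms Suc
    by fastforce
  also have "alternating A (star A c) (Suc (2 * k)) @ [c] = alternating A (star A c) (2 * m)"
    using alternating_snoc_odd[of "star A c" k] assms Suc by simp
  finally show ?thesis using list_prod_alternating[of c m] list_prod_alternating[of "star A c" m] assms by simp
qed simp

text \<open>The power is selfadjoint, so its trace is real. The absolute value stands in for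
  nonnegativity of the moment and commutes with \<open>root\<close>.\<close>

lemma cmod_moment:
  "c \<in> carrier A \<Longrightarrow> cmod (\<tau> ((star A c \<otimes> c) [^] (m::nat))) = \<bar>Re (\<tau> ((star A c \<otimes> c) [^] m))\<bar>"
  using tr_star[of "(star A c \<otimes> c) [^] m"] star_pow[of "star A c \<otimes> c" m]
  by (simp add: star_mult monoid.nat_pow_closed[OF monoid_A] complex_eq_iff cmod_eq_Re)

lemma abs_trace_norm:
  "c \<in> carrier A \<Longrightarrow> \<bar>trace_norm A \<tau> (2 * m) c\<bar> = root (2 * m) (cmod (\<tau> ((star A c \<otimes> c) [^] m)))"
  by (cases "m = 0") (simp_all add: trace_norm_def cmod_moment real_root_abs)

lemma word_bound:
  assumes ab: "a \<in> carrier A" "b \<in> carrier A"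
    and K: "cmod (\<tau> ((star A a \<otimes> a) [^] m)) \<le> K" "cmod (\<tau> ((star A b \<otimes> b) [^] m)) \<le> K"
    and w: "set w \<subseteq> {a, b, star A a, star A b}" "length w = 2 * m" "m \<ge> 1"
  shows "cmod (\<tau> (list_prod A w)) \<le> K"
proof (rule chessboard[OF _ _ _ _ w])
  fix c assume "c \<in> {a, b, star A a, star A b}"
  then show "cmod (\<tau> ((c \<otimes> star A c) [^] m)) \<le> K"
    using K ab tr_moment_star[of a m] tr_moment_star[of b m] by auto
qed (use ab in auto)

text \<open>The word \<open>w\<close> collects the letters already chosen, and \<open>j\<close>
  counts the factors still to be expanded. Each factor splits into four words, and after the last
  one \<open>word_bound\<close> applies to every word of length \<open>2 * m\<close>.\<close>

lemma sum_word_bound: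
  assumes ab: "a \<in> carrier A" "b \<in> carrier A"
    and K: "cmod (\<tau> ((star A a \<otimes> a) [^] m)) \<le> K" "cmod (\<tau> ((star A b \<otimes> b) [^] m)) \<le> K"
    and m: "m \<ge> 1"
  shows "set w \<subseteq> {a, b, star A a, star A b} \<Longrightarrow> length w + 2 * j = 2 * m \<Longrightarrow>
    cmod (\<tau> (list_prod A w \<otimes> (star A (a \<oplus> b) \<otimes> (a \<oplus> b)) [^] j)) \<le> 4 ^ j * K"
proof (induction j arbitrary: w)
  case 0
  have "set w \<subseteq> carrier A" using 0 ab by auto
  then show ?case using word_bound[OF ab K _ _ m, of w] 0 by simp
next
  case (Suc j)
  define Z where "Z = (star A (a \<oplus> b) \<otimes> (a \<oplus> b)) [^] j"
  have Z: "Z \<in> carrier A" using ab by (simp add: Z_def monoid.nat_pow_closed[OF monoid_A])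
  have wc: "set w \<subseteq> carrier A" using Suc.prems ab by auto
  let ?t = "\<lambda>x y. \<tau> (list_prod A (w @ [x, y]) \<otimes> Z)"
  have "list_prod A w \<otimes> (star A (a \<oplus> b) \<otimes> (a \<oplus> b)) [^] Suc j =
      list_prod A w \<otimes> ((star A a \<oplus> star A b) \<otimes> ((a \<oplus> b) \<otimes> Z))"
    using ab Z monoid.nat_pow_Suc2[OF monoid_A, of "star A (a \<oplus> b) \<otimes> (a \<oplus> b)" j]
    by (simp add: star_add A_m_assoc Z_def)
  then have "\<tau> (list_prod A w \<otimes> (star A (a \<oplus> b) \<otimes> (a \<oplus> b)) [^] Suc j) =
      ?t (star A a) a + ?t (star A a) b + (?t (star A b) a + ?t (star A b) b)"
    using ab Z wc by (simp add: A_l_distr A_r_distr tr_add A_m_assoc)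
  moreover have "cmod (?t x y) \<le> 4 ^ j * K" if "x \<in> {star A a, star A b}" "y \<in> {a, b}" for x y
    using Suc.IH[of "w @ [x, y]"] Suc.prems that by (auto simp: Z_def)
  then have "cmod (?t (star A a) a) \<le> 4 ^ j * K" "cmod (?t (star A a) b) \<le> 4 ^ j * K"
    "cmod (?t (star A b) a) \<le> 4 ^ j * K" "cmod (?t (star A b) b) \<le> 4 ^ j * K" by blast+
  then have "cmod (?t (star A a) a + ?t (star A a) b + (?t (star A b) a + ?t (star A b) b))
      \<le> (4 ^ j * K + 4 ^ j * K) + (4 ^ j * K + 4 ^ j * K)"
    by (intro norm_triangle_mono)
  ultimately show ?case by (simp add: algebra_simps)
qed

lemma moment_add_bound:
  assumes ab: "a \<in> carrier A" "b \<in> carrier A"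
    and K: "cmod (\<tau> ((star A a \<otimes> a) [^] m)) \<le> K" "cmod (\<tau> ((star A b \<otimes> b) [^] m)) \<le> K"
    and m: "m \<ge> 1"
  shows "cmod (\<tau> ((star A (a \<oplus> b) \<otimes> (a \<oplus> b)) [^] m)) \<le> 4 ^ m * K"
  using sum_word_bound[OF assms, of "[]" m] ab by (simp add: monoid.nat_pow_closed[OF monoid_A])

text \<open>A substitute for Hoelder's inequality: the \<open>m\<close>-th moment of
  \<open>a \<otimes> b\<close> is the trace of a word of length \<open>4 * m\<close> in
  \<open>a\<close>, \<open>b\<close> and their stars, hence the exponent \<open>2 * m\<close> in the
  hypotheses.\<close>

lemma moment_mult_bound:
  assumes ab: "a \<in> carrier A" "b \<in> carrier A"
    and K: "cmod (\<tau> ((star A a \<otimes> a) [^] (2 * m :: nat))) \<le> K" "cmod (\<tau> ((star A b \<otimes> b) [^] (2 * m))) \<le> K"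
    and m: "m \<ge> 1"
  shows "cmod (\<tau> ((star A (a \<otimes> b) \<otimes> (a \<otimes> b)) [^] m)) \<le> K"
proof -
  define w where "w m = concat (replicate m [star A b, star A a, a, b])" for m
  have sub: "set (w m) \<subseteq> {a, b, star A a, star A b}" for m by (auto simp: w_def)
  have len: "length (w m) = 2 * (2 * m)" for m by (induction m) (auto simp: w_def)
  have "list_prod A (w m) = (star A (a \<otimes> b) \<otimes> (a \<otimes> b)) [^] m" for m
  proof (induction m)
    case (Suc m)
    have "list_prod A (w (Suc m)) = star A b \<otimes> (star A a \<otimes> (a \<otimes> (b \<otimes> list_prod A (w m))))"
      by (simp add: w_def)
    then show ?case using Suc ab monoid.nat_pow_Suc2[OF monoid_A, of "star A (a \<otimes> b) \<otimes> (a \<otimes> b)" m]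
      by (simp add: star_mult A_m_assoc monoid.nat_pow_closed[OF monoid_A])
  qed (simp add: w_def)
  then show ?thesis using word_bound[OF ab K sub len] m by simp
qed

lemma pow_smult: "a \<in> carrier A \<Longrightarrow> (c \<odot> a) [^] (m::nat) = c ^ m \<odot> a [^] m"
  by (induction m) (simp_all add: smult_mult_left smult_mult_right monoid.nat_pow_closed[OF monoid_A] mult.commute flip: cscale_assoc)

lemma moment_smult:
  assumes "a \<in> carrier A"
  shows "cmod (\<tau> ((star A (c \<odot> a) \<otimes> (c \<odot> a)) [^] (m::nat))) = cmod c ^ (2 * m) * cmod (\<tau> ((star A a \<otimes> a) [^] m))"
proof -
  have "star A (c \<odot> a) \<otimes> (c \<odot> a) = (c * cnj c) \<odot> (star A a \<otimes> a)"
    using assms by (simp add: star_smult smult_mult_left smult_mult_right mult.commute flip: cscale_assoc)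
  moreover have "cmod (c * cnj c) ^ m = cmod c ^ (2 * m)"
    by (simp add: norm_mult power_mult power2_eq_square)
  ultimately show ?thesis using assms
    by (simp add: pow_smult tr_smult monoid.nat_pow_closed[OF monoid_A] norm_mult norm_power)
qed

lemma cmod_trace_le: "a \<in> carrier A \<Longrightarrow> cmod (\<tau> a) \<le> sqrt (cmod (\<tau> (star A a \<otimes> a)))"
  using tr_cs[of \<one> a] complex_Re_le_cmod[of "\<tau> (star A a \<otimes> a)"]
  by (simp add: order.trans[OF _ real_sqrt_le_mono])

end

section \<open>Bounded products and ultraproducts\<close>

locale tracial_family =
  fixes I :: "'i set" and A :: "'i \<Rightarrow> ('a, 'm) star_algebra_scheme" and \<tau> :: "'i \<Rightarrow> 'a \<Rightarrow> complex"
  assumes tracial: "i \<in> I \<Longrightarrow> tracial_algebra (A i) (\<tau> i)"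
begin

lemma star_algebra: "i \<in> I \<Longrightarrow> complex_star_algebra (A i)"
  using tracial tracial_algebra.axioms by blast

lemma complex_alg: "i \<in> I \<Longrightarrow> complex_algebra (A i)"
  using star_algebra complex_star_algebra.axioms by blast

lemmas fam_ring = complex_algebra.ring_A[OF complex_alg]

abbreviation moment :: "nat \<Rightarrow> 'i \<Rightarrow> 'a \<Rightarrow> complex" where
  "moment m i a \<equiv> \<tau> i ((star (A i) a \<otimes>\<^bsub>A i\<^esub> a) [^]\<^bsub>A i\<^esub> m)"

text \<open>Passing from norms to moments removes the roots: with \<open>p = 2 * m\<close>, a bound
  \<open>B\<close> for the norms and a bound for the moments differ by a power. The bound
  \<open>K\<close> may depend on \<open>m\<close> but not on \<open>i\<close>.\<close>

lemma bounded_families_iff: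
  "a \<in> bounded_families I A \<tau> \<longleftrightarrow> a \<in> (\<Pi>\<^sub>E i\<in>I. carrier (A i)) \<and> (\<forall>m\<ge>1. \<exists>K. \<forall>i\<in>I. cmod (moment m i (a i)) \<le> K)"
proof -
  have "(\<forall>p\<ge>2. even p \<longrightarrow> bounded ((\<lambda>i. trace_norm (A i) (\<tau> i) p (a i)) ` I)) \<longleftrightarrow>
     (\<forall>m\<ge>1. \<exists>K. \<forall>i\<in>I. cmod (moment m i (a i)) \<le> K)" if a: "a \<in> (\<Pi>\<^sub>E i\<in>I. carrier (A i))"
  proof -
    have abs: "\<bar>trace_norm (A i) (\<tau> i) (2 * m) (a i)\<bar> = root (2 * m) (cmod (moment m i (a i)))" if "i \<in> I" for i m
      using tracial_algebra.abs_trace_norm[OF tracial[OF that]] a that by auto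
    have "bounded ((\<lambda>i. trace_norm (A i) (\<tau> i) (2 * m) (a i)) ` I) \<longleftrightarrow> (\<exists>K. \<forall>i\<in>I. cmod (moment m i (a i)) \<le> K)"
      if m: "m \<ge> 1" for m
    proof
      assume "bounded ((\<lambda>i. trace_norm (A i) (\<tau> i) (2 * m) (a i)) ` I)"
      then obtain B where B: "\<bar>trace_norm (A i) (\<tau> i) (2 * m) (a i)\<bar> \<le> B" if "i \<in> I" for i
        by (auto simp: bounded_iff)
      have "cmod (moment m i (a i)) \<le> B ^ (2 * m)" if "i \<in> I" for i
      proof -
        have "cmod (moment m i (a i)) = root (2 * m) (cmod (moment m i (a i))) ^ (2 * m)"
          using m by (simp add: real_root_pow_pos2)
        also have "\<dots> \<le> B ^ (2 * m)" using B[OF that] abs[OF that, of m] m by (intro power_mono) auto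
        finally show ?thesis .
      qed
      then show "\<exists>K. \<forall>i\<in>I. cmod (moment m i (a i)) \<le> K" by blast
    next
      assume "\<exists>K. \<forall>i\<in>I. cmod (moment m i (a i)) \<le> K"
      then obtain K where K: "cmod (moment m i (a i)) \<le> K" if "i \<in> I" for i by blast
      then show "bounded ((\<lambda>i. trace_norm (A i) (\<tau> i) (2 * m) (a i)) ` I)"
        unfolding bounded_iff using abs m by (intro exI[of _ "root (2 * m) K"]) auto
    qed
    moreover have "(\<forall>p\<ge>2. even p \<longrightarrow> P p) \<longleftrightarrow> (\<forall>m\<ge>1. P (2 * m))" for P :: "nat \<Rightarrow> bool"
      by (auto elim!: evenE)
    ultimately show ?thesis by simp
  qed
  then show ?thesis by (auto simp: bounded_families_def)
qed

lemma bounded_families_carrier: "a \<in> bounded_families I A \<tau> \<Longrightarrow> i \<in> I \<Longrightarrow> a i \<in> carrier (A i)"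
  by (auto simp: bounded_families_def)

lemma bounded_families_extensional: "a \<in> bounded_families I A \<tau> \<Longrightarrow> a \<in> extensional I"
  by (auto simp: bounded_families_def PiE_def)

lemma bounded_familiesE:
  assumes "a \<in> bounded_families I A \<tau>" "b \<in> bounded_families I A \<tau>" "m \<ge> 1"
  obtains K where "\<And>i. i \<in> I \<Longrightarrow> cmod (moment m i (a i)) \<le> K" "\<And>i. i \<in> I \<Longrightarrow> cmod (moment m i (b i)) \<le> K"
proof -
  obtain K1 K2 where "\<forall>i\<in>I. cmod (moment m i (a i)) \<le> K1" "\<forall>i\<in>I. cmod (moment m i (b i)) \<le> K2"
    using assms unfolding bounded_families_iff by meson
  then show ?thesis by (intro that[of "max K1 K2"]) (auto simp: le_max_iff_disj)
qed

lemma bounded_families_one: "(\<lambda>i\<in>I. \<one>\<^bsub>A i\<^esub>) \<in> bounded_families I A \<tau>"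
proof -
  have "moment m i \<one>\<^bsub>A i\<^esub> = 1" if "i \<in> I" for m i
  proof -
    interpret tracial_algebra "A i" "\<tau> i" by (rule tracial[OF that])
    show ?thesis by (simp add: monoid.nat_pow_one[OF monoid_A])
  qed
  then show ?thesis
    unfolding bounded_families_iff using fam_ring by (auto simp: ring.ring_simprules intro!: exI[of _ 1])
qed

lemma bounded_families_add:
  assumes "a \<in> bounded_families I A \<tau>" "b \<in> bounded_families I A \<tau>"
  shows "(\<lambda>i\<in>I. a i \<oplus>\<^bsub>A i\<^esub> b i) \<in> bounded_families I A \<tau>"
  unfolding bounded_families_iff
proof (intro conjI allI impI)
  show "(\<lambda>i\<in>I. a i \<oplus>\<^bsub>A i\<^esub> b i) \<in> (\<Pi>\<^sub>E i\<in>I. carrier (A i))"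
    using assms fam_ring by (auto simp: ring.ring_simprules bounded_families_carrier)
  fix m :: nat assume m: "m \<ge> 1"
  obtain K where "\<And>i. i \<in> I \<Longrightarrow> cmod (moment m i (a i)) \<le> K" "\<And>i. i \<in> I \<Longrightarrow> cmod (moment m i (b i)) \<le> K"
    using bounded_familiesE[OF assms m] by blast
  then show "\<exists>K. \<forall>i\<in>I. cmod (moment m i ((\<lambda>i\<in>I. a i \<oplus>\<^bsub>A i\<^esub> b i) i)) \<le> K"
    using tracial_algebra.moment_add_bound[OF tracial] assms m
    by (intro exI[of _ "4 ^ m * K"]) (auto simp: bounded_families_carrier)
qed

lemma bounded_families_mult:
  assumes "a \<in> bounded_families I A \<tau>" "b \<in> bounded_families I A \<tau>"
  shows "(\<lambda>i\<in>I. a i \<otimes>\<^bsub>A i\<^esub> b i) \<in> bounded_families I A \<tau>"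
  unfolding bounded_families_iff
proof (intro conjI allI impI)
  show "(\<lambda>i\<in>I. a i \<otimes>\<^bsub>A i\<^esub> b i) \<in> (\<Pi>\<^sub>E i\<in>I. carrier (A i))"
    using assms fam_ring by (auto simp: ring.ring_simprules bounded_families_carrier)
  fix m :: nat assume m: "m \<ge> 1"
  then have "2 * m \<ge> 1" by simp
  then obtain K where "\<And>i. i \<in> I \<Longrightarrow> cmod (moment (2 * m) i (a i)) \<le> K" "\<And>i. i \<in> I \<Longrightarrow> cmod (moment (2 * m) i (b i)) \<le> K"
    using bounded_familiesE[OF assms] by metis
  then show "\<exists>K. \<forall>i\<in>I. cmod (moment m i ((\<lambda>i\<in>I. a i \<otimes>\<^bsub>A i\<^esub> b i) i)) \<le> K"
    using tracial_algebra.moment_mult_bound[OF tracial] assms m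
    by (intro exI[of _ K]) (auto simp: bounded_families_carrier)
qed

lemma bounded_families_smult:
  assumes "a \<in> bounded_families I A \<tau>"
  shows "(\<lambda>i\<in>I. c \<odot>\<^bsub>A i\<^esub> a i) \<in> bounded_families I A \<tau>"
  unfolding bounded_families_iff
proof (intro conjI allI impI)
  show "(\<lambda>i\<in>I. c \<odot>\<^bsub>A i\<^esub> a i) \<in> (\<Pi>\<^sub>E i\<in>I. carrier (A i))"
    using assms complex_alg by (auto simp: complex_algebra.smult_carrier bounded_families_carrier)
  fix m :: nat assume m: "m \<ge> 1"
  obtain K where "\<And>i. i \<in> I \<Longrightarrow> cmod (moment m i (a i)) \<le> K"
    using assms m unfolding bounded_families_iff by meson
  then show "\<exists>K. \<forall>i\<in>I. cmod (moment m i ((\<lambda>i\<in>I. c \<odot>\<^bsub>A i\<^esub> a i) i)) \<le> K"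
    using tracial_algebra.moment_smult[OF tracial] assms m
    by (intro exI[of _ "cmod c ^ (2 * m) * K"]) (auto simp: bounded_families_carrier mult_left_mono)
qed

lemma bounded_families_star:
  assumes "a \<in> bounded_families I A \<tau>"
  shows "(\<lambda>i\<in>I. star (A i) (a i)) \<in> bounded_families I A \<tau>"
  unfolding bounded_families_iff
proof (intro conjI allI impI)
  show "(\<lambda>i\<in>I. star (A i) (a i)) \<in> (\<Pi>\<^sub>E i\<in>I. carrier (A i))"
    using assms star_algebra by (auto simp: complex_star_algebra.star_closed bounded_families_carrier)
  fix m :: nat assume m: "m \<ge> 1"
  obtain K where "\<And>i. i \<in> I \<Longrightarrow> cmod (moment m i (a i)) \<le> K"
    using assms m unfolding bounded_families_iff by meson
  then show "\<exists>K. \<forall>i\<in>I. cmod (moment m i ((\<lambda>i\<in>I. star (A i) (a i)) i)) \<le> K"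
    using tracial_algebra.tr_moment_star[OF tracial] assms m
    by (intro exI[of _ K]) (auto simp: bounded_families_carrier complex_star_algebra.star_star[OF star_algebra])
qed


lemma bounded_product_star_algebra: "complex_star_algebra (bounded_product I A \<tau>)" (is "complex_star_algebra ?P")
proof -
  note R = ring.ring_simprules[OF fam_ring]
  note bc [simp] = bounded_families_carrier
  have ext: "x = y" if "x \<in> bounded_families I A \<tau>" "y \<in> bounded_families I A \<tau>" "\<And>i. i \<in> I \<Longrightarrow> x i = y i" for x y
    using that by (metis bounded_families_extensional extensionalityI)
  have ext1: "(\<lambda>i\<in>I. x i) = y" if "y \<in> bounded_families I A \<tau>" "\<And>i. i \<in> I \<Longrightarrow> x i = y i" for x y
    using that bounded_families_extensional[OF that(1)] by (auto simp: fun_eq_iff extensional_def)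
  note cl = bounded_families_add bounded_families_mult bounded_families_smult bounded_families_star bounded_families_one
  have zero: "(\<lambda>i\<in>I. \<zero>\<^bsub>A i\<^esub>) \<in> bounded_families I A \<tau>"
  proof -
    have "(\<lambda>i\<in>I. \<zero>\<^bsub>A i\<^esub>) = (\<lambda>i\<in>I. 0 \<odot>\<^bsub>A i\<^esub> ((\<lambda>i\<in>I. \<one>\<^bsub>A i\<^esub>) i))"
      by (auto simp: restrict_def complex_algebra.cscale_zero[OF complex_alg] R)
    then show ?thesis using bounded_families_smult[OF bounded_families_one, of 0] by simp
  qed
  have "ring ?P"
  proof (rule ringI)
    show "abelian_group ?P"
    proof (rule abelian_groupI)
      fix x assume x: "x \<in> carrier ?P"
      then have xb: "x \<in> bounded_families I A \<tau>" by (simp add: bounded_product_def)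
      define y where "y = (\<lambda>i\<in>I. (-1) \<odot>\<^bsub>A i\<^esub> x i)"
      have y: "y \<in> bounded_families I A \<tau>" unfolding y_def by (rule bounded_families_smult[OF xb])
      have "y i \<oplus>\<^bsub>A i\<^esub> x i = \<zero>\<^bsub>A i\<^esub>" if "i \<in> I" for i
        using that xb complex_algebra.neg_add[OF complex_alg[OF that]] by (simp add: y_def)
      then have "y \<oplus>\<^bsub>?P\<^esub> x = \<zero>\<^bsub>?P\<^esub>"
        by (auto simp: bounded_product_def restrict_def)
      then show "\<exists>y\<in>carrier ?P. y \<oplus>\<^bsub>?P\<^esub> x = \<zero>\<^bsub>?P\<^esub>" using y by (auto simp: bounded_product_def)
    qed (auto simp: bounded_product_def cl zero R intro!: ext1 restrict_ext)
    show "Group.monoid ?P"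
      by (rule monoidI) (auto simp: bounded_product_def cl R complex_algebra.A_r_one[OF complex_alg] intro!: ext1 restrict_ext)
  qed (auto simp: bounded_product_def cl R intro!: restrict_ext)
  then show ?thesis
    by (rule complex_star_algebraI)
      (auto simp: bounded_product_def cl intro!: ext1 restrict_ext simp: complex_algebra.cscale_add_left[OF complex_alg]
        complex_algebra.cscale_add_right[OF complex_alg] complex_algebra.cscale_assoc[OF complex_alg]
        complex_algebra.cscale_one[OF complex_alg]
        complex_algebra.smult_mult_left[OF complex_alg] complex_algebra.smult_mult_right[OF complex_alg]
        complex_star_algebra.star_star[OF star_algebra] complex_star_algebra.star_add[OF star_algebra]
        complex_star_algebra.star_smult[OF star_algebra] complex_star_algebra.star_mult[OF star_algebra])
qed

end

text \<open>By compactness of the ball the image filter has a cluster point. For an ultrafilter it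
  is a limit: otherwise the complement of some neighbourhood would belong to the image
  filter.\<close>

lemma ultrafilter_bounded_convergent:
  fixes f :: "'i \<Rightarrow> complex"
  assumes \<omega>: "ultrafilter_on I \<omega>" and K: "\<And>i. i \<in> I \<Longrightarrow> cmod (f i) \<le> K"
  obtains l where "(f \<longlongrightarrow> l) \<omega>"
proof -
  have ne: "\<omega> \<noteq> bot" and evI: "eventually (\<lambda>i. i \<in> I) \<omega>" and um: "eventually P \<omega> \<or> eventually (\<lambda>i. \<not> P i) \<omega>" for P
    using \<omega> by (auto simp: ultrafilter_on_def)
  let ?F = "filtermap f \<omega>"
  have "eventually (\<lambda>x. x \<in> cball 0 K) ?F"
    using evI by (auto simp: eventually_filtermap K elim!: eventually_mono)
  moreover have "?F \<noteq> bot" using ne by (simp add: filtermap_bot_iff)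
  ultimately have "\<exists>l\<in>cball 0 K. inf (nhds l) ?F \<noteq> bot"
    using compact_cball[of "0::complex" K] unfolding compact_filter le_principal by blast
  then obtain l where l: "inf (nhds l) ?F \<noteq> bot" by blast
  have "(f \<longlongrightarrow> l) \<omega>"
  proof (rule topological_tendstoI)
    fix S assume S: "open S" "l \<in> S"
    show "eventually (\<lambda>i. f i \<in> S) \<omega>"
    proof (rule ccontr)
      assume "\<not> ?thesis"
      then have "eventually (\<lambda>i. f i \<notin> S) \<omega>" using um[of "\<lambda>i. f i \<in> S"] by simp
      then have "eventually (\<lambda>y. y \<notin> S) ?F" by (simp add: eventually_filtermap)
      moreover have "eventually (\<lambda>y. y \<in> S) (nhds l)" using S by (rule eventually_nhds_in_open)
      ultimately have "eventually (\<lambda>y. False) (inf (nhds l) ?F)"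
        unfolding eventually_inf by (intro exI[of _ "\<lambda>y. y \<in> S"] exI[of _ "\<lambda>y. y \<notin> S"]) auto
      then show False using l by (simp add: trivial_limit_def)
    qed
  qed
  then show ?thesis by (rule that)
qed

section \<open>The limit trace and embeddings into the ultraproduct\<close>

locale tracial_ultraproduct = tracial_family I A \<tau>
  for I :: "'i set" and A :: "'i \<Rightarrow> ('a, 'm) star_algebra_scheme" and \<tau> :: "'i \<Rightarrow> 'a \<Rightarrow> complex" +
  fixes \<omega> :: "'i filter"
  assumes ultra: "ultrafilter_on I \<omega>"
begin

lemma omega_ne: "\<omega> \<noteq> bot" and eventually_I: "eventually (\<lambda>i. i \<in> I) \<omega>"
  using ultra by (auto simp: ultrafilter_on_def)

text \<open>\<open>Lim\<close> carries information only once a limit exists. The bound on the first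
  moment provides one, since by Cauchy--Schwarz it bounds the traces themselves.\<close>

lemma trace_tendsto:
  assumes a: "a \<in> bounded_families I A \<tau>" shows "((\<lambda>i. \<tau> i (a i)) \<longlongrightarrow> limit_trace \<omega> \<tau> a) \<omega>"
proof -
  obtain K where K: "\<And>i. i \<in> I \<Longrightarrow> cmod (moment 1 i (a i)) \<le> K"
    using a unfolding bounded_families_iff by blast
  have "cmod (\<tau> i (a i)) \<le> sqrt K" if "i \<in> I" for i
  proof -
    interpret tracial_algebra "A i" "\<tau> i" by (rule tracial[OF that])
    have "a i \<in> carrier (A i)" using a that by (rule bounded_families_carrier)
    then show ?thesis using cmod_trace_le[of "a i"] K[OF that]
      by (simp add: order.trans[OF _ real_sqrt_le_mono])
  qed
  then obtain l where l: "((\<lambda>i. \<tau> i (a i)) \<longlongrightarrow> l) \<omega>"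
    using ultrafilter_bounded_convergent[OF ultra, of "\<lambda>i. \<tau> i (a i)"] by metis
  then show ?thesis using tendsto_Lim[OF omega_ne l] by (simp add: limit_trace_def)
qed

lemma limit_trace_eqI:
  assumes "((\<lambda>i. \<tau> i (a i)) \<longlongrightarrow> l) \<omega>" shows "limit_trace \<omega> \<tau> a = l"
  unfolding limit_trace_def by (rule tendsto_Lim[OF omega_ne assms])

lemma limit_trace_eqI':
  assumes "(f \<longlongrightarrow> l) \<omega>" "\<And>i. i \<in> I \<Longrightarrow> \<tau> i (a i) = f i" shows "limit_trace \<omega> \<tau> a = l"
proof (rule limit_trace_eqI)
  have "eventually (\<lambda>i. f i = \<tau> i (a i)) \<omega>" using eventually_I by eventually_elim (simp add: assms(2))
  then show "((\<lambda>i. \<tau> i (a i)) \<longlongrightarrow> l) \<omega>" using assms(1) by (rule Lim_transform_eventually[rotated])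
qed

sublocale product: tracial_algebra "bounded_product I A \<tau>" "limit_trace \<omega> \<tau>"
proof (intro tracial_algebra.intro bounded_product_star_algebra tracial_algebra_axioms.intro)
  note T = tracial_algebra.tr_add[OF tracial] tracial_algebra.tr_smult[OF tracial] tracial_algebra.tr_one[OF tracial]
  have carr: "x i \<in> carrier (A i)" if "x \<in> bounded_families I A \<tau>" "i \<in> I" for x i
    using that by (rule bounded_families_carrier)
  have "limit_trace \<omega> \<tau> (\<lambda>i\<in>I. x i \<oplus>\<^bsub>A i\<^esub> y i) = limit_trace \<omega> \<tau> x + limit_trace \<omega> \<tau> y"
    if "x \<in> bounded_families I A \<tau>" "y \<in> bounded_families I A \<tau>" for x y
    by (rule limit_trace_eqI'[OF tendsto_add[OF trace_tendsto[OF that(1)] trace_tendsto[OF that(2)]]])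
       (use that T carr in simp)
  moreover have "limit_trace \<omega> \<tau> (\<lambda>i\<in>I. c \<odot>\<^bsub>A i\<^esub> x i) = c * limit_trace \<omega> \<tau> x"
    if "x \<in> bounded_families I A \<tau>" for c x
    by (rule limit_trace_eqI'[OF tendsto_mult_left[OF trace_tendsto[OF that(1)]]])
       (use that T carr in simp)
  moreover have "limit_trace \<omega> \<tau> (\<lambda>i\<in>I. \<one>\<^bsub>A i\<^esub>) = 1"
    by (rule limit_trace_eqI'[OF tendsto_const]) (use T in simp)
  moreover have comm: "limit_trace \<omega> \<tau> (\<lambda>i\<in>I. x i \<otimes>\<^bsub>A i\<^esub> y i) = limit_trace \<omega> \<tau> (\<lambda>i\<in>I. y i \<otimes>\<^bsub>A i\<^esub> x i)"
    if "x \<in> bounded_families I A \<tau>" "y \<in> bounded_families I A \<tau>" for x y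
    by (rule limit_trace_eqI'[OF trace_tendsto[OF bounded_families_mult[OF that(2,1)]]])
       (use that tracial_algebra.tr_comm[OF tracial] carr in simp)
  moreover have "limit_trace \<omega> \<tau> (\<lambda>i\<in>I. (\<lambda>i\<in>I. star (A i) (x i)) i \<otimes>\<^bsub>A i\<^esub> x i) \<in> \<real>\<^sub>\<ge>\<^sub>0"
    if x: "x \<in> bounded_families I A \<tau>" for x
  proof -
    let ?a = "\<lambda>i\<in>I. (\<lambda>i\<in>I. star (A i) (x i)) i \<otimes>\<^bsub>A i\<^esub> x i"
    have "?a \<in> bounded_families I A \<tau>" by (rule bounded_families_mult[OF bounded_families_star[OF x] x])
    note lim = trace_tendsto[OF this]
    show ?thesis
    proof (rule Lim_in_closed_set[OF closed_nonneg_Reals_complex _ omega_ne lim])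
      show "eventually (\<lambda>i. \<tau> i (?a i) \<in> \<real>\<^sub>\<ge>\<^sub>0) \<omega>"
        using eventually_I by eventually_elim (simp add: tracial_algebra.tr_pos[OF tracial] carr[OF x])
    qed
  qed
  ultimately show "positive_trace (bounded_product I A \<tau>) (limit_trace \<omega> \<tau>)"
    by (simp add: positive_trace_def linear_functional_def bounded_product_def cong: restrict_cong) (use comm in blast)
qed

text \<open>The kernel conditions of \<open>embedding_into_quotient\<close>, written coordinatewise:
  every defect of \<open>r\<close> has to tend to 0 in 2-norm along \<omega>.\<close>

lemma ultraproduct_embedding:
  fixes r :: "'b \<Rightarrow> 'i \<Rightarrow> 'a"
  assumes B: "tracial_algebra B \<sigma>" "faithful B \<sigma>"
    and r: "\<And>x. x \<in> carrier B \<Longrightarrow> r x \<in> bounded_families I A \<tau>"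
    and add: "\<And>x y. x \<in> carrier B \<Longrightarrow> y \<in> carrier B \<Longrightarrow>
      ((\<lambda>i. moment 1 i (r (x \<oplus>\<^bsub>B\<^esub> y) i \<oplus>\<^bsub>A i\<^esub> (-1) \<odot>\<^bsub>A i\<^esub> (r x i \<oplus>\<^bsub>A i\<^esub> r y i))) \<longlongrightarrow> 0) \<omega>"
    and mult: "\<And>x y. x \<in> carrier B \<Longrightarrow> y \<in> carrier B \<Longrightarrow>
      ((\<lambda>i. moment 1 i (r (x \<otimes>\<^bsub>B\<^esub> y) i \<oplus>\<^bsub>A i\<^esub> (-1) \<odot>\<^bsub>A i\<^esub> (r x i \<otimes>\<^bsub>A i\<^esub> r y i))) \<longlongrightarrow> 0) \<omega>"
    and scale: "\<And>c x. x \<in> carrier B \<Longrightarrow>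
      ((\<lambda>i. moment 1 i (r (c \<odot>\<^bsub>B\<^esub> x) i \<oplus>\<^bsub>A i\<^esub> (-1) \<odot>\<^bsub>A i\<^esub> (c \<odot>\<^bsub>A i\<^esub> r x i))) \<longlongrightarrow> 0) \<omega>"
    and star: "\<And>x. x \<in> carrier B \<Longrightarrow>
      ((\<lambda>i. moment 1 i (r (star B x) i \<oplus>\<^bsub>A i\<^esub> (-1) \<odot>\<^bsub>A i\<^esub> star (A i) (r x i))) \<longlongrightarrow> 0) \<omega>"
    and one: "((\<lambda>i. moment 1 i (r \<one>\<^bsub>B\<^esub> i \<oplus>\<^bsub>A i\<^esub> (-1) \<odot>\<^bsub>A i\<^esub> \<one>\<^bsub>A i\<^esub>)) \<longlongrightarrow> 0) \<omega>"
    and tr: "\<And>x. x \<in> carrier B \<Longrightarrow> ((\<lambda>i. \<tau> i (r x i)) \<longlongrightarrow> \<sigma> x) \<omega>"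
  shows "\<exists>\<iota>. trace_preserving_embedding B \<sigma> (metric_ultraproduct I \<omega> A \<tau>) (metric_ultraproduct_trace \<omega> \<tau>) \<iota>"
proof -
  interpret B: tracial_algebra B \<sigma> by (rule B)
  let ?P = "bounded_product I A \<tau>" and ?t = "limit_trace \<omega> \<tau>"
  have carrP: "carrier ?P = bounded_families I A \<tau>" by (simp add: bounded_product_def)
  have ker: "z \<in> trace_kernel ?P ?t"
    if "z \<in> bounded_families I A \<tau>" "((\<lambda>i. moment 1 i (y i)) \<longlongrightarrow> 0) \<omega>" "\<And>i. i \<in> I \<Longrightarrow> z i = y i" for z y
  proof -
    have "?t (star ?P z \<otimes>\<^bsub>?P\<^esub> z) = 0"
    proof (rule limit_trace_eqI'[OF that(2)])
      fix i assume i: "i \<in> I"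
      interpret tracial_algebra "A i" "\<tau> i" by (rule tracial[OF i])
      show "\<tau> i ((star ?P z \<otimes>\<^bsub>?P\<^esub> z) i) = moment 1 i (y i)"
        using i that(3)[OF i] bounded_families_carrier[OF that(1) i]
        by (simp add: bounded_product_def)
    qed
    then show ?thesis using that(1) carrP by (simp add: trace_kernel_def)
  qed
  have sc: "((-1) \<odot>\<^bsub>?P\<^esub> x) i = (-1) \<odot>\<^bsub>A i\<^esub> x i" "(x \<oplus>\<^bsub>?P\<^esub> y) i = x i \<oplus>\<^bsub>A i\<^esub> y i"
      "(c \<odot>\<^bsub>?P\<^esub> x) i = c \<odot>\<^bsub>A i\<^esub> x i"
      "(x \<otimes>\<^bsub>?P\<^esub> y) i = x i \<otimes>\<^bsub>A i\<^esub> y i" "star ?P x i = star (A i) (x i)" "\<one>\<^bsub>?P\<^esub> i = \<one>\<^bsub>A i\<^esub>" if "i \<in> I" for x y i c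
    using that by (simp_all add: bounded_product_def)
  note cl = product.A_m_closed product.smult_carrier product.star_closed product.A_one_closed ring.ring_simprules(1)[OF product.ring_A]
  note cl' = cl[unfolded carrP]
  have "trace_preserving_embedding B \<sigma> (quotient_star_algebra ?P (trace_kernel ?P ?t)) (induced_trace ?t)
      (\<lambda>x. trace_kernel ?P ?t +>\<^bsub>?P\<^esub> r x)"
  proof (rule product.embedding_into_quotient[OF B])
    show "r \<in> carrier B \<rightarrow> carrier ?P" using r by (simp add: carrP)
    show "r (x \<oplus>\<^bsub>B\<^esub> y) \<oplus>\<^bsub>?P\<^esub> (-1) \<odot>\<^bsub>?P\<^esub> (r x \<oplus>\<^bsub>?P\<^esub> r y) \<in> trace_kernel ?P ?t"
      if "x \<in> carrier B" "y \<in> carrier B" for x y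
      by (rule ker[OF _ add[OF that]]) (use that in \<open>auto simp: sc intro!: cl' r ring.ring_simprules(1)[OF B.ring_A]\<close>)
    show "r (x \<otimes>\<^bsub>B\<^esub> y) \<oplus>\<^bsub>?P\<^esub> (-1) \<odot>\<^bsub>?P\<^esub> (r x \<otimes>\<^bsub>?P\<^esub> r y) \<in> trace_kernel ?P ?t"
      if "x \<in> carrier B" "y \<in> carrier B" for x y
      by (rule ker[OF _ mult[OF that]]) (use that in \<open>auto simp: sc intro!: cl' r\<close>)
    show "r (c \<odot>\<^bsub>B\<^esub> x) \<oplus>\<^bsub>?P\<^esub> (-1) \<odot>\<^bsub>?P\<^esub> (c \<odot>\<^bsub>?P\<^esub> r x) \<in> trace_kernel ?P ?t"
      if "x \<in> carrier B" for c x
      by (rule ker[OF _ scale[OF that]]) (use that in \<open>auto simp: sc intro!: cl' r\<close>)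
    show "r (star B x) \<oplus>\<^bsub>?P\<^esub> (-1) \<odot>\<^bsub>?P\<^esub> star ?P (r x) \<in> trace_kernel ?P ?t"
      if "x \<in> carrier B" for x
      by (rule ker[OF _ star[OF that]]) (use that in \<open>auto simp: sc intro!: cl' r\<close>)
    show "r \<one>\<^bsub>B\<^esub> \<oplus>\<^bsub>?P\<^esub> (-1) \<odot>\<^bsub>?P\<^esub> \<one>\<^bsub>?P\<^esub> \<in> trace_kernel ?P ?t"
      by (rule ker[OF _ one]) (auto simp: sc intro!: cl' r)
    show "?t (r x) = \<sigma> x" if "x \<in> carrier B" for x
      by (rule limit_trace_eqI[OF tr[OF that]])
  qed
  then show ?thesis unfolding metric_ultraproduct_def metric_ultraproduct_trace_def by blast
qed

end

section \<open>The free star-algebra\<close>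

alias keys = Poly_Mapping.keys
alias lookup = Poly_Mapping.lookup

text \<open>The flag \<open>True\<close> marks the generator with the given index,
  \<open>False\<close> its adjoint.\<close>

type_synonym letter = "nat \<times> bool"

text \<open>A wrapper around lists, so that concatenation can serve as the addition of a
  \<open>monoid_add\<close>. The convolution product of
  \<open>word \<Rightarrow>\<^sub>0 complex\<close> is then the free algebra.\<close>

datatype word = Word (letters: "letter list")

instantiation word :: monoid_add
begin
definition "0 = Word []"
definition "u + v = Word (letters u @ letters v)"
instance by standard (simp_all add: zero_word_def plus_word_def)
end

lemma letters_simps [simp]: "letters 0 = []" "letters (u + v) = letters u @ letters v"
  by (simp_all add: zero_word_def plus_word_def)

definition letter_star :: "letter \<Rightarrow> letter" where
  "letter_star x = (fst x, \<not> snd x)"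

definition word_star :: "word \<Rightarrow> word" where
  "word_star w = Word (rev (map letter_star (letters w)))"

lemma letter_star_star [simp]: "letter_star (letter_star x) = x"
  and fst_letter_star [simp]: "fst (letter_star x) = fst x"
  by (simp_all add: letter_star_def)

lemma word_star_star [simp]: "word_star (word_star w) = w"
  by (simp add: word_star_def rev_map comp_def)

lemma word_star_add: "word_star (u + v) = word_star v + word_star u"
  by (simp add: word_star_def plus_word_def)

lemma word_star_zero [simp]: "word_star 0 = 0"
  by (simp add: word_star_def zero_word_def)

abbreviation wlen :: "word \<Rightarrow> nat" where "wlen w \<equiv> length (letters w)"

lemma wlen_star [simp]: "wlen (word_star w) = wlen w"
  by (simp add: word_star_def)

type_synonym free = "word \<Rightarrow>\<^sub>0 complex"

lemma free_sum: "f = (\<Sum>w\<in>keys f. Poly_Mapping.single w (lookup f w))"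
  by (rule poly_mapping_eqI) (simp add: lookup_sum lookup_single when_def in_keys_iff)

lemma free_induct [case_names zero single add]:
  fixes f :: free
  assumes "P 0" "\<And>w c. P (Poly_Mapping.single w c)" "\<And>f g. P f \<Longrightarrow> P g \<Longrightarrow> P (f + g)"
  shows "P f"
proof -
  have "P (\<Sum>w\<in>S. Poly_Mapping.single w (lookup f w))" if "finite S" for S
    using that by (induction S) (auto simp: assms)
  then show ?thesis using free_sum[of f] by (metis finite_keys)
qed

definition ext :: "(word \<Rightarrow> complex) \<Rightarrow> free \<Rightarrow> complex" where
  "ext \<phi> f = (\<Sum>w\<in>keys f. lookup f w * \<phi> w)"

lemma ext_superset: "finite S \<Longrightarrow> keys f \<subseteq> S \<Longrightarrow> ext \<phi> f = (\<Sum>w\<in>S. lookup f w * \<phi> w)"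
  unfolding ext_def by (intro sum.mono_neutral_left) (auto simp: in_keys_iff)

lemma ext_zero [simp]: "ext \<phi> 0 = 0"
  by (simp add: ext_def)

lemma ext_single [simp]: "ext \<phi> (Poly_Mapping.single w c) = c * \<phi> w"
  by (simp add: ext_def)

lemma ext_add: "ext \<phi> (f + g) = ext \<phi> f + ext \<phi> g"
proof -
  let ?S = "keys f \<union> keys g"
  have "ext \<phi> (f + g) = (\<Sum>w\<in>?S. lookup (f + g) w * \<phi> w)"
    by (intro ext_superset) (auto simp: Poly_Mapping.keys_add)
  also have "\<dots> = (\<Sum>w\<in>?S. lookup f w * \<phi> w) + (\<Sum>w\<in>?S. lookup g w * \<phi> w)"
    by (simp add: lookup_add sum.distrib distrib_right)
  also have "\<dots> = ext \<phi> f + ext \<phi> g"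
    by (simp add: ext_superset[of ?S])
  finally show ?thesis .
qed

lemma ext_minus: "ext \<phi> (- f) = - ext \<phi> f"
  using ext_add[of \<phi> f "- f"] by (simp add: eq_neg_iff_add_eq_0 add.commute)

lemma ext_diff: "ext \<phi> (f - g) = ext \<phi> f - ext \<phi> g"
  using ext_add[of \<phi> f "- g"] ext_minus[of \<phi> g] by simp

lemma ext_sum: "ext \<phi> (\<Sum>i\<in>S. f i) = (\<Sum>i\<in>S. ext \<phi> (f i))"
  by (induction S rule: infinite_finite_induct) (auto simp: ext_add)

lemma ext_one: "ext \<phi> 1 = \<phi> 0"
  using ext_single[of \<phi> 0 1] by simp

lemma ext_fun_add: "ext (\<lambda>w. \<phi> w + \<psi> w) f = ext \<phi> f + ext \<psi> f"
  by (simp add: ext_def distrib_left sum.distrib)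

lemma ext_fun_sum: "ext (\<lambda>w. \<Sum>e\<in>E. \<phi> e w) f = (\<Sum>e\<in>E. ext (\<phi> e) f)"
  unfolding ext_def sum_distrib_left by (rule sum.swap)

lemma ext_fun_cmult: "ext (\<lambda>w. c * \<phi> w) f = c * ext \<phi> f"
  by (simp add: ext_def sum_distrib_left mult.left_commute)

lemma ext_fun_cmult_right: "ext (\<lambda>w. \<phi> w * c) f = ext \<phi> f * c"
  by (simp add: ext_def sum_distrib_right mult.assoc)

lemma ext_of_bool: "ext (\<lambda>v. of_bool (v = u)) f = lookup f u"
  by (simp add: ext_def of_bool_def if_distrib in_keys_iff cong: if_cong)

lemma ext_cong: "(\<And>w. w \<in> keys f \<Longrightarrow> \<phi> w = \<psi> w) \<Longrightarrow> ext \<phi> f = ext \<psi> f"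
  by (simp add: ext_def)

text \<open>Functionals on products become nested extensions of \<open>\<phi> (u + v)\<close>; a
  factorisation of \<phi> on concatenated words thereby passes to the whole free algebra.\<close>

lemma ext_mult: "ext \<phi> (f * g) = ext (\<lambda>u. ext (\<lambda>v. \<phi> (u + v)) g) f"
proof -
  have "ext \<phi> (Poly_Mapping.single u c * g) = c * ext (\<lambda>v. \<phi> (u + v)) g" for u c
    by (induction g rule: free_induct) (simp_all add: mult_single distrib_left ext_add mult.assoc)
  then show ?thesis
    by (induction f rule: free_induct) (simp_all add: distrib_right ext_add)
qed

lift_definition fstar :: "free \<Rightarrow> free" is "\<lambda>f w. cnj (f (word_star w))"
proof -
  fix f :: "word \<Rightarrow> complex" assume "finite {w. f w \<noteq> 0}"
  then have "finite (word_star ` {w. f w \<noteq> 0})" by simp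
  moreover have "{w. cnj (f (word_star w)) \<noteq> 0} \<subseteq> word_star ` {w. f w \<noteq> 0}"
    by (auto intro!: image_eqI[of _ _ "word_star _"])
  ultimately show "finite {w. cnj (f (word_star w)) \<noteq> 0}" by (rule rev_finite_subset)
qed

lemma fstar_add: "fstar (f + g) = fstar f + fstar g"
  by (rule poly_mapping_eqI) (simp add: fstar.rep_eq lookup_add)

lemma fstar_star [simp]: "fstar (fstar f) = f"
  by (rule poly_mapping_eqI) (simp add: fstar.rep_eq)

lemma fstar_single: "fstar (Poly_Mapping.single w c) = Poly_Mapping.single (word_star w) (cnj c)"
  by (rule poly_mapping_eqI) (auto simp: fstar.rep_eq lookup_single when_def)

lemma fstar_zero [simp]: "fstar 0 = 0"
  by (rule poly_mapping_eqI) (simp add: fstar.rep_eq)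

lemma fstar_mult: "fstar (f * g) = fstar g * fstar f"
proof -
  have "fstar (Poly_Mapping.single u c * g) = fstar g * fstar (Poly_Mapping.single u c)" for u c
    by (induction g rule: free_induct)
       (simp_all add: mult_single fstar_single word_star_add distrib_left distrib_right fstar_add mult.commute)
  then show ?thesis
    by (induction f rule: free_induct) (simp_all add: distrib_right distrib_left fstar_add)
qed

lemma ext_fstar: "ext \<phi> (fstar f) = cnj (ext (\<lambda>w. cnj (\<phi> (word_star w))) f)"
  by (induction f rule: free_induct) (simp_all add: fstar_single fstar_add ext_add)

lemma ext_star_mult:
  "ext \<phi> (fstar f * g) = cnj (ext (\<lambda>u. cnj (ext (\<lambda>v. \<phi> (word_star u + v)) g)) f)"
  by (simp add: ext_mult ext_fstar)

text \<open>Scaling is multiplication by a constant polynomial, so the scalar laws are ring laws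
  together with centrality of constants.\<close>

definition fscale :: "complex \<Rightarrow> free \<Rightarrow> free" where
  "fscale c f = Poly_Mapping.single 0 c * f"

lemma fscale_commute: "f * Poly_Mapping.single 0 c = Poly_Mapping.single 0 c * (f :: free)"
  by (induction f rule: free_induct) (simp_all add: mult_single distrib_left distrib_right mult.commute)

lemma ext_fscale: "ext \<phi> (fscale c f) = c * ext \<phi> f"
  unfolding fscale_def by (induction f rule: free_induct) (simp_all add: mult_single distrib_left ext_add)

lemma fscale_mult_left: "fscale c f * g = fscale c (f * g)"
  by (simp add: fscale_def mult.assoc)

lemma fscale_mult_right: "f * fscale c g = fscale c (f * g)"
  unfolding fscale_def mult.assoc[symmetric] fscale_commute ..

lemma fscale_add: "fscale c (f + g) = fscale c f + fscale c g"
  by (simp add: fscale_def distrib_left)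

lemma fscale_plus: "fscale (c + d) f = fscale c f + fscale d f"
  by (simp add: fscale_def distrib_right single_add)

lemma fscale_fscale: "fscale (c * d) f = fscale c (fscale d f)"
  by (simp add: fscale_def mult_single flip: mult.assoc)

lemma fscale_one: "fscale 1 f = f"
  by (simp add: fscale_def)

lemma fstar_fscale: "fstar (fscale c f) = fscale (cnj c) (fstar f)"
  unfolding fscale_def fstar_mult fstar_single word_star_zero fscale_commute ..

definition free_star_algebra :: "free star_algebra" where
  "free_star_algebra = \<lparr>carrier = UNIV, mult = (*), one = 1, zero = 0, add = (+), smult = fscale, star = fstar\<rparr>"

lemma free_star_algebra_simps [simp]:
  "carrier free_star_algebra = UNIV" "mult free_star_algebra = (*)" "one free_star_algebra = 1"
  "zero free_star_algebra = 0" "add free_star_algebra = (+)" "smult free_star_algebra = fscale"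
  "star free_star_algebra = fstar"
  by (simp_all add: free_star_algebra_def)

lemma free_complex_star_algebra: "complex_star_algebra free_star_algebra"
proof (rule complex_star_algebraI)
  show "ring free_star_algebra"
  proof (rule ringI)
    show "abelian_group free_star_algebra"
    proof (rule abelian_groupI)
      show "\<exists>y\<in>carrier free_star_algebra. y \<oplus>\<^bsub>free_star_algebra\<^esub> x = \<zero>\<^bsub>free_star_algebra\<^esub>" for x
        by (auto intro!: exI[of _ "- x"])
    qed (auto simp: algebra_simps)
    show "Group.monoid free_star_algebra" by (rule monoidI) (auto simp: mult.assoc)
  qed (auto simp: algebra_simps)
qed (simp_all add: fscale_mult_left fscale_mult_right fscale_add fscale_fscale fscale_plus fscale_one fstar_add fstar_mult fstar_fscale)

section \<open>Grading by word length and the matrix representations\<close>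

lift_definition component :: "nat \<Rightarrow> free \<Rightarrow> free" is "\<lambda>s f w. if wlen w = s then f w else 0"
  by (rule rev_finite_subset) (auto split: if_splits)

lemma keys_component: "w \<in> keys (component s f) \<Longrightarrow> wlen w = s"
  by (auto simp: in_keys_iff component.rep_eq split: if_splits)

lemma component_sum:
  assumes "\<And>w. w \<in> keys f \<Longrightarrow> wlen w \<le> N" shows "(\<Sum>s\<le>N. component s f) = f"
proof (rule poly_mapping_eqI)
  fix w
  have "lookup (\<Sum>s\<le>N. component s f) w = (\<Sum>s\<le>N. if s = wlen w then lookup f w else 0)"
    by (auto simp: lookup_sum component.rep_eq intro!: sum.cong)
  also have "\<dots> = lookup f w" using assms[of w] by (auto simp: in_keys_iff)
  finally show "lookup (\<Sum>s\<le>N. component s f) w = lookup f w" .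
qed

text \<open>Every word in the product has length \<open>i + j\<close>, so a factor depending on
  length alone is constant there.\<close>

lemma ext_component_star_mult:
  "ext (\<lambda>v. c (wlen v) * \<phi> v) (fstar (component i f) * component j g) = c (i + j) * ext \<phi> (fstar (component i f) * component j g)"
proof -
  have "ext (\<lambda>v. c (wlen (word_star u + v)) * \<phi> (word_star u + v)) (component j g) =
     c (i + j) * ext (\<lambda>v. \<phi> (word_star u + v)) (component j g)" if "u \<in> keys (component i f)" for u
    unfolding ext_fun_cmult[symmetric] using keys_component[OF that] by (intro ext_cong) (auto dest: keys_component)
  then show ?thesis
    by (simp add: ext_star_mult ext_fun_cmult cong: ext_cong)
qed

lemma wlen_bounded: "\<exists>N\<ge>D. \<forall>w\<in>keys f. wlen w \<le> N"
proof -
  have "finite (insert D (wlen ` keys f))" by simp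
  then have "\<forall>x\<in>insert D (wlen ` keys f). x \<le> Max (insert D (wlen ` keys f))" by (simp add: Max_ge)
  then show ?thesis by (intro exI[of _ "Max (insert D (wlen ` keys f))"]) auto
qed

text \<open>The \<open>n \<times> n\<close> representation attached to a word \<open>w\<close> of length \<open>< n\<close>: a letter \<open>x\<close> acts by the
  sum of the \<open>E\<^sub>i\<^sub>,\<^sub>i\<^sub>+\<^sub>1\<close> with \<open>w\<^sub>i = x\<close> and of the \<open>E\<^sub>i\<^sub>+\<^sub>1\<^sub>,\<^sub>i\<close> with \<open>w\<^sub>i = x\<^sup>*\<close>, so that among
  the words of length at most \<open>|w|\<close> only \<open>w\<close> itself has a nonzero entry at \<open>(0, |w|)\<close>.\<close>

definition step :: "letter list \<Rightarrow> letter \<Rightarrow> nat \<Rightarrow> nat \<Rightarrow> complex" where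
  "step w x i j = of_bool (j = Suc i \<and> i < length w \<and> w ! i = x) + of_bool (i = Suc j \<and> j < length w \<and> w ! j = letter_star x)"

fun walk :: "nat \<Rightarrow> letter list \<Rightarrow> letter list \<Rightarrow> nat \<Rightarrow> nat \<Rightarrow> complex" where
  "walk n w [] i j = of_bool (i = j)"
| "walk n w (x # xs) i j = (\<Sum>k<n. step w x i k * walk n w xs k j)"

lemma walk_append: "i < n \<Longrightarrow> walk n w (xs @ ys) i j = (\<Sum>k<n. walk n w xs i k * walk n w ys k j)"
proof (induction xs arbitrary: i)
  case (Cons x xs)
  have "walk n w ((x # xs) @ ys) i j = (\<Sum>l<n. step w x i l * (\<Sum>k<n. walk n w xs l k * walk n w ys k j))"
    using Cons.IH by simp
  also have "\<dots> = (\<Sum>l<n. \<Sum>k<n. step w x i l * walk n w xs l k * walk n w ys k j)"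
    by (simp add: sum_distrib_left mult.assoc)
  also have "\<dots> = (\<Sum>k<n. \<Sum>l<n. step w x i l * walk n w xs l k * walk n w ys k j)"
    by (rule sum.swap)
  finally show ?case by (simp add: sum_distrib_right)
qed (simp add: of_bool_def if_distrib if_distribR cong: if_cong)

lemma walk_single: "j < n \<Longrightarrow> walk n w [x] i j = step w x i j"
  by (simp add: of_bool_def if_distrib cong: if_cong)

lemma step_star: "step w (letter_star x) i j = cnj (step w x j i)"
  by (auto simp: step_def)

lemma walk_star:
  "i < n \<Longrightarrow> j < n \<Longrightarrow> walk n w (rev (map letter_star xs)) i j = cnj (walk n w xs j i)"
proof (induction xs arbitrary: i j)
  case (Cons x xs)
  have "walk n w (rev (map letter_star (x # xs))) i j = (\<Sum>k<n. cnj (walk n w xs k i) * cnj (step w x j k))"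
    using Cons by (simp add: walk_append walk_single step_star del: walk.simps)
  then show ?case by (simp add: mult.commute)
qed (auto simp: eq_commute)

lemma walk_too_short: "i + length xs < j \<Longrightarrow> walk n w xs i j = 0"
proof (induction xs arbitrary: i)
  case (Cons x xs)
  have "step w x i k * walk n w xs k j = 0" for k
    using Cons.IH[of k] Cons.prems by (cases "k \<le> Suc i") (auto simp: step_def)
  then show ?case unfolding walk.simps by (intro sum.neutral ballI)
qed simp

text \<open>Each letter moves the index by exactly one, so a walk as long as the distance it covers
  must step upwards every time, and each upward step at \<open>i\<close> demands the letter
  \<open>w ! i\<close>.\<close>

lemma walk_monotone:
  "i + length xs \<le> length w \<Longrightarrow> length w < n \<Longrightarrow>
    walk n w xs i (i + length xs) = of_bool (\<forall>t<length xs. w ! (i + t) = xs ! t)"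
proof (induction xs arbitrary: i)
  case (Cons x xs)
  have "step w x i k * walk n w xs k (i + length (x # xs)) =
     (if k = Suc i then of_bool (w ! i = x) * walk n w xs (Suc i) (Suc i + length xs) else 0)" for k
    using Cons.prems walk_too_short[of k xs "i + length (x # xs)" n w] by (auto simp: step_def)
  then have "walk n w (x # xs) i (i + length (x # xs)) = of_bool (w ! i = x) * walk n w xs (Suc i) (Suc i + length xs)"
    using Cons.prems by simp
  also have "\<dots> = of_bool (w ! i = x \<and> (\<forall>t<length xs. w ! (Suc i + t) = xs ! t))"
    using Cons.IH[of "Suc i"] Cons.prems by simp
  also have "(w ! i = x \<and> (\<forall>t<length xs. w ! (Suc i + t) = xs ! t)) \<longleftrightarrow> (\<forall>t<length (x # xs). w ! (i + t) = (x # xs) ! t)"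
    by (auto simp: less_Suc_eq_0_disj)
  finally show ?case .
qed simp

lemma walk_detects:
  "length v = length w \<Longrightarrow> length w < n \<Longrightarrow> walk n w v 0 (length w) = of_bool (v = w)"
  using walk_monotone[of 0 v w n] by (auto simp: list_eq_iff_nth_eq)


section \<open>Positive traces close to a truncated trace\<close>

text \<open>Each side of the diagonal contributes a part of the series of \<open>1 / 8 ^ k\<close>
  over \<open>k \<ge> 1\<close>, whose sum is 1/7; and 2/7 is below 1/2.\<close>

lemma geometric_row_sum:
  fixes i N :: nat
  shows "(\<Sum>j\<le>N. if i = j then 0 else 1 / 8 ^ (if i \<le> j then j - i else i - j) :: real) \<le> 1 / 2"
proof -
  let ?g = "\<lambda>k::nat. (1/8::real) ^ Suc k"
  have fin: "(\<Sum>k\<in>S. ?g k) \<le> 1 / 7" if "finite S" for S :: "nat set"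
  proof -
    have "(\<Sum>k\<in>S. ?g k) \<le> suminf ?g"
      using that summable_geometric[of "1/8::real"] by (intro sum_le_suminf) (auto intro: summable_mult)
    also have "\<dots> = 1 / 7" using sums_mult[OF geometric_sums[of "1/8::real"], of "1/8"] by (simp add: sums_unique[symmetric])
    finally show ?thesis .
  qed
  let ?f = "\<lambda>j. if i = j then 0 else 1 / 8 ^ (if i \<le> j then j - i else i - j) :: real"
  have "(\<Sum>j\<le>N. ?f j) \<le> (\<Sum>j\<in>{..<i} \<union> {i..N}. ?f j)" by (rule sum_mono2) auto
  also have "\<dots> \<le> (\<Sum>j<i. ?f j) + (\<Sum>j\<in>{i..N}. ?f j)" by (subst sum.union_disjoint) auto
  also have "(\<Sum>j<i. ?f j) = (\<Sum>j\<in>(\<lambda>j. i - 1 - j) ` {..<i}. ?g j)"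
    by (subst sum.reindex) (auto simp: inj_on_def power_divide Suc_diff_Suc simp del: power_Suc intro!: sum.cong)
  also have "\<dots> \<le> 1 / 7" by (rule fin) simp
  also have "(\<Sum>j\<in>{i..N}. ?f j) = (\<Sum>j\<in>{i<..N}. ?f j)" by (rule sum.mono_neutral_right) auto
  also have "\<dots> = (\<Sum>j\<in>(\<lambda>j. j - i - 1) ` {i<..N}. ?g j)"
    by (subst sum.reindex) (auto simp: inj_on_def power_divide Suc_diff_Suc simp del: power_Suc intro!: sum.cong)
  also have "\<dots> \<le> 1 / 7" by (rule fin) simp
  finally show ?thesis by simp
qed

text \<open>Truncated subtraction makes the last factor 1 for \<open>t \<le> D\<close>. In these
  degrees the weight depends on \<open>\<eta>\<close> alone, so \<open>S\<close> remains free to be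
  large without spoiling the approximation.\<close>

definition weight :: "real \<Rightarrow> real \<Rightarrow> nat \<Rightarrow> nat \<Rightarrow> real" where
  "weight \<eta> S D t = \<eta> * 8 ^ (t * t) * S ^ (2 * (t - D))"

lemma weight_even: "\<eta> \<ge> 0 \<Longrightarrow> weight \<eta> S D (2 * i) = (sqrt \<eta> * 8 ^ (2 * i * i) * S ^ (2 * i - D))\<^sup>2"
  by (simp add: weight_def power_mult_distrib flip: power_mult) (simp add: mult.commute)

text \<open>The parallelogram identity \<open>(i + j)^2 + (i - j)^2 = 2 * i^2 + 2 * j^2\<close>
  leaves a factor 8 to the power \<open>(i - j)^2\<close>, hence at least to the power of the
  distance. For the powers of \<open>S\<close>, truncated subtraction is convex:
  \<open>2 * (i + j - D)\<close> is at most \<open>(2 * i - D) + (2 * j - D)\<close>.\<close>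

lemma weight_log_convex:
  assumes "\<eta> \<ge> 0" "S \<ge> 1"
  shows "weight \<eta> S D (i + j) \<le> (sqrt \<eta> * 8 ^ (2 * i * i) * S ^ (2 * i - D)) * (sqrt \<eta> * 8 ^ (2 * j * j) * S ^ (2 * j - D))
     / 8 ^ (if i \<le> j then j - i else i - j)"
proof -
  let ?d = "if i \<le> j then j - i else i - j"
  have sq: "k \<le> k * k" for k :: nat by (cases k) auto
  have "?d * ?d + (i + j) * (i + j) = 2 * i * i + 2 * j * j"
  proof (cases "i \<le> j")
    case True
    then obtain k where "j = i + k" using le_Suc_ex by blast
    then show ?thesis by (simp add: algebra_simps)
  next
    case False
    then obtain k where "i = j + k" using le_Suc_ex by (metis nat_le_linear)
    then show ?thesis by (simp add: algebra_simps)
  qed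
  then have e: "(i + j) * (i + j) + ?d \<le> 2 * i * i + 2 * j * j" using sq[of ?d] by linarith
  have "weight \<eta> S D (i + j) * 8 ^ ?d = \<eta> * (8 ^ ((i + j) * (i + j) + ?d) * S ^ (2 * (i + j - D)))"
    by (simp add: weight_def power_add)
  also have "\<dots> \<le> \<eta> * (8 ^ (2 * i * i + 2 * j * j) * S ^ ((2 * i - D) + (2 * j - D)))"
    using assms e by (intro mult_left_mono mult_mono power_increasing) auto
  also have "\<dots> = (sqrt \<eta> * 8 ^ (2 * i * i) * S ^ (2 * i - D)) * (sqrt \<eta> * 8 ^ (2 * j * j) * S ^ (2 * j - D))"
    using assms by (simp add: power_add)
  finally show ?thesis by (simp add: pos_le_divide_eq)
qed

text \<open>The moment matrix of a truncated trace, perturbed by a trace with fast growing weights: the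
  off-diagonal blocks are dominated by the diagonal, because the weights are strongly
  log-convex (the factor \<open>8 ^ t\<^sup>2\<close>), and jump by the large factor \<open>S\<^sup>2\<close> beyond the truncation.\<close>

lemma perturbed_positive:
  fixes x y :: "nat \<Rightarrow> nat \<Rightarrow> complex" and a :: "nat \<Rightarrow> real"
  assumes a: "\<And>i. a i \<ge> 0" and N: "D \<le> N"
    and x: "\<And>i j. i \<le> D \<Longrightarrow> j \<le> D \<Longrightarrow> cmod (x i j) \<le> c * (a i * a j)"
    and x0: "0 \<le> Re (\<Sum>i\<le>D div 2. \<Sum>j\<le>D div 2. x i j)"
    and y: "\<And>i j. cmod (y i j) \<le> a i * a j" and yd: "\<And>i. Re (y i i) = (a i)\<^sup>2"
    and \<eta>: "\<eta> > 0" and S: "S \<ge> 1" "S \<ge> 4 * c * (real D + 1) / \<eta>"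
  shows "Re (\<Sum>i\<le>N. \<Sum>j\<le>N. (if i + j \<le> D then x i j else 0) + weight \<eta> S D (i + j) * y i j)
     \<ge> (\<Sum>i\<le>N. weight \<eta> S D (2 * i) * (a i)\<^sup>2) / 4"
proof -
  \<comment> \<open>The square root of the weight in degree \<open>2 * i\<close>; thus
    \<open>v i\<close> squared is the diagonal entry and \<open>V\<close> the trace of the weighted
    matrix.\<close>
  define \<mu> where "\<mu> i = sqrt \<eta> * 8 ^ (2 * i * i) * S ^ (2 * i - D)" for i
  define v where "v i = \<mu> i * a i" for i
  define V where "V = (\<Sum>i\<le>N. (v i)\<^sup>2)"
  have \<mu>0: "\<mu> i \<ge> 0" for i using \<eta> S by (simp add: \<mu>_def)
  have v0: "v i \<ge> 0" for i using \<mu>0 a by (simp add: v_def)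
  have w2: "weight \<eta> S D (2 * i) * (a i)\<^sup>2 = (v i)\<^sup>2" for i
    using \<eta> by (simp add: weight_even v_def \<mu>_def power_mult_distrib)
  let ?d = "\<lambda>i j::nat. if i \<le> j then j - i else i - j"
  let ?q = "\<lambda>i j::nat. if i = j then 0 else 1 / 8 ^ ?d i j :: real"
  have am: "v i * v j \<le> ((v i)\<^sup>2 + (v j)\<^sup>2) / 2" for i j
    using sum_squares_bound[of "v i" "v j"] by simp
  \<comment> \<open>A Schur test: the product \<open>v i * v j\<close> is split evenly between rows
    \<open>i\<close> and \<open>j\<close>, so only the row sums of \<open>?q\<close> will
    matter.\<close>
  have W: "Re (weight \<eta> S D (i + j) * y i j) \<ge> (if i = j then (v i)\<^sup>2 else 0) - ?q i j * (((v i)\<^sup>2 + (v j)\<^sup>2) / 2)" for i j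
  proof (cases "i = j")
    case True
    then have "Re (weight \<eta> S D (i + j) * y i j) = weight \<eta> S D (2 * i) * (a i)\<^sup>2"
      using yd[of i] by (simp add: mult_2[symmetric])
    then show ?thesis using w2[of i] True by simp
  next
    case False
    have w0: "0 \<le> weight \<eta> S D (i + j)" using \<eta> S by (simp add: weight_def)
    have "- Re (weight \<eta> S D (i + j) * y i j) \<le> cmod (weight \<eta> S D (i + j) * y i j)"
      using abs_Re_le_cmod[of "weight \<eta> S D (i + j) * y i j"] by linarith
    also have "\<dots> \<le> (\<mu> i * \<mu> j / 8 ^ ?d i j) * (a i * a j)"
    proof -
      have "weight \<eta> S D (i + j) \<le> \<mu> i * \<mu> j / 8 ^ ?d i j"
        unfolding \<mu>_def using \<eta> S by (intro weight_log_convex) auto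
      then have "weight \<eta> S D (i + j) * cmod (y i j) \<le> (\<mu> i * \<mu> j / 8 ^ ?d i j) * (a i * a j)"
        using y[of i j] w0 \<mu>0 by (intro mult_mono) auto
      then show ?thesis using w0 by (simp add: norm_mult)
    qed
    also have "\<dots> = ?q i j * (v i * v j)" using False by (simp add: v_def)
    also have "\<dots> \<le> ?q i j * (((v i)\<^sup>2 + (v j)\<^sup>2) / 2)" by (intro mult_left_mono am) auto
    finally show ?thesis using False by simp
  qed
  \<comment> \<open>The corner \<open>?x\<close> is a full moment matrix and nonnegative by
    \<open>x0\<close>. The loss in the other surviving blocks is charged to \<open>?e\<close>,
    scaled so that the at most \<open>D + 1\<close> rows and columns cost \<open>V / 4\<close>
    together.\<close>
  let ?e = "\<lambda>i j. if i \<le> D \<and> j \<le> D then ((v i)\<^sup>2 + (v j)\<^sup>2) / (8 * (real D + 1)) else 0"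
  let ?x = "\<lambda>i j. if i \<le> D div 2 \<and> j \<le> D div 2 then Re (x i j) else 0"
  have X: "Re (if i + j \<le> D then x i j else 0) \<ge> ?x i j - ?e i j" for i j
  proof (cases "i + j \<le> D \<and> \<not> (i \<le> D div 2 \<and> j \<le> D div 2)")
    case True
    then have ij: "i \<le> D" "j \<le> D" by auto
    have "\<eta> * S \<le> \<mu> i * \<mu> j"
    proof -
      \<comment> \<open>Outside the corner one index exceeds \<open>D / 2\<close>, so the geometric
        mean of the two diagonal weights contains at least one factor \<open>S\<close>, which beats
        the constant \<open>c\<close>.\<close>
      have "1 \<le> (2 * i - D) + (2 * j - D)" using True by linarith
      then have "S ^ 1 \<le> S ^ ((2 * i - D) + (2 * j - D))" using S by (intro power_increasing) auto
      then have "S * 1 \<le> S ^ ((2 * i - D) + (2 * j - D)) * (8 ^ (2 * i * i) * 8 ^ (2 * j * j))"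
        using S by (intro mult_mono mult_ge1_I one_le_power) auto
      then have "\<eta> * S \<le> \<eta> * (S ^ ((2 * i - D) + (2 * j - D)) * (8 ^ (2 * i * i) * 8 ^ (2 * j * j)))"
        using \<eta> by (intro mult_left_mono) auto
      also have "\<dots> = \<mu> i * \<mu> j" using \<eta> by (simp add: \<mu>_def power_add mult_ac)
      finally show ?thesis .
    qed
    then have "(4 * c * (real D + 1)) * (a i * a j) \<le> \<mu> i * \<mu> j * (a i * a j)"
      using S \<eta> a by (intro mult_right_mono) (auto simp: pos_divide_le_eq mult_ac)
    also have "\<dots> = v i * v j" by (simp add: v_def)
    also note am[of i j]
    finally have "c * (a i * a j) \<le> ((v i)\<^sup>2 + (v j)\<^sup>2) / (8 * (real D + 1))"
      by (simp add: field_simps)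
    then have "cmod (x i j) \<le> ((v i)\<^sup>2 + (v j)\<^sup>2) / (8 * (real D + 1))"
      using x[OF ij] by linarith
    then show ?thesis using True ij abs_Re_le_cmod[of "x i j"] by auto
  qed auto
  have sx: "(\<Sum>i\<le>N. \<Sum>j\<le>N. ?x i j) = Re (\<Sum>i\<le>D div 2. \<Sum>j\<le>D div 2. x i j)"
  proof -
    have "(\<Sum>i\<le>N. \<Sum>j\<le>N. ?x i j) = (\<Sum>i\<le>D div 2. \<Sum>j\<le>N. ?x i j)"
      using N by (intro sum.mono_neutral_right) auto
    also have "\<dots> = (\<Sum>i\<le>D div 2. \<Sum>j\<le>D div 2. ?x i j)"
      using N by (intro sum.cong refl sum.mono_neutral_right) auto
    also have "\<dots> = (\<Sum>i\<le>D div 2. \<Sum>j\<le>D div 2. Re (x i j))"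
      by (intro sum.cong refl) auto
    finally show ?thesis by simp
  qed
  have se: "(\<Sum>i\<le>N. \<Sum>j\<le>N. ?e i j) \<le> V / 4"
  proof -
    have "(\<Sum>i\<le>N. \<Sum>j\<le>N. ?e i j) = (\<Sum>i\<le>D. \<Sum>j\<le>N. ?e i j)"
      using N by (intro sum.mono_neutral_right) auto
    also have "\<dots> = (\<Sum>i\<le>D. \<Sum>j\<le>D. ?e i j)"
      using N by (intro sum.cong refl sum.mono_neutral_right) auto
    also have "\<dots> = (\<Sum>i\<le>D. \<Sum>j\<le>D. ((v i)\<^sup>2 + (v j)\<^sup>2) / (8 * (real D + 1)))"
      by (intro sum.cong refl) auto
    also have "\<dots> = 2 * (real D + 1) * (\<Sum>i\<le>D. (v i)\<^sup>2) / (8 * (real D + 1))"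
      by (simp add: sum.distrib flip: sum_divide_distrib sum_distrib_left)
    also have "\<dots> = (\<Sum>i\<le>D. (v i)\<^sup>2) / 4" by (simp add: field_simps)
    also have "\<dots> \<le> V / 4" unfolding V_def using N by (intro divide_right_mono sum_mono2) auto
    finally show ?thesis .
  qed
  have sq: "(\<Sum>i\<le>N. \<Sum>j\<le>N. ?q i j * (((v i)\<^sup>2 + (v j)\<^sup>2) / 2)) \<le> V / 2"
  proof -
    have "(\<Sum>i\<le>N. \<Sum>j\<le>N. ?q i j * (((v i)\<^sup>2 + (v j)\<^sup>2) / 2)) =
       (\<Sum>i\<le>N. \<Sum>j\<le>N. ?q i j * ((v i)\<^sup>2 / 2)) + (\<Sum>i\<le>N. \<Sum>j\<le>N. ?q i j * ((v j)\<^sup>2 / 2))"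
      by (simp add: add_divide_distrib distrib_left flip: sum.distrib)
    also have "(\<Sum>i\<le>N. \<Sum>j\<le>N. ?q i j * ((v j)\<^sup>2 / 2)) = (\<Sum>i\<le>N. \<Sum>j\<le>N. ?q j i * ((v i)\<^sup>2 / 2))"
      by (rule sum.swap)
    also have "\<dots> = (\<Sum>i\<le>N. \<Sum>j\<le>N. ?q i j * ((v i)\<^sup>2 / 2))"
      by (intro sum.cong refl) auto
    also have "(\<Sum>i\<le>N. \<Sum>j\<le>N. ?q i j * ((v i)\<^sup>2 / 2)) + \<dots> = (\<Sum>i\<le>N. (\<Sum>j\<le>N. ?q i j) * (v i)\<^sup>2)"
      by (simp only: sum.distrib[symmetric] sum_distrib_right distrib_left[symmetric] field_sum_of_halves)
    also have "\<dots> \<le> (\<Sum>i\<le>N. 1 / 2 * (v i)\<^sup>2)"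
      by (intro sum_mono mult_right_mono geometric_row_sum) auto
    also have "\<dots> = V / 2" by (simp add: V_def sum_divide_distrib)
    finally show ?thesis .
  qed
  \<comment> \<open>The balance: the diagonal gives \<open>V\<close>, the off-diagonal weighted
    blocks cost at most \<open>V / 2\<close>, the surviving blocks outside the corner at most
    \<open>V / 4\<close>, so that \<open>V / 4\<close> is left.\<close>
  have "(\<Sum>i\<le>N. \<Sum>j\<le>N. (?x i j - ?e i j) + ((if i = j then (v i)\<^sup>2 else 0) - ?q i j * (((v i)\<^sup>2 + (v j)\<^sup>2) / 2)))
    \<le> (\<Sum>i\<le>N. \<Sum>j\<le>N. Re ((if i + j \<le> D then x i j else 0) + weight \<eta> S D (i + j) * y i j))"
    unfolding plus_complex.sel by (intro sum_mono add_mono X W)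
  also have "\<dots> = Re (\<Sum>i\<le>N. \<Sum>j\<le>N. (if i + j \<le> D then x i j else 0) + weight \<eta> S D (i + j) * y i j)"
    by simp
  also have "(\<Sum>i\<le>N. \<Sum>j\<le>N. (?x i j - ?e i j) + ((if i = j then (v i)\<^sup>2 else 0) - ?q i j * (((v i)\<^sup>2 + (v j)\<^sup>2) / 2))) =
     (\<Sum>i\<le>N. \<Sum>j\<le>N. ?x i j) - (\<Sum>i\<le>N. \<Sum>j\<le>N. ?e i j) + ((\<Sum>i\<le>N. \<Sum>j\<le>N. if i = j then (v i)\<^sup>2 else 0)
      - (\<Sum>i\<le>N. \<Sum>j\<le>N. ?q i j * (((v i)\<^sup>2 + (v j)\<^sup>2) / 2)))"
    by (simp only: sum.distrib sum_subtractf)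
  also have "(\<Sum>i\<le>N. \<Sum>j\<le>N. if i = j then (v i)\<^sup>2 else 0) = V" by (simp add: V_def)
  finally have "V / 4 \<le> Re (\<Sum>i\<le>N. \<Sum>j\<le>N. (if i + j \<le> D then x i j else 0) + weight \<eta> S D (i + j) * y i j)"
    using x0 sx se sq by linarith
  then show ?thesis unfolding w2 V_def .
qed


section \<open>Truncated moments perturbed by traces of matrix representations\<close>

locale truncated_trace =
  fixes n :: nat and \<theta> :: "word \<Rightarrow> complex"
  assumes n: "n \<ge> 1"
    and theta_one: "\<theta> 0 = 1"
    and theta_comm: "\<theta> (u + v) = \<theta> (v + u)"
    and theta_star: "\<theta> (word_star u) = cnj (\<theta> u)"
    and theta_pos: "0 \<le> Re (ext \<theta> (fstar f * f))"
    and theta_letters: "\<not> fst ` set (letters u) \<subseteq> {..<n} \<Longrightarrow> \<theta> u = 0"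
begin

text \<open>The greatest length of a word \<open>u\<close> whose detecting entry
  \<open>(0, wlen u)\<close> still fits into an n x n matrix.\<close>

definition D :: nat where "D = n - 1"

definition W :: "letter list set" where
  "W = {w. set w \<subseteq> {..<n} \<times> UNIV \<and> length w \<le> D}"

text \<open>All matrix positions in the direct sum of the representations attached to the words in
  \<open>W\<close>.\<close>

definition E :: "(letter list \<times> nat \<times> nat) set" where
  "E = W \<times> {..<n} \<times> {..<n}"

definition entry :: "letter list \<times> nat \<times> nat \<Rightarrow> word \<Rightarrow> complex" where
  "entry = (\<lambda>(w, i, j) v. walk n w (letters v) i j)"

text \<open>The unnormalised trace of this direct sum.\<close>

definition \<sigma> :: "word \<Rightarrow> complex" where
  "\<sigma> v = (\<Sum>w\<in>W. \<Sum>i<n. walk n w (letters v) i i)"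

text \<open>The Hilbert--Schmidt norm of the image of a homogeneous component in the direct sum; by
  \<open>sigma_diag\<close> it is the 2-norm belonging to \<open>\<sigma>\<close>. It vanishes
  exactly if every representation kills the component.\<close>

definition comp_norm :: "nat \<Rightarrow> free \<Rightarrow> real" where
  "comp_norm s f = L2_set (\<lambda>e. cmod (ext (entry e) (component s f))) E"

lemma finite_W [simp]: "finite W"
  unfolding W_def by (rule finite_lists_length_le) simp

lemma finite_E [simp]: "finite E"
  by (simp add: E_def)

lemma length_W: "w \<in> W \<Longrightarrow> length w < n"
  using n by (auto simp: W_def D_def)

lemma sigma_star_add: "\<sigma> (word_star u + v) = (\<Sum>e\<in>E. cnj (entry e u) * entry e v)"
proof -
  have "(\<Sum>i<n. walk n w (letters (word_star u + v)) i i) = (\<Sum>i<n. \<Sum>k<n. cnj (walk n w (letters u) k i) * walk n w (letters v) k i)" for w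
    by (simp add: walk_append word_star_def walk_star)
  also have "\<dots> w = (\<Sum>k<n. \<Sum>i<n. cnj (walk n w (letters u) k i) * walk n w (letters v) k i)" for w
    by (rule sum.swap)
  finally show ?thesis by (simp add: \<sigma>_def E_def entry_def sum.cartesian_product split_def)
qed

lemma sigma_comm: "\<sigma> (u + v) = \<sigma> (v + u)"
proof -
  have "(\<Sum>i<n. \<Sum>k<n. walk n w (letters u) i k * walk n w (letters v) k i)
     = (\<Sum>k<n. \<Sum>i<n. walk n w (letters u) i k * walk n w (letters v) k i)" for w
    by (rule sum.swap)
  then show ?thesis by (simp add: \<sigma>_def walk_append mult.commute)
qed

lemma sigma_star: "\<sigma> (word_star u) = cnj (\<sigma> u)"
  by (simp add: \<sigma>_def word_star_def walk_star)

lemma sigma_zero: "\<sigma> 0 = of_nat (card W * n)"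
  by (simp add: \<sigma>_def)

lemma ext_sigma: "ext \<sigma> (fstar f * g) = (\<Sum>e\<in>E. cnj (ext (entry e) f) * ext (entry e) g)"
  by (simp add: ext_star_mult sigma_star_add ext_fun_sum ext_fun_cmult ext_fun_cmult_right mult.commute)

lemma sigma_bound: "cmod (ext \<sigma> (fstar (component i f) * component j f)) \<le> comp_norm i f * comp_norm j f"
proof -
  have "cmod (ext \<sigma> (fstar (component i f) * component j f))
     \<le> (\<Sum>e\<in>E. \<bar>cmod (ext (entry e) (component i f))\<bar> * \<bar>cmod (ext (entry e) (component j f))\<bar>)"
    unfolding ext_sigma by (rule order.trans[OF norm_sum]) (simp add: norm_mult)
  also have "\<dots> \<le> comp_norm i f * comp_norm j f" unfolding comp_norm_def by (rule L2_set_mult_ineq)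
  finally show ?thesis .
qed

lemma sigma_diag: "ext \<sigma> (fstar (component i f) * component i f) = of_real ((comp_norm i f)\<^sup>2)"
  unfolding ext_sigma comp_norm_def L2_set_def
  by (simp add: sum_nonneg mult.commute complex_norm_square del: of_real_power)

lemma comp_norm_nonneg: "comp_norm s f \<ge> 0"
  by (simp add: comp_norm_def L2_set_nonneg)

text \<open>In the representation attached to \<open>u\<close>, the entry \<open>(0, wlen u)\<close>
  of a homogeneous component is the coefficient of \<open>u\<close>, and an entry is bounded by the
  Hilbert--Schmidt norm.\<close>

lemma coeff_bound:
  assumes "letters u \<in> W" shows "cmod (lookup f u) \<le> comp_norm (wlen u) f"
proof -
  let ?e = "(letters u, 0, wlen u)"
  have e: "?e \<in> E" using assms length_W[OF assms] by (simp add: E_def)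
  have "entry ?e v = of_bool (v = u)" if "v \<in> keys (component (wlen u) f)" for v
    using walk_detects[of "letters v" "letters u" n] keys_component[OF that] length_W[OF assms]
    by (auto simp: entry_def intro: word.expand)
  then have "ext (entry ?e) (component (wlen u) f) = ext (\<lambda>v. of_bool (v = u)) (component (wlen u) f)"
    by (rule ext_cong)
  also have "\<dots> = lookup f u"
    by (simp only: ext_of_bool) (simp add: component.rep_eq)
  finally have "cmod (lookup f u) = \<bar>cmod (ext (entry ?e) (component (wlen u) f))\<bar>" by simp
  also have "\<dots> \<le> comp_norm (wlen u) f"
    unfolding comp_norm_def using member_le_L2_set[OF finite_E e, of "\<lambda>e. cmod (ext (entry e) (component (wlen u) f))"] by simp
  finally show ?thesis .
qed

definition theta_const :: real where
  "theta_const = (\<Sum>u\<in>Word ` W. \<Sum>v\<in>Word ` W. cmod (\<theta> (word_star u + v)))"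

lemma theta_star_add_zero: "letters u \<notin> W \<Longrightarrow> wlen u \<le> D \<Longrightarrow> \<theta> (word_star u + v) = 0"
   "letters u \<notin> W \<Longrightarrow> wlen u \<le> D \<Longrightarrow> \<theta> (word_star v + u) = 0"
proof -
  assume u: "letters u \<notin> W" "wlen u \<le> D"
  then have "\<not> set (letters u) \<subseteq> {..<n} \<times> UNIV" by (simp add: W_def)
  then obtain x where x: "x \<in> set (letters u)" "\<not> fst x < n" by (metis lessThan_iff mem_Times_iff subsetI UNIV_I)
  have "fst ` set (letters (word_star u)) = fst ` set (letters u)" by (simp add: word_star_def image_image)
  then have "\<not> fst ` set (letters (word_star u + v)) \<subseteq> {..<n}" "\<not> fst ` set (letters (word_star v + u)) \<subseteq> {..<n}"
    using x by (auto simp: image_Un)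
  then show "\<theta> (word_star u + v) = 0" "\<theta> (word_star v + u) = 0" using theta_letters by auto
qed

text \<open>Among the words of length at most \<open>D\<close>, those outside \<open>W\<close>
  contain a letter of index at least \<open>n\<close> and are killed by \<open>\<theta>\<close>; the
  coefficients of the others are controlled by \<open>coeff_bound\<close>. \<open>W\<close> is
  finite, so a single constant serves all \<open>f\<close>.\<close>

lemma theta_bound:
  assumes "i \<le> D" "j \<le> D"
  shows "cmod (ext \<theta> (fstar (component i f) * component j f)) \<le> theta_const * (comp_norm i f * comp_norm j f)"
proof -
  let ?f = "component i f" and ?g = "component j f"
  let ?S = "Word ` W"
  let ?K = "{u \<in> ?S. wlen u = i}" and ?L = "{u \<in> ?S. wlen u = j}"
  have fS: "finite ?S" by simp
  have zero: "\<theta> (word_star u + v) = 0" if "u \<in> keys ?f" "v \<in> keys ?g" "u \<notin> ?K \<or> v \<notin> ?L" for u v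
  proof -
    have "wlen u = i" "wlen v = j" using that keys_component by auto
    moreover from this have "letters u \<notin> W \<or> letters v \<notin> W" using that(3) by (auto simp: image_iff)
    ultimately show ?thesis using theta_star_add_zero assms by metis
  qed
  have "ext \<theta> (fstar ?f * ?g) = (\<Sum>u\<in>keys ?f. \<Sum>v\<in>keys ?g. cnj (lookup ?f u) * lookup ?g v * \<theta> (word_star u + v))"
    unfolding ext_star_mult by (simp add: ext_def sum_distrib_left mult.assoc)
  also have "\<dots> = (\<Sum>u\<in>keys ?f \<union> ?K. \<Sum>v\<in>keys ?g \<union> ?L. cnj (lookup ?f u) * lookup ?g v * \<theta> (word_star u + v))"
    using fS by (intro sum.mono_neutral_cong_left sum.mono_neutral_left) (auto simp: in_keys_iff intro!: sum.neutral)
  also have "\<dots> = (\<Sum>u\<in>?K. \<Sum>v\<in>?L. cnj (lookup ?f u) * lookup ?g v * \<theta> (word_star u + v))"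
  proof -
    have z: "cnj (lookup ?f u) * lookup ?g v * \<theta> (word_star u + v) = 0" if "u \<notin> ?K \<or> v \<notin> ?L" for u v
      using zero[of u v] that by (cases "u \<in> keys ?f \<and> v \<in> keys ?g") (auto simp: in_keys_iff)
    let ?t = "\<lambda>u v. cnj (lookup ?f u) * lookup ?g v * \<theta> (word_star u + v)"
    have "(\<Sum>u\<in>keys ?f \<union> ?K. \<Sum>v\<in>keys ?g \<union> ?L. ?t u v) = (\<Sum>u\<in>keys ?f \<union> ?K. \<Sum>v\<in>?L. ?t u v)"
      using fS by (intro sum.cong refl sum.mono_neutral_right ballI z) auto
    also have "\<dots> = (\<Sum>u\<in>?K. \<Sum>v\<in>?L. ?t u v)"
      using fS by (intro sum.mono_neutral_right ballI sum.neutral z) auto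
    finally show ?thesis .
  qed
  finally have "cmod (ext \<theta> (fstar ?f * ?g)) \<le> (\<Sum>u\<in>?K. \<Sum>v\<in>?L. cmod (lookup ?f u) * cmod (lookup ?g v) * cmod (\<theta> (word_star u + v)))"
    by (simp only:) (intro order.trans[OF norm_sum] sum_mono, auto simp: norm_mult intro!: order.trans[OF norm_sum])
  also have "\<dots> \<le> (\<Sum>u\<in>?K. \<Sum>v\<in>?L. comp_norm i f * comp_norm j f * cmod (\<theta> (word_star u + v)))"
  proof (intro sum_mono mult_right_mono mult_mono)
    fix u v assume uv: "u \<in> ?K" "v \<in> ?L"
    show "cmod (lookup ?f u) \<le> comp_norm i f" using coeff_bound[of u f] uv by (auto simp: component.rep_eq)
    show "cmod (lookup ?g v) \<le> comp_norm j f" using coeff_bound[of v f] uv by (auto simp: component.rep_eq)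
  qed (auto simp: comp_norm_nonneg)
  also have "\<dots> = comp_norm i f * comp_norm j f * (\<Sum>u\<in>?K. \<Sum>v\<in>?L. cmod (\<theta> (word_star u + v)))"
    by (simp add: sum_distrib_left)
  also have "\<dots> \<le> comp_norm i f * comp_norm j f * theta_const"
  proof (rule mult_left_mono)
    have "(\<Sum>u\<in>?K. \<Sum>v\<in>?L. cmod (\<theta> (word_star u + v))) \<le> (\<Sum>u\<in>?K. \<Sum>v\<in>?S. cmod (\<theta> (word_star u + v)))"
      using fS by (intro sum_mono sum_mono2) auto
    also have "\<dots> \<le> theta_const" unfolding theta_const_def using fS by (intro sum_mono2) (auto simp: sum_nonneg)
    finally show "(\<Sum>u\<in>?K. \<Sum>v\<in>?L. cmod (\<theta> (word_star u + v))) \<le> theta_const" .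
  qed (simp add: comp_norm_nonneg)
  finally show ?thesis by (simp add: mult.commute)
qed

lemma ext_double_sum:
  assumes N: "\<And>w. w \<in> keys f \<Longrightarrow> wlen w \<le> N"
  shows "ext \<phi> (fstar f * f) = (\<Sum>i\<le>N. \<Sum>j\<le>N. ext \<phi> (fstar (component i f) * component j f))"
proof -
  have fs: "fstar (\<Sum>s\<le>N. component s f) = (\<Sum>s\<le>N. fstar (component s f))" for N
    by (induction N) (simp_all add: fstar_add)
  have "ext \<phi> (fstar f * f) = ext \<phi> (fstar (\<Sum>s\<le>N. component s f) * (\<Sum>s\<le>N. component s f))"
    using component_sum[OF N] by simp
  also have "\<dots> = (\<Sum>i\<le>N. \<Sum>j\<le>N. ext \<phi> (fstar (component i f) * component j f))"
    unfolding fs sum_product ext_sum ..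
  finally show ?thesis .
qed

lemma theta_low_pos: "0 \<le> Re (\<Sum>i\<le>d. \<Sum>j\<le>d. ext \<theta> (fstar (component i f) * component j f))"
proof -
  let ?g = "\<Sum>s\<le>d. component s f"
  have fs: "fstar (\<Sum>s\<le>d. component s f) = (\<Sum>s\<le>d. fstar (component s f))" for d
    by (induction d) (simp_all add: fstar_add)
  have "ext \<theta> (fstar ?g * ?g) = (\<Sum>i\<le>d. \<Sum>j\<le>d. ext \<theta> (fstar (component i f) * component j f))"
    unfolding fs sum_product ext_sum ..
  then show ?thesis using theta_pos[of ?g] by simp
qed

definition perturbed :: "real \<Rightarrow> real \<Rightarrow> word \<Rightarrow> complex" where
  "perturbed \<eta> S v = (if wlen v \<le> D then \<theta> v else 0) + weight \<eta> S D (wlen v) * \<sigma> v"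

lemma ext_perturbed_component:
  "ext (perturbed \<eta> S) (fstar (component i f) * component j f) =
    (if i + j \<le> D then ext \<theta> (fstar (component i f) * component j f) else 0)
     + weight \<eta> S D (i + j) * ext \<sigma> (fstar (component i f) * component j f)"
proof -
  have "perturbed \<eta> S = (\<lambda>v. (if wlen v \<le> D then 1 else 0) * \<theta> v + (of_real (weight \<eta> S D (wlen v))) * \<sigma> v)"
    by (auto simp: perturbed_def fun_eq_iff)
  then show ?thesis
    using ext_component_star_mult[of "\<lambda>k. if k \<le> D then 1 else 0" \<theta> i f j f]
      ext_component_star_mult[of "\<lambda>k. of_real (weight \<eta> S D k)" \<sigma> i f j f]
    by (simp add: ext_fun_add)
qed

lemma ext_perturbed_real: "ext (perturbed \<eta> S) (fstar f * f) \<in> \<real>"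
proof -
  have "perturbed \<eta> S (word_star v) = cnj (perturbed \<eta> S v)" for v
    by (simp add: perturbed_def theta_star sigma_star)
  then have "ext (perturbed \<eta> S) (fstar g) = cnj (ext (perturbed \<eta> S) g)" for g
    by (simp add: ext_fstar)
  from this[of "fstar f * f"] show ?thesis
    by (simp add: fstar_mult complex_is_Real_iff complex_eq_iff)
qed

text \<open>The constants are chosen in the order \<open>\<epsilon>\<close>, \<open>\<eta>\<close>,
  \<open>S\<close>. Closeness concerns the words in \<open>W\<close>, where the weight is
  independent of \<open>S\<close>; positivity then asks for \<open>S\<close> large in terms of
  \<open>\<eta>\<close>. The lower bound by a positive combination of the squared component norms
  yields positivity and identifies the kernel.\<close>

lemma approximating_trace:
  assumes \<epsilon>: "\<epsilon> > 0"
  shows "\<exists>\<phi>. positive_trace free_star_algebra (ext \<phi>) \<and>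
     (\<forall>v. letters v \<in> W \<longrightarrow> cmod (\<phi> v - \<theta> v) \<le> \<epsilon>) \<and>
     (\<forall>f. ext \<phi> (fstar f * f) = 0 \<longleftrightarrow> (\<forall>s. \<forall>e\<in>E. ext (entry e) (component s f) = 0))"
proof -
  \<comment> \<open>The error at a word \<open>v\<close> in \<open>W\<close> is at most
    \<open>\<eta>\<close> times its summand here: 8 to the power \<open>D * D\<close> bounds the
    weight factor at lengths up to \<open>D\<close>, and the second term is the effect of
    normalisation. The added 1 keeps \<open>K\<close> positive.\<close>
  define K where "K = (\<Sum>v\<in>Word ` W. 8 ^ (D * D) * cmod (\<sigma> v) + cmod (\<theta> v) * cmod (\<sigma> 0)) + 1"
  have K: "K \<ge> 1" unfolding K_def by (simp add: sum_nonneg)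
  define \<eta> where "\<eta> = \<epsilon> / K"
  have \<eta>: "\<eta> > 0" using \<epsilon> K by (simp add: \<eta>_def)
  define S where "S = max 1 (4 * theta_const * (real D + 1) / \<eta>)"
  have S: "S \<ge> 1" "S \<ge> 4 * theta_const * (real D + 1) / \<eta>" by (auto simp: S_def)
  \<comment> \<open>The value of the perturbed functional at the empty word, namely 1 plus
    \<open>\<eta>\<close> times \<open>\<sigma> 0\<close>, by which it is divided.\<close>
  define Z where "Z = 1 + \<eta> * (real (card W) * real n)"
  have Z: "Z \<ge> 1" using \<eta> by (simp add: Z_def)
  have perturbed0: "perturbed \<eta> S 0 = of_real Z" by (simp add: perturbed_def weight_def sigma_zero theta_one Z_def)
  define \<phi> where "\<phi> v = perturbed \<eta> S v * of_real (1 / Z)" for v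
  have ext_phi: "ext \<phi> f = ext (perturbed \<eta> S) f * of_real (1 / Z)" for f
    unfolding \<phi>_def by (rule ext_fun_cmult_right)
  have lower: "(\<Sum>i\<le>N. weight \<eta> S D (2 * i) * (comp_norm i f)\<^sup>2) / 4 \<le> Re (ext (perturbed \<eta> S) (fstar f * f))"
    if N: "D \<le> N" "\<And>w. w \<in> keys f \<Longrightarrow> wlen w \<le> N" for N f
  proof -
    have "(\<Sum>i\<le>N. weight \<eta> S D (2 * i) * (comp_norm i f)\<^sup>2) / 4 \<le>
      Re (\<Sum>i\<le>N. \<Sum>j\<le>N. (if i + j \<le> D then ext \<theta> (fstar (component i f) * component j f) else 0)
        + weight \<eta> S D (i + j) * ext \<sigma> (fstar (component i f) * component j f))"
      by (rule perturbed_positive[OF comp_norm_nonneg N(1) theta_bound theta_low_pos sigma_bound _ \<eta> S])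
         (simp_all add: sigma_diag)
    then show ?thesis by (simp only: ext_double_sum[OF N(2)] ext_perturbed_component)
  qed
  have wpos: "weight \<eta> S D t > 0" for t using \<eta> S by (simp add: weight_def)
  have pos: "ext \<phi> (fstar f * f) \<in> \<real>\<^sub>\<ge>\<^sub>0" for f
  proof -
    obtain N where "N \<ge> D" "\<forall>w\<in>keys f. wlen w \<le> N" using wlen_bounded by blast
    then have "(\<Sum>i\<le>N. weight \<eta> S D (2 * i) * (comp_norm i f)\<^sup>2) / 4 \<le> Re (ext (perturbed \<eta> S) (fstar f * f))" by (intro lower) auto
    moreover have "0 \<le> (\<Sum>i\<le>N. weight \<eta> S D (2 * i) * (comp_norm i f)\<^sup>2) / 4"
      using wpos by (auto intro!: sum_nonneg simp: less_imp_le)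
    ultimately have "0 \<le> Re (ext (perturbed \<eta> S) (fstar f * f))" by linarith
    then show ?thesis using ext_perturbed_real[of \<eta> S f] Z
      by (auto simp: ext_phi complex_nonneg_Reals_iff complex_is_Real_iff)
  qed
  have comm: "\<phi> (u + v) = \<phi> (v + u)" for u v
    by (simp add: \<phi>_def perturbed_def theta_comm[of u v] sigma_comm[of u v] add.commute)
  have swap: "ext \<phi> (f * g) = ext \<phi> (g * f)" for f g
  proof -
    have "ext \<phi> (f * g) = (\<Sum>u\<in>keys f. \<Sum>v\<in>keys g. lookup f u * (lookup g v * \<phi> (u + v)))"
      unfolding ext_mult by (simp add: ext_def sum_distrib_left)
    also have "\<dots> = (\<Sum>v\<in>keys g. \<Sum>u\<in>keys f. lookup f u * (lookup g v * \<phi> (u + v)))"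
      by (rule sum.swap)
    also have "\<dots> = ext \<phi> (g * f)"
      unfolding ext_mult by (simp add: ext_def sum_distrib_left comm mult.left_commute)
    finally show ?thesis .
  qed
  have "positive_trace free_star_algebra (ext \<phi>)"
    unfolding positive_trace_def linear_functional_def
    using pos swap Z by (simp add: ext_add ext_fscale ext_one \<phi>_def[of 0] perturbed0)
  moreover have "cmod (\<phi> v - \<theta> v) \<le> \<epsilon>" if v: "letters v \<in> W" for v
  proof -
    have vW: "v \<in> Word ` W" using v by (metis image_eqI word.collapse)
    have len: "wlen v \<le> D" using v by (simp add: W_def)
    let ?w = "\<eta> * 8 ^ (wlen v * wlen v)"
    have "\<phi> v - \<theta> v = (of_real ?w * \<sigma> v - of_real \<eta> * \<sigma> 0 * \<theta> v) * of_real (1 / Z)"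
    proof -
      have "\<theta> v = \<theta> v * of_real Z * of_real (1 / Z)" using Z by simp
      then have "\<phi> v - \<theta> v = (perturbed \<eta> S v - \<theta> v * of_real Z) * of_real (1 / Z)"
        by (simp add: \<phi>_def diff_divide_distrib)
      also have "perturbed \<eta> S v - \<theta> v * of_real Z = of_real ?w * \<sigma> v - of_real \<eta> * \<sigma> 0 * \<theta> v"
        using len by (simp add: perturbed_def weight_def Z_def sigma_zero algebra_simps)
      finally show ?thesis .
    qed
    also have "cmod \<dots> \<le> cmod (of_real ?w * \<sigma> v - of_real \<eta> * \<sigma> 0 * \<theta> v)"
    proof -
      have "cmod (of_real (1 / Z)) \<le> 1" unfolding norm_of_real using Z by simp
      then show ?thesis unfolding norm_mult by (simp add: mult_left_le)
    qed
    also have "\<dots> \<le> ?w * cmod (\<sigma> v) + \<eta> * (cmod (\<theta> v) * cmod (\<sigma> 0))"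
      using norm_triangle_ineq4[of "of_real ?w * \<sigma> v" "of_real \<eta> * \<sigma> 0 * \<theta> v"] \<eta> by (simp add: norm_mult norm_power mult_ac)
    also have "\<dots> \<le> \<eta> * (8 ^ (D * D) * cmod (\<sigma> v) + cmod (\<theta> v) * cmod (\<sigma> 0))"
    proof -
      have "(8::real) ^ (wlen v * wlen v) \<le> 8 ^ (D * D)" using len by (intro power_increasing mult_le_mono) auto
      then have "8 ^ (wlen v * wlen v) * cmod (\<sigma> v) \<le> 8 ^ (D * D) * cmod (\<sigma> v)" by (intro mult_right_mono) auto
      then have "\<eta> * (8 ^ (wlen v * wlen v) * cmod (\<sigma> v)) \<le> \<eta> * (8 ^ (D * D) * cmod (\<sigma> v))" using \<eta> by (intro mult_left_mono) auto
      then show ?thesis by (simp add: distrib_left mult.assoc)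
    qed
    also have "\<dots> \<le> \<eta> * K"
    proof (rule mult_left_mono)
      have "8 ^ (D * D) * cmod (\<sigma> v) + cmod (\<theta> v) * cmod (\<sigma> 0) \<le> (\<Sum>v\<in>Word ` W. 8 ^ (D * D) * cmod (\<sigma> v) + cmod (\<theta> v) * cmod (\<sigma> 0))"
        by (rule member_le_sum[OF vW]) auto
      then show "8 ^ (D * D) * cmod (\<sigma> v) + cmod (\<theta> v) * cmod (\<sigma> 0) \<le> K" by (simp add: K_def)
    qed (use \<eta> in simp)
    also have "\<dots> = \<epsilon>" using K by (simp add: \<eta>_def)
    finally show ?thesis .
  qed
  moreover have "ext \<phi> (fstar f * f) = 0 \<longleftrightarrow> (\<forall>s. \<forall>e\<in>E. ext (entry e) (component s f) = 0)" for f
  proof -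
    have size0: "comp_norm s f = 0 \<longleftrightarrow> (\<forall>e\<in>E. ext (entry e) (component s f) = 0)" for s
      by (simp add: comp_norm_def L2_set_eq_0_iff)
    have phi0: "ext \<phi> (fstar f * f) = 0 \<longleftrightarrow> ext (perturbed \<eta> S) (fstar f * f) = 0" using Z by (simp add: ext_phi)
    obtain N0 where N0: "N0 \<ge> D" "\<forall>w\<in>keys f. wlen w \<le> N0" using wlen_bounded by blast
    have "comp_norm s f = 0" if "ext (perturbed \<eta> S) (fstar f * f) = 0" for s
    proof -
      \<comment> \<open>The bound is enlarged so that the term of index \<open>s\<close> occurs in
        the sum even when \<open>s\<close> exceeds the degree of \<open>f\<close>.\<close>
      let ?N = "max s N0"
      have "(\<Sum>i\<le>?N. weight \<eta> S D (2 * i) * (comp_norm i f)\<^sup>2) / 4 \<le> Re (ext (perturbed \<eta> S) (fstar f * f))"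
        using N0 by (intro lower) auto
      then have le: "(\<Sum>i\<le>?N. weight \<eta> S D (2 * i) * (comp_norm i f)\<^sup>2) \<le> 0" using that by simp
      have "weight \<eta> S D (2 * s) * (comp_norm s f)\<^sup>2 \<le> (\<Sum>i\<le>?N. weight \<eta> S D (2 * i) * (comp_norm i f)\<^sup>2)"
        using wpos by (intro member_le_sum[of s]) (auto simp: less_imp_le)
      with le have "weight \<eta> S D (2 * s) * (comp_norm s f)\<^sup>2 \<le> 0" by linarith
      then show ?thesis using wpos[of "2 * s"] by (simp add: mult_le_0_iff)
    qed
    moreover have "ext (perturbed \<eta> S) (fstar f * f) = 0" if a0: "\<And>s. comp_norm s f = 0"
    proof -
      \<comment> \<open>Conversely, both parts of every block are bounded by products of component
        norms; the truncated part occurs only for \<open>i + j \<le> D\<close>, within the range of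
        \<open>theta_bound\<close>.\<close>
      have "ext (perturbed \<eta> S) (fstar (component i f) * component j f) = 0" for i j
        using theta_bound[of i j f] sigma_bound[of i f j] a0 by (auto simp: ext_perturbed_component)
      then show ?thesis using ext_double_sum[of f N0] N0 by simp
    qed
    ultimately show ?thesis unfolding phi0 size0[symmetric] by blast
  qed
  ultimately show ?thesis by blast
qed

end


section \<open>Quotients of the free algebra with carrier in the type of points\<close>

text \<open>There are countably many words, so listing coefficients along an enumeration places the
  free algebra inside \<open>point\<close>.\<close>

definition coeffs :: "free \<Rightarrow> point" where
  "coeffs f = (\<lambda>k. lookup f (Word (from_nat k)))"

lemma inj_coeffs: "inj coeffs"
proof (rule injI, rule poly_mapping_eqI)
  fix f g :: free and w assume "coeffs f = coeffs g"
  then have "coeffs f (to_nat (letters w)) = coeffs g (to_nat (letters w))" by simp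
  then show "lookup f w = lookup g w" by (simp add: coeffs_def)
qed

locale free_trace =
  fixes \<phi> :: "word \<Rightarrow> complex"
  assumes pos: "positive_trace free_star_algebra (ext \<phi>)"
begin

sublocale tracial_algebra free_star_algebra "ext \<phi>"
  using pos by (intro tracial_algebra.intro free_complex_star_algebra tracial_algebra_axioms.intro)

definition negligible :: "free \<Rightarrow> bool" where "negligible f \<longleftrightarrow> ext \<phi> (fstar f * f) = 0"

lemma negligible_kernel: "negligible f \<longleftrightarrow> f \<in> trace_kernel free_star_algebra (ext \<phi>)"
  by (simp add: negligible_def kernel_iff)

lemma negligible_rules: "negligible 0" "negligible f \<Longrightarrow> negligible g \<Longrightarrow> negligible (f + g)" "negligible f \<Longrightarrow> negligible (g * f)" "negligible f \<Longrightarrow> negligible (f * g)"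
  "negligible f \<Longrightarrow> negligible (fscale c f)" "negligible f \<Longrightarrow> negligible (fstar f)" "negligible f \<Longrightarrow> ext \<phi> f = 0" "negligible f \<Longrightarrow> negligible (- f)"
proof -
  show "negligible 0" by (simp add: negligible_def)
  show "negligible f \<Longrightarrow> negligible g \<Longrightarrow> negligible (f + g)" using kernel_add[of f g] by (simp add: negligible_kernel)
  show "negligible f \<Longrightarrow> negligible (g * f)" using kernel_mult_left[of f g] by (simp add: negligible_kernel)
  show "negligible f \<Longrightarrow> negligible (f * g)" using kernel_mult_right[of f g] by (simp add: negligible_kernel)
  show "negligible f \<Longrightarrow> negligible (fscale c f)" using kernel_smult[of f c] by (simp add: negligible_kernel)
  show "negligible f \<Longrightarrow> negligible (fstar f)" using kernel_star[of f] by (simp add: negligible_kernel)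
  show "negligible f \<Longrightarrow> ext \<phi> f = 0" using kernel_orthogonal(4)[of f 0] by (simp add: negligible_kernel)
  show "negligible f \<Longrightarrow> negligible (- f)" using kernel_mult_left[of f "-1"] by (simp add: negligible_kernel)
qed

text \<open>The predicate under the choice operator depends only on the class of \<open>f\<close>,
  so equivalent elements get the same representative.\<close>

definition rep :: "free \<Rightarrow> free" where "rep f = (SOME g. negligible (f - g))"

lemma negligible_rep: "negligible (f - rep f)"
  unfolding rep_def by (rule someI[of _ f]) (simp add: negligible_rules)

lemma rep_eq_iff: "rep f = rep g \<longleftrightarrow> negligible (f - g)"
proof
  assume "rep f = rep g"
  then show "negligible (f - g)"
    using negligible_rules(2)[OF negligible_rep[of f] negligible_rules(8)[OF negligible_rep[of g]]] by simp
next
  assume fg: "negligible (f - g)"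
  have "negligible (f - h) \<longleftrightarrow> negligible (g - h)" for h
    using negligible_rules(2)[OF fg, of "g - h"] negligible_rules(2)[OF negligible_rules(8)[OF fg], of "f - h"] by auto
  then show "rep f = rep g" by (simp add: rep_def)
qed

text \<open>The quotient map, with a class encoded by the coefficients of its canonical
  representative.\<close>

definition q :: "free \<Rightarrow> point" where "q f = coeffs (rep f)"

lemma q_eq_iff: "q f = q g \<longleftrightarrow> negligible (f - g)"
  using inj_coeffs by (simp add: q_def inj_eq rep_eq_iff)

text \<open>A section of \<open>q\<close>. It is neither additive nor multiplicative;
  \<open>negligible_r\<close> makes up for this.\<close>

definition r :: "point \<Rightarrow> free" where "r x = inv_into UNIV q x"

lemma q_r: "q (r (q f)) = q f"
  by (simp add: r_def f_inv_into_f)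

lemma negligible_r: "negligible (r (q f) - f)"
  using q_r q_eq_iff by blast

definition alg :: "point star_algebra" where
  "alg = \<lparr>carrier = range q, mult = (\<lambda>x y. q (r x * r y)), one = q 1, zero = q 0, add = (\<lambda>x y. q (r x + r y)),
     smult = (\<lambda>c x. q (fscale c (r x))), star = (\<lambda>x. q (fstar (r x)))\<rparr>"

definition tr :: "point \<Rightarrow> complex" where "tr x = ext \<phi> (r x)"

lemma alg_simps:
  "carrier alg = range q" "\<one>\<^bsub>alg\<^esub> = q 1" "\<zero>\<^bsub>alg\<^esub> = q 0"
  "q f \<otimes>\<^bsub>alg\<^esub> q g = q (f * g)" "q f \<oplus>\<^bsub>alg\<^esub> q g = q (f + g)" "c \<odot>\<^bsub>alg\<^esub> q f = q (fscale c f)"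
  "star alg (q f) = q (fstar f)" "tr (q f) = ext \<phi> f"
proof -
  have d: "r (q f) * r (q g) - f * g = (r (q f) - f) * r (q g) + f * (r (q g) - g)" by (simp add: algebra_simps)
  show "q f \<otimes>\<^bsub>alg\<^esub> q g = q (f * g)"
    by (simp add: alg_def q_eq_iff d negligible_rules negligible_r)
  have d: "r (q f) + r (q g) - (f + g) = (r (q f) - f) + (r (q g) - g)" by simp
  show "q f \<oplus>\<^bsub>alg\<^esub> q g = q (f + g)"
    by (simp add: alg_def q_eq_iff d negligible_rules negligible_r)
  have d: "fscale c (r (q f)) - fscale c f = fscale c (r (q f) - f)" by (simp add: fscale_def algebra_simps)
  show "c \<odot>\<^bsub>alg\<^esub> q f = q (fscale c f)" by (simp add: alg_def q_eq_iff d negligible_rules negligible_r)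
  have d: "fstar (r (q f)) - fstar f = fstar (r (q f) - f)"
    using fstar_add[of "r (q f) - f" f] by (simp add: algebra_simps)
  show "star alg (q f) = q (fstar f)" by (simp add: alg_def q_eq_iff d negligible_rules negligible_r)
  show "tr (q f) = ext \<phi> f" using negligible_rules(7)[OF negligible_r[of f]] by (simp add: tr_def ext_diff)
qed (simp_all add: alg_def)

lemma alg_pow: "q f [^]\<^bsub>alg\<^esub> (m::nat) = q (f ^ m)"
  by (induction m) (simp_all add: alg_simps nat_pow_def power_commutes)

lemma alg_trace_reduced: "trace_reduced alg tr"
proof -
  have "complex_star_algebra alg"
    by (rule complex_star_algebra_image[OF free_complex_star_algebra, where q = q]) (simp_all add: alg_simps)
  moreover have "positive_trace alg tr"
    using pos by (auto simp: positive_trace_def linear_functional_def alg_simps)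
  moreover have "faithful alg tr"
    by (auto simp: faithful_def alg_simps q_eq_iff negligible_def)
  ultimately show ?thesis by (simp add: trace_reduced_def tracial_star_algebra_def)
qed

end

section \<open>Matrices over the algebra of all points\<close>

text \<open>All complex sequences with pointwise operations. Countably many coordinates suffice to
  record every pair of a word and a natural scaling factor.\<close>

definition point_algebra :: "(complex, point) module" where
  "point_algebra = \<lparr>carrier = UNIV, mult = (\<lambda>x y k. x k * y k), one = (\<lambda>k. 1), zero = (\<lambda>k. 0),
     add = (\<lambda>x y k. x k + y k), smult = (\<lambda>c x k. c * x k)\<rparr>"

lemma point_algebra_simps [simp]:
  "carrier point_algebra = UNIV" "x \<otimes>\<^bsub>point_algebra\<^esub> y = (\<lambda>k. x k * y k)" "\<one>\<^bsub>point_algebra\<^esub> = (\<lambda>k. 1)"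
  "\<zero>\<^bsub>point_algebra\<^esub> = (\<lambda>k. 0)" "x \<oplus>\<^bsub>point_algebra\<^esub> y = (\<lambda>k. x k + y k)" "c \<odot>\<^bsub>point_algebra\<^esub> x = (\<lambda>k. c * x k)"
  by (simp_all add: point_algebra_def)

lemma cring_point_algebra: "cring point_algebra"
proof (rule cringI)
  show "abelian_group point_algebra"
  proof (rule abelian_groupI)
    show "\<exists>y\<in>carrier point_algebra. y \<oplus>\<^bsub>point_algebra\<^esub> x = \<zero>\<^bsub>point_algebra\<^esub>" for x
      by (auto intro!: exI[of _ "\<lambda>k. - x k"])
  qed (auto simp: algebra_simps)
  show "comm_monoid point_algebra" by (rule comm_monoidI) (auto simp: algebra_simps)
qed (auto simp: algebra_simps)

lemma algebra_point_algebra: "Module.algebra complex_ring point_algebra"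
  by (rule algebraI[OF cring_complex_ring cring_point_algebra]) (auto simp: algebra_simps)

lemma finsum_point_algebra: "finite S \<Longrightarrow> (\<Oplus>\<^bsub>point_algebra\<^esub>k\<in>S. f k) = (\<lambda>m. \<Sum>k\<in>S. f k m)"
proof (induction S rule: finite_induct)
  interpret cring point_algebra by (rule cring_point_algebra)
  case empty
  then show ?case by simp
next
  interpret cring point_algebra by (rule cring_point_algebra)
  case (insert x S)
  then show ?case by (simp add: finsum_insert)
qed

text \<open>A nonzero polynomial has finitely many roots, so it cannot vanish at all natural
  numbers. The argument \<open>l\<close> will be the scaling factor and \<open>c s\<close> an entry
  of the component of degree \<open>s\<close>.\<close>

lemma polynomial_zero_coeffs:
  fixes c :: "nat \<Rightarrow> complex"
  assumes "\<And>l::nat. (\<Sum>s\<le>N. of_nat l ^ s * c s) = 0" shows "s \<le> N \<Longrightarrow> c s = 0"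
proof -
  have "\<forall>s\<le>N. c s = 0"
  proof (rule ccontr)
    assume "\<not> (\<forall>s\<le>N. c s = 0)"
    then obtain s where "s \<le> N" "c s \<noteq> 0" by blast
    then have "finite {z. (\<Sum>s\<le>N. c s * z ^ s) = 0}"
      using polyfun_finite_roots[of c N] by blast
    moreover have "range (of_nat :: nat \<Rightarrow> complex) \<subseteq> {z. (\<Sum>s\<le>N. c s * z ^ s) = 0}"
      using assms by (auto simp: mult.commute)
    ultimately have "finite (range (of_nat :: nat \<Rightarrow> complex))" by (rule rev_finite_subset)
    then show False using finite_imageD[OF _ inj_of_nat] by blast
  qed
  then show "s \<le> N \<Longrightarrow> c s = 0" by blast
qed

context truncated_trace
begin

text \<open>The coordinate \<open>m\<close> encodes a word \<open>w\<close> and a scaling factor \<open>l\<close> of the letters; letting \<open>l\<close> vary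
  separates the homogeneous components.\<close>

definition matrix :: "free \<Rightarrow> nat \<times> nat \<Rightarrow> point" where
  "matrix f = (\<lambda>(i, j) \<in> {..<n} \<times> {..<n}. \<lambda>m. case from_nat m of (w, l) \<Rightarrow>
     if w \<in> W then ext (\<lambda>v. of_nat l ^ wlen v * walk n w (letters v) i j) f else (0 :: complex))"

text \<open>\<open>matrix\<close> vanishes exactly on the kernel of the trace, so it factors through
  an injective map on the quotient. The unit is not preserved: coordinates encoding a word outside
  \<open>W\<close> are 0.\<close>

lemma matrix_embedding:
  assumes pos: "positive_trace free_star_algebra (ext \<phi>)"
    and ker: "\<And>f. ext \<phi> (fstar f * f) = 0 \<longleftrightarrow> (\<forall>s. \<forall>e\<in>E. ext (entry e) (component s f) = 0)"
  shows "\<exists>h. complex_alg_embedding (free_trace.alg \<phi>) (matrix_algebra n point_algebra) h"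
proof -
  interpret free_trace \<phi> by standard (rule pos)
  have zero: "negligible f \<longleftrightarrow> matrix f = matrix 0" for f
  proof
    assume f: "negligible f"
    have "ext (\<lambda>v. of_nat l ^ wlen v * walk n w (letters v) i j) f = 0" if "w \<in> W" "i < n" "j < n" for w l i j
    proof -
      obtain N where N: "\<forall>w\<in>keys f. wlen w \<le> N" using wlen_bounded by blast
      have "ext (\<lambda>v. of_nat l ^ wlen v * walk n w (letters v) i j) (component s f) = of_nat l ^ s * ext (entry (w, i, j)) (component s f)" for s
        unfolding ext_fun_cmult[symmetric] by (intro ext_cong) (auto dest: keys_component simp: entry_def)
      also have "\<dots> s = 0" for s
        using f that by (simp add: negligible_def ker E_def)
      finally show ?thesis using ext_sum[of _ "\<lambda>s. component s f" "{..N}"] component_sum[of f N] N by simp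
    qed
    then show "matrix f = matrix 0"
      by (auto simp: matrix_def fun_eq_iff split: prod.split)
  next
    assume m: "matrix f = matrix 0"
    obtain N where N: "\<forall>w\<in>keys f. wlen w \<le> N" using wlen_bounded by blast
    have "ext (entry (w, i, j)) (component s f) = 0" if "w \<in> W" "i < n" "j < n" for w i j s
    proof (cases "s \<le> N")
      case True
      have "(\<Sum>s\<le>N. of_nat l ^ s * ext (entry (w, i, j)) (component s f)) = 0" for l
      proof -
        have "of_nat l ^ s * ext (entry (w, i, j)) (component s f) = ext (\<lambda>v. of_nat l ^ wlen v * walk n w (letters v) i j) (component s f)" for s
          unfolding ext_fun_cmult[symmetric] by (intro ext_cong) (auto dest: keys_component simp: entry_def)
        then have "(\<Sum>s\<le>N. of_nat l ^ s * ext (entry (w, i, j)) (component s f)) = ext (\<lambda>v. of_nat l ^ wlen v * walk n w (letters v) i j) f"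
          using ext_sum[of _ "\<lambda>s. component s f" "{..N}"] component_sum[of f N] N by simp
        also have "\<dots> = matrix f (i, j) (to_nat (w, l))" using that by (simp add: matrix_def)
        also have "\<dots> = 0" unfolding m using that by (simp add: matrix_def)
        finally show ?thesis .
      qed
      then show ?thesis using polynomial_zero_coeffs[where c = "\<lambda>s. ext (entry (w, i, j)) (component s f)" and N = N] True by blast
    next
      case False
      then have "component s f = 0" using N by (intro poly_mapping_eqI) (auto simp: component.rep_eq in_keys_iff)
      then show ?thesis by simp
    qed
    then show "negligible f" by (auto simp: negligible_def ker E_def)
  qed
  have sub: "matrix (f - g) = matrix 0 \<longleftrightarrow> matrix f = matrix g" for f g
    by (auto simp: matrix_def fun_eq_iff ext_diff restrict_def split: prod.splits if_splits)
  have eq: "matrix f = matrix g \<longleftrightarrow> q f = q g" for f g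
    using zero[of "f - g"] sub[of f g] by (simp add: q_eq_iff)
  define h where "h x = matrix (r x)" for x
  have h: "h (q f) = matrix f" for f unfolding h_def eq q_r ..
  have closed: "matrix f \<in> carrier (matrix_algebra n point_algebra)" for f
    by (auto simp: matrix_def matrix_algebra_def)
  have madd: "matrix (f + g) = matrix f \<oplus>\<^bsub>matrix_algebra n point_algebra\<^esub> matrix g" for f g
    by (auto simp: matrix_def matrix_algebra_def ext_add fun_eq_iff split: prod.split)
  have mscale: "matrix (fscale c f) = c \<odot>\<^bsub>matrix_algebra n point_algebra\<^esub> matrix f" for c f
    by (auto simp: matrix_def matrix_algebra_def ext_fscale fun_eq_iff split: prod.split)
  \<comment> \<open>Scaling every letter by \<open>l\<close> multiplies a word by
    \<open>l ^ wlen v\<close>; word length is additive, so each coordinate remains a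
    representation.\<close>
  have walk: "ext (\<lambda>v. of_nat l ^ wlen v * walk n w (letters v) i j) (f * g) =
      (\<Sum>k<n. ext (\<lambda>v. of_nat l ^ wlen v * walk n w (letters v) i k) f * ext (\<lambda>v. of_nat l ^ wlen v * walk n w (letters v) k j) g)"
    if "i < n" for l w i j f g
  proof -
    have "(of_nat l :: complex) ^ wlen (u + v) * walk n w (letters (u + v)) i j =
       (\<Sum>k<n. (of_nat l ^ wlen u * walk n w (letters u) i k) * (of_nat l ^ wlen v * walk n w (letters v) k j))" for u v
      using that by (simp add: walk_append power_add sum_distrib_left mult_ac)
    then show ?thesis
      unfolding ext_mult by (simp only: ext_fun_sum ext_fun_cmult ext_fun_cmult_right)
  qed
  have mmult: "matrix (f * g) = matrix f \<otimes>\<^bsub>matrix_algebra n point_algebra\<^esub> matrix g" for f g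
  proof (rule ext)
    fix ij :: "nat \<times> nat"
    obtain i j where ij: "ij = (i, j)" by (cases ij)
    show "matrix (f * g) ij = (matrix f \<otimes>\<^bsub>matrix_algebra n point_algebra\<^esub> matrix g) ij"
      by (auto simp: ij matrix_algebra_def finsum_point_algebra fun_eq_iff matrix_def walk split: prod.split)
  qed
  have "complex_alg_embedding alg (matrix_algebra n point_algebra) h"
    unfolding complex_alg_embedding_def complex_alg_hom_def
    by (auto simp: alg_simps h closed madd mmult mscale eq inj_on_def)
  then show ?thesis by blast
qed

end

section \<open>Hilbert spaces and adjoints\<close>

lemma cinner_add_right: "cinner x (y + z) = cinner x y + cinner x z"
  by (metis cinner_commute cinner_add_left complex_cnj_add)

lemma cinner_scaleC_right: "cinner x (c *\<^sub>C y) = cnj c * cinner x y"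
  by (metis cinner_commute cinner_scaleC_left complex_cnj_mult)

lemma cinner_zero [simp]: "cinner 0 y = 0" "cinner x 0 = 0"
  using cinner_add_left[of 0 0 y] cinner_add_right[of x 0 0] by auto

lemma cinner_minus_left: "cinner (- x) y = - cinner x y"
  using cinner_add_left[of x "- x" y] by (simp add: eq_neg_iff_add_eq_0 add.commute)

lemma cinner_minus_right: "cinner x (- y) = - cinner x y"
  using cinner_add_right[of x y "- y"] by (simp add: eq_neg_iff_add_eq_0 add.commute)

lemma cinner_diff_right: "cinner x (y - z) = cinner x y - cinner x z"
  using cinner_add_right[of x y "- z"] by (simp add: cinner_minus_right)

lemma cinner_scaleR_left: "cinner (r *\<^sub>R x) y = of_real r * cinner x y"
  by (simp add: scaleR_scaleC cinner_scaleC_left)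

lemma cinner_scaleR_right: "cinner x (r *\<^sub>R y) = of_real r * cinner x y"
  by (simp add: scaleR_scaleC cinner_scaleC_right)

lemma cinner_ext: "(\<And>x. cinner x a = cinner x b) \<Longrightarrow> a = b"
  using cinner_self[of "a - b"] by (simp add: cinner_diff_right)

lemma norm2_cinner: "(norm x)\<^sup>2 = Re (cinner x x)"
  by (simp add: cinner_self)

lemma norm2_add: "(norm (x + y))\<^sup>2 = (norm x)\<^sup>2 + 2 * Re (cinner x y) + (norm y)\<^sup>2"
  using cinner_commute[of y x] by (simp add: norm2_cinner cinner_add_left cinner_add_right)

lemma norm_scaleC: "norm (c *\<^sub>C (x::'h::complex_hilbert_space)) = cmod c * norm x"
proof -
  have "complex_of_real ((norm (c *\<^sub>C x))\<^sup>2) = c * cnj c * of_real ((norm x)\<^sup>2)"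
    by (simp only: cinner_self[symmetric] cinner_scaleC_left cinner_scaleC_right mult.assoc mult.left_commute)
  also have "\<dots> = of_real ((cmod c * norm x)\<^sup>2)"
    by (simp add: complex_norm_square[symmetric] power_mult_distrib)
  finally have "(norm (c *\<^sub>C x))\<^sup>2 = (cmod c * norm x)\<^sup>2" using of_real_eq_iff by blast
  then show ?thesis by (simp add: power2_eq_iff_nonneg)
qed

text \<open>A factor \<open>u\<close> of modulus 1 turns the inner product into its modulus; then
  \<open>x\<close> is scaled to the norm of \<open>y\<close> and the squared distance of the two
  vectors is expanded.\<close>

lemma cinner_le_norm: "cmod (cinner x y) \<le> norm x * norm y"
proof (cases "cinner x y = 0")
  case False
  define u where "u = cnj (sgn (cinner x y))"
  have u: "cmod u = 1" using False by (simp add: u_def norm_sgn)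
  have "of_real (cmod (cinner x y)) = u * cinner x y"
    using complex_norm_square[of "cinner x y"] False by (simp add: u_def sgn_eq power2_eq_square field_simps)
  then have re: "Re (cinner (u *\<^sub>C x) y) = cmod (cinner x y)"
    by (metis Re_complex_of_real cinner_scaleC_left)
  have nx: "norm (u *\<^sub>C x) = norm x" using u by (simp add: norm_scaleC)
  have "x \<noteq> 0" "y \<noteq> 0" using False by auto
  define s where "s = norm y / norm x"
  have "0 \<le> (norm (s *\<^sub>R (u *\<^sub>C x) + (-1) *\<^sub>R y))\<^sup>2" by simp
  also have "\<dots> = s\<^sup>2 * (norm x)\<^sup>2 - 2 * s * cmod (cinner x y) + (norm y)\<^sup>2"
    unfolding norm2_add using re by (simp add: cinner_scaleR_left cinner_minus_right nx power_mult_distrib)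
  finally have "2 * s * cmod (cinner x y) \<le> 2 * (norm y)\<^sup>2"
    using \<open>x \<noteq> 0\<close> by (simp add: s_def power_divide)
  then have "s * cmod (cinner x y) \<le> (norm y)\<^sup>2" by simp
  then show ?thesis using \<open>x \<noteq> 0\<close> \<open>y \<noteq> 0\<close> by (simp add: s_def field_simps power2_eq_square)
qed simp

lemma bounded_linear_scaleC: "bounded_linear (\<lambda>x::'h::complex_hilbert_space. c *\<^sub>C x)"
  by (rule bounded_linear_intro[where K = "cmod c"])
     (simp_all add: scaleC_add_right scaleR_scaleC scaleC_scaleC mult.commute norm_scaleC)

text \<open>The representing vector minimizes \<open>\<parallel>x\<parallel>\<^sup>2 - 2 Re (f x)\<close>.\<close>

lemma riesz_representation:
  fixes f :: "'h::complex_hilbert_space \<Rightarrow> complex"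
  assumes add: "\<And>x y. f (x + y) = f x + f y" and scale: "\<And>c x. f (c *\<^sub>C x) = c * f x"
    and K: "\<And>x. cmod (f x) \<le> K * norm x"
  shows "\<exists>y. \<forall>x. f x = cinner x y"
proof -
  have scaleR: "f (r *\<^sub>R x) = of_real r * f x" for r x by (simp add: scaleR_scaleC scale)
  define J where "J x = (norm x)\<^sup>2 - 2 * Re (f x)" for x
  have "- K\<^sup>2 \<le> J x" for x
  proof -
    have "Re (f x) \<le> K * norm x" using K[of x] complex_Re_le_cmod[of "f x"] by linarith
    moreover have "0 \<le> (norm x - K)\<^sup>2" by simp
    ultimately show ?thesis by (simp add: J_def power2_diff mult.commute)
  qed
  then have bdd: "bdd_below (range J)" by (intro bdd_belowI[of _ "- K\<^sup>2"]) auto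
  define m where "m = Inf (range J)"
  have m_le: "m \<le> J x" for x unfolding m_def using bdd by (intro cInf_lower) auto
  have "\<exists>x. J x < m + 1 / real (Suc k)" for k
    using cInf_lessD[of "range J" "m + 1 / real (Suc k)"] by (auto simp: m_def)
  then obtain X where X: "J (X k) < m + 1 / real (Suc k)" for k by metis
  \<comment> \<open>By the parallelogram law the midpoint of two near-minimisers would undercut
    \<open>m\<close> unless they are close; hence a minimising sequence is Cauchy.\<close>
  have mid: "(norm (x - y))\<^sup>2 \<le> 2 * (J x - m) + 2 * (J y - m)" for x y
  proof -
    have "4 * J ((1/2) *\<^sub>R (x + y)) = (norm (x + y))\<^sup>2 - 4 * Re (f x) - 4 * Re (f y)"
    proof -
      have n: "(norm ((1/2) *\<^sub>R (x + y)))\<^sup>2 = (norm (x + y))\<^sup>2 / 4" by (simp add: power_divide)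
      show ?thesis unfolding J_def n scaleR add by (simp add: field_simps)
    qed
    moreover have "(norm (x + y))\<^sup>2 + (norm (x - y))\<^sup>2 = 2 * (norm x)\<^sup>2 + 2 * (norm y)\<^sup>2"
      using norm2_add[of x y] norm2_add[of x "- y"] by (simp add: cinner_minus_right)
    ultimately have "(norm (x - y))\<^sup>2 = 2 * J x + 2 * J y - 4 * J ((1/2) *\<^sub>R (x + y))"
      by (simp add: J_def)
    then show ?thesis using m_le[of "(1/2) *\<^sub>R (x + y)"] by simp
  qed
  have "Cauchy X"
  proof (rule metric_CauchyI)
    fix e :: real assume e: "e > 0"
    obtain N where N: "1 / real (Suc N) < e\<^sup>2 / 4" using e nat_approx_posE[of "e\<^sup>2 / 4"] by auto
    have "dist (X p) (X q) < e" if "p \<ge> N" "q \<ge> N" for p q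
    proof -
      have close: "J (X p) - m < e\<^sup>2 / 4" if "p \<ge> N" for p
      proof -
        have "J (X p) - m < 1 / real (Suc p)" using X[of p] by simp
        also have "\<dots> \<le> 1 / real (Suc N)" using that by (intro divide_left_mono) auto
        finally show ?thesis using N by simp
      qed
      have "(norm (X p - X q))\<^sup>2 \<le> 2 * (J (X p) - m) + 2 * (J (X q) - m)" by (rule mid)
      also have "\<dots> < 2 * (e\<^sup>2 / 4) + 2 * (e\<^sup>2 / 4)"
        using close[OF that(1)] close[OF that(2)] by (intro add_strict_mono mult_strict_left_mono) auto
      finally have "(norm (X p - X q))\<^sup>2 < e\<^sup>2" by simp
      then show ?thesis using e power_less_imp_less_base[of "norm (X p - X q)" 2 e] by (simp add: dist_norm)
    qed
    then show "\<exists>M. \<forall>p\<ge>M. \<forall>q\<ge>M. dist (X p) (X q) < e" by blast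
  qed
  then obtain z where z: "X \<longlonglongrightarrow> z" using Cauchy_convergent convergentD by blast
  have bl: "bounded_linear f"
    by (rule bounded_linear_intro[where K = K]) (use add scaleR K in \<open>auto simp: scaleR_conv_of_real mult.commute\<close>)
  have "(\<lambda>k. J (X k)) \<longlonglongrightarrow> J z" unfolding J_def
    using z by (intro tendsto_intros bounded_linear.tendsto[OF bl])
  moreover have "(\<lambda>k. m + 1 / real (Suc k)) \<longlonglongrightarrow> m + 0"
    using LIMSEQ_Suc[OF lim_1_over_n] by (intro tendsto_add tendsto_const) (simp add: inverse_eq_divide)
  ultimately have "J z \<le> m"
    using X by (intro LIMSEQ_le[of "\<lambda>k. J (X k)" _ "\<lambda>k. m + 1 / real (Suc k)"]) (auto intro: less_imp_le)
  have re: "Re (f w) = Re (cinner w z)" for w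
  proof (rule ccontr)
    assume ne: "Re (f w) \<noteq> Re (cinner w z)"
    define d where "d = Re (f w) - Re (cinner w z)"
    have d: "d \<noteq> 0" using ne by (simp add: d_def)
    have "0 \<le> t\<^sup>2 * (norm w)\<^sup>2 - 2 * t * d" for t :: real
    proof -
      have "J z \<le> J (z + t *\<^sub>R w)" using \<open>J z \<le> m\<close> m_le order.trans by blast
      moreover have "Re (cinner z w) = Re (cinner w z)" using cinner_commute[of z w] by simp
      ultimately show ?thesis
        by (simp add: J_def norm2_add add scaleR cinner_scaleR_right d_def power_mult_distrib algebra_simps)
    qed
    \<comment> \<open>Up to the added 1, this is the minimiser of the quadratic in \<open>t\<close>;
      the 1 keeps the denominator positive when \<open>w = 0\<close>.\<close>
    from this[of "d / ((norm w)\<^sup>2 + 1)"] have "0 \<le> d\<^sup>2 * ((norm w)\<^sup>2 / ((norm w)\<^sup>2 + 1)\<^sup>2 - 2 / ((norm w)\<^sup>2 + 1))"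
      by (simp add: power_divide power2_eq_square algebra_simps)
    then have "0 \<le> (norm w)\<^sup>2 / ((norm w)\<^sup>2 + 1)\<^sup>2 - 2 / ((norm w)\<^sup>2 + 1)"
      using d by (simp add: zero_le_mult_iff)
    moreover have "(norm w)\<^sup>2 / ((norm w)\<^sup>2 + 1)\<^sup>2 < 2 / ((norm w)\<^sup>2 + 1)"
    proof -
      have p: "(norm w)\<^sup>2 + 1 > 0" by (simp add: add_nonneg_pos)
      have "(norm w)\<^sup>2 < 2 * ((norm w)\<^sup>2 + 1)" using p by simp
      then have "(norm w)\<^sup>2 / ((norm w)\<^sup>2 + 1)\<^sup>2 < 2 * ((norm w)\<^sup>2 + 1) / ((norm w)\<^sup>2 + 1)\<^sup>2"
        using p by (intro divide_strict_right_mono) auto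
      also have "2 * r / r\<^sup>2 = 2 / r" for r :: real by (simp add: power2_eq_square)
      finally show ?thesis .
    qed
    ultimately show False by simp
  qed
  have "f w = cinner w z" for w
    using re[of w] re[of "\<i> *\<^sub>C w"] by (simp add: scale cinner_scaleC_left complex_eq_iff)
  then show ?thesis by blast
qed

lemma blinfun_comp_assoc: "(R o\<^sub>L S) o\<^sub>L T = R o\<^sub>L (S o\<^sub>L T)"
  by (rule blinfun_eqI) simp

text \<open>Riesz gives the values of the adjoint; complex linearity of \<open>T\<close> makes the
  functional complex linear. The bound comes from applying Cauchy--Schwarz to
  \<open>cinner (T (S y)) y\<close>, the square of the norm of \<open>S y\<close>.\<close>

lemma adjoint_exists:
  assumes T: "complex_linear_op (T :: 'h::complex_hilbert_space \<Rightarrow>\<^sub>L 'h)"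
  shows "\<exists>S :: 'h \<Rightarrow>\<^sub>L 'h. \<forall>x y. cinner (T x) y = cinner x (S y)"
proof -
  have "\<exists>s. \<forall>x. cinner (T x) y = cinner x s" for y
  proof (rule riesz_representation[where K = "norm T * norm y"])
    show "cmod (cinner (T x) y) \<le> norm T * norm y * norm x" for x
      using order.trans[OF cinner_le_norm[of "T x" y] mult_right_mono[OF norm_blinfun[of T x] norm_ge_zero[of y]]]
      by (simp add: mult_ac)
  qed (use T in \<open>simp_all add: blinfun.add_right cinner_add_left complex_linear_op_def cinner_scaleC_left\<close>)
  then obtain S where S: "\<And>x y. cinner (T x) y = cinner x (S y)" by metis
  have "bounded_linear S"
  proof (rule bounded_linear_intro[where K = "norm T"])
    show "S (x + y) = S x + S y" for x y
      by (rule cinner_ext) (simp add: S[symmetric] cinner_add_right)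
    show "S (r *\<^sub>R x) = r *\<^sub>R S x" for r x
      by (rule cinner_ext) (simp add: S[symmetric] cinner_scaleR_right)
    show "norm (S y) \<le> norm y * norm T" for y
    proof (cases "S y = 0")
      case False
      have "(norm (S y))\<^sup>2 = cmod (cinner (S y) (S y))" unfolding cinner_self norm_of_real by simp
      also have "\<dots> = cmod (cinner (T (S y)) y)" by (simp add: S)
      also have "\<dots> \<le> norm (T (S y)) * norm y" by (rule cinner_le_norm)
      also have "\<dots> \<le> (norm T * norm (S y)) * norm y" by (intro mult_right_mono norm_blinfun) auto
      finally show ?thesis using False by (simp add: power2_eq_square mult_ac)
    qed simp
  qed
  then show ?thesis using S by (intro exI[of _ "Blinfun S"]) (simp add: bounded_linear_Blinfun_apply)
qed

lemma adjoint_unique: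
  assumes "\<forall>x y. cinner (blinfun_apply T x) y = cinner x (blinfun_apply S y)" shows "adjoint_op T = S"
  unfolding adjoint_op_def
proof (rule the_equality[where a = S])
  show "S' = S" if "\<forall>x y. cinner (blinfun_apply T x) y = cinner x (blinfun_apply S' y)" for S'
    using assms that by (intro blinfun_eqI cinner_ext) metis
qed (use assms in auto)

lemma adjoint_apply: "complex_linear_op T \<Longrightarrow> cinner (blinfun_apply T x) y = cinner x (adjoint_op T y)"
  using adjoint_exists[of T] adjoint_unique[of T] by metis

lemma adjoint_apply': "complex_linear_op T \<Longrightarrow> cinner (adjoint_op T x) y = cinner x (T y)"
  using adjoint_apply[of T y x] cinner_commute by metis

lemma norm_adjoint:
  assumes "complex_linear_op T" shows "norm (adjoint_op T) \<le> norm T"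
proof (rule norm_blinfun_bound)
  fix y
  let ?s = "adjoint_op T y"
  show "norm ?s \<le> norm T * norm y"
  proof (cases "?s = 0")
    case False
    have "(norm ?s)\<^sup>2 = cmod (cinner ?s ?s)" unfolding cinner_self norm_of_real by simp
    also have "\<dots> = cmod (cinner (T ?s) y)" using adjoint_apply[OF assms, of ?s y] by simp
    also have "\<dots> \<le> norm (T ?s) * norm y" by (rule cinner_le_norm)
    also have "\<dots> \<le> (norm T * norm ?s) * norm y" by (intro mult_right_mono norm_blinfun) auto
    finally show ?thesis using False by (simp add: power2_eq_square mult_ac)
  qed simp
qed simp

lemma scale_op_apply [simp]: "scale_op c T x = c *\<^sub>C T x"
  unfolding scale_op_def
  by (intro fun_cong[OF bounded_linear_Blinfun_apply] bounded_linear_compose[OF bounded_linear_scaleC] blinfun.bounded_linear_right)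

lemma norm_scale_op: "norm (scale_op c T) \<le> cmod c * norm T"
proof (rule norm_blinfun_bound)
  show "norm (scale_op c T x) \<le> cmod c * norm T * norm x" for x
    using mult_left_mono[OF norm_blinfun[of T x], of "cmod c"] by (simp add: norm_scaleC mult.assoc)
qed simp

lemma scaleC_one [simp]: "1 *\<^sub>C x = x"
  using scaleR_scaleC[of 1 x] by simp

lemma scale_op_minus: "scale_op (-1) T = - T"
proof (rule blinfun_eqI)
  show "scale_op (-1) T x = (- T) x" for x
    using scaleR_scaleC[of "-1" "T x"] by (simp add: blinfun.minus_left)
qed

lemma scale_op_zero [simp]: "scale_op 0 T = 0"
proof (rule blinfun_eqI)
  show "scale_op 0 T x = (0 :: 'a \<Rightarrow>\<^sub>L 'a) x" for x
    using scaleR_scaleC[of 0 "T x"] by simp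
qed

lemma scale_op_of_real: "scale_op (of_real r) T = r *\<^sub>R T"
  by (intro blinfun_eqI) (simp add: blinfun.scaleR_left scaleR_scaleC)

lemma operator_algebra_simps [simp]:
  "carrier (operator_algebra M) = M" "mult (operator_algebra M) = (o\<^sub>L)" "one (operator_algebra M) = id_blinfun"
  "zero (operator_algebra M) = 0" "add (operator_algebra M) = (+)" "smult (operator_algebra M) = scale_op"
  "star (operator_algebra M) = adjoint_op"
  by (simp_all add: operator_algebra_def)

section \<open>Von Neumann algebras as complex star-algebras\<close>

locale vn_algebra =
  fixes M :: "('h::complex_hilbert_space \<Rightarrow>\<^sub>L 'h) set"
  assumes vn: "von_neumann_algebra M"
begin

lemma lin: "T \<in> M \<Longrightarrow> complex_linear_op T"
  and M_id [simp]: "id_blinfun \<in> M"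
  and M_add [simp]: "S \<in> M \<Longrightarrow> T \<in> M \<Longrightarrow> S + T \<in> M"
  and M_scale [simp]: "T \<in> M \<Longrightarrow> scale_op c T \<in> M"
  and M_comp [simp]: "S \<in> M \<Longrightarrow> T \<in> M \<Longrightarrow> S o\<^sub>L T \<in> M"
  and M_adj [simp]: "T \<in> M \<Longrightarrow> adjoint_op T \<in> M"
  using vn by (auto simp: von_neumann_algebra_def)

lemma M_minus [simp]: "T \<in> M \<Longrightarrow> - T \<in> M"
  using M_scale[of T "-1"] by (simp add: scale_op_minus)

lemma M_diff [simp]: "S \<in> M \<Longrightarrow> T \<in> M \<Longrightarrow> S - T \<in> M"
  using M_add[of S "- T"] by simp

lemma M_zero [simp]: "0 \<in> M"
  using M_diff[OF M_id M_id] by simp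

lemmas adj = adjoint_apply[OF lin] adjoint_apply'[OF lin]

lemma complex_star_operator_algebra: "complex_star_algebra (operator_algebra M)"
proof (rule complex_star_algebraI)
  show "ring (operator_algebra M)"
  proof (rule ringI)
    show "abelian_group (operator_algebra M)"
    proof (rule abelian_groupI)
      show "\<exists>y\<in>carrier (operator_algebra M). y \<oplus>\<^bsub>operator_algebra M\<^esub> x = \<zero>\<^bsub>operator_algebra M\<^esub>"
        if "x \<in> carrier (operator_algebra M)" for x
        using that by (auto intro!: bexI[of _ "- x"])
    qed (auto simp: algebra_simps)
    show "Group.monoid (operator_algebra M)"
      by (rule monoidI) (auto intro!: blinfun_eqI)
  qed (auto intro!: blinfun_eqI simp: blinfun.add_left blinfun.add_right)
next
  fix x y c
  assume x: "x \<in> carrier (operator_algebra M)"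
  then show "star (operator_algebra M) (star (operator_algebra M) x) = x"
    by (auto intro!: adjoint_unique simp: adjoint_apply'[OF lin])
  show "star (operator_algebra M) (c \<odot>\<^bsub>operator_algebra M\<^esub> x) = cnj c \<odot>\<^bsub>operator_algebra M\<^esub> star (operator_algebra M) x"
    using x by (auto intro!: adjoint_unique simp: adj cinner_scaleC_left cinner_scaleC_right)
  assume y: "y \<in> carrier (operator_algebra M)"
  show "star (operator_algebra M) (x \<oplus>\<^bsub>operator_algebra M\<^esub> y) = star (operator_algebra M) x \<oplus>\<^bsub>operator_algebra M\<^esub> star (operator_algebra M) y"
    using x y by (auto intro!: adjoint_unique simp: adj blinfun.add_left cinner_add_left cinner_add_right)
  show "star (operator_algebra M) (x \<otimes>\<^bsub>operator_algebra M\<^esub> y) = star (operator_algebra M) y \<otimes>\<^bsub>operator_algebra M\<^esub> star (operator_algebra M) x"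
    using x y by (auto intro!: adjoint_unique simp: adj)
  show "x \<otimes>\<^bsub>operator_algebra M\<^esub> (c \<odot>\<^bsub>operator_algebra M\<^esub> y) = c \<odot>\<^bsub>operator_algebra M\<^esub> (x \<otimes>\<^bsub>operator_algebra M\<^esub> y)"
    using x lin by (auto intro!: blinfun_eqI simp: complex_linear_op_def)
qed (auto intro!: blinfun_eqI simp: blinfun.add_left scaleC_add_left scaleC_add_right scaleC_scaleC)

end


section \<open>Normal functionals and separability\<close>

text \<open>All ultraweak coordinates at once: the ultraweak topology is the pullback of the product
  topology along this map.\<close>

definition pairing :: "('h::complex_hilbert_space \<Rightarrow>\<^sub>L 'h) \<Rightarrow> (nat \<Rightarrow> 'h) \<times> (nat \<Rightarrow> 'h) \<Rightarrow> complex" where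
  "pairing T = (\<lambda>(x, y). if square_summable x \<and> square_summable y then suminf (\<lambda>k. cinner (T (x k)) (y k)) else 0)"

lemma ultraweak_eq: "ultraweak_topology = pullback_topology UNIV pairing euclidean"
  by (simp add: ultraweak_topology_def pairing_def[abs_def])

text \<open>Norms of square-summable sequences have summable products, and their sum bounds the
  functional. Consequently the ultraweak topology is coarser than the norm topology.\<close>

lemma bounded_linear_pairing:
  fixes p :: "(nat \<Rightarrow> 'h::complex_hilbert_space) \<times> (nat \<Rightarrow> 'h)"
  shows "bounded_linear (\<lambda>T. pairing T p)"
proof (cases p)
  case (Pair x y)
  show ?thesis
  proof (cases "square_summable x \<and> square_summable y")
    case True
    have bd: "norm (norm (x k) * norm (y k)) \<le> (norm (x k))\<^sup>2 + (norm (y k))\<^sup>2" for k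
      using sum_squares_bound[of "norm (x k)" "norm (y k)"] mult_nonneg_nonneg[OF norm_ge_zero[of "x k"] norm_ge_zero[of "y k"]]
      unfolding real_norm_def abs_mult abs_norm_cancel by linarith
    have sxy: "summable (\<lambda>k. norm (x k) * norm (y k))"
    proof (rule summable_comparison_test'[where N = 0])
      show "summable (\<lambda>k. (norm (x k))\<^sup>2 + (norm (y k))\<^sup>2)"
        using True by (intro summable_add) (simp_all add: square_summable_def)
    qed (rule bd)
    have le: "cmod (cinner (T (x k)) (y k)) \<le> norm T * (norm (x k) * norm (y k))" for T :: "'h \<Rightarrow>\<^sub>L 'h" and k
      using order.trans[OF cinner_le_norm[of "T (x k)" "y k"] mult_right_mono[OF norm_blinfun[of T "x k"] norm_ge_zero[of "y k"]]]
      by (simp add: mult.assoc)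
    have sn: "summable (\<lambda>k. cmod (cinner (T (x k)) (y k)))" for T :: "'h \<Rightarrow>\<^sub>L 'h"
    proof (rule summable_comparison_test'[where N = 0])
      show "summable (\<lambda>k. norm T * (norm (x k) * norm (y k)))" using sxy by (rule summable_mult)
    qed (simp add: le)
    have s: "summable (\<lambda>k. cinner (T (x k)) (y k))" for T :: "'h \<Rightarrow>\<^sub>L 'h"
      using sn by (rule summable_norm_cancel)
    have "bounded_linear (\<lambda>T. suminf (\<lambda>k. cinner (blinfun_apply T (x k)) (y k)))"
    proof (rule bounded_linear_intro[where K = "suminf (\<lambda>k. norm (x k) * norm (y k))"])
      show "(suminf (\<lambda>k. cinner ((S + T) (x k)) (y k))) = (suminf (\<lambda>k. cinner (S (x k)) (y k))) + (suminf (\<lambda>k. cinner (T (x k)) (y k)))" for S T :: "'h \<Rightarrow>\<^sub>L 'h"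
        using suminf_add[OF s s, of S T] by (simp add: blinfun.add_left cinner_add_left)
      show "(suminf (\<lambda>k. cinner ((r *\<^sub>R T) (x k)) (y k))) = r *\<^sub>R (suminf (\<lambda>k. cinner (T (x k)) (y k)))" for r and T :: "'h \<Rightarrow>\<^sub>L 'h"
        using suminf_mult[OF s, of "of_real r" T] by (simp add: blinfun.scaleR_left cinner_scaleR_left scaleR_conv_of_real)
      show "norm (suminf (\<lambda>k. cinner (T (x k)) (y k))) \<le> norm T * (suminf (\<lambda>k. norm (x k) * norm (y k)))" for T :: "'h \<Rightarrow>\<^sub>L 'h"
      proof -
        have "norm (suminf (\<lambda>k. cinner (T (x k)) (y k))) \<le> (suminf (\<lambda>k. cmod (cinner (T (x k)) (y k))))" by (rule summable_norm[OF sn])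
        also have "\<dots> \<le> (suminf (\<lambda>k. norm T * (norm (x k) * norm (y k))))" using le sn summable_mult[OF sxy] by (intro suminf_le) auto
        also have "\<dots> = norm T * (suminf (\<lambda>k. norm (x k) * norm (y k)))" by (rule suminf_mult[OF sxy])
        finally show ?thesis .
      qed
    qed
    then show ?thesis using Pair True by (simp add: pairing_def)
  qed (use Pair in \<open>auto simp: pairing_def intro: bounded_linear_zero\<close>)
qed

lemma continuous_pairing: "continuous_on UNIV pairing"
  by (rule continuous_on_coordinatewise_then_product)
     (rule linear_continuous_on[OF bounded_linear_pairing])

context vn_algebra
begin

text \<open>An ultraweak neighbourhood of 0 contains a norm ball, so the functional is smaller than
  1 on a ball of \<open>M\<close>; rescaling to radius \<open>d / 2\<close> gives the
  constant.\<close>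

lemma normal_functional_bounded:
  assumes "normal_functional M \<psi>"
  shows "\<exists>C\<ge>0. \<forall>T\<in>M. cmod (\<psi> T) \<le> C * norm T"
proof -
  have scale: "\<psi> (scale_op c T) = c * \<psi> T" if "T \<in> M" for c T
    using assms that by (simp add: normal_functional_def linear_functional_def)
  have zero: "\<psi> 0 = 0" using scale[OF M_zero, of 0] by simp
  have cont: "continuous_map (subtopology ultraweak_topology M) euclidean \<psi>"
    using assms by (simp add: normal_functional_def)
  have ts: "topspace (subtopology ultraweak_topology M) = M"
    by (simp add: ultraweak_eq topspace_pullback_topology)
  have "openin (subtopology ultraweak_topology M) {T \<in> M. \<psi> T \<in> ball 0 1}"
    using openin_continuous_map_preimage[OF cont, of "ball 0 1"] unfolding ts by simp
  then obtain U where U: "open U" "{T \<in> M. \<psi> T \<in> ball 0 1} = (pairing -` U) \<inter> M"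
    by (auto simp: openin_subtopology ultraweak_eq openin_pullback_topology)
  have "open (pairing -` U)"
    by (rule open_vimage[OF U(1) continuous_pairing])
  moreover have "0 \<in> pairing -` U" using U(2) zero M_zero by auto
  ultimately obtain d where d: "d > 0" "ball 0 d \<subseteq> pairing -` U" using open_contains_ball by blast
  have "cmod (\<psi> T) \<le> 2 / d * norm T" if T: "T \<in> M" for T
  proof (cases "T = 0")
    case False
    define T' where "T' = scale_op (of_real (d / (2 * norm T))) T"
    have "T' = (d / (2 * norm T)) *\<^sub>R T" unfolding T'_def by (rule scale_op_of_real)
    then have "norm T' = d / 2" using False d by simp
    then have "T' \<in> pairing -` U" using d by (intro set_mp[OF d(2)]) simp
    moreover have "T' \<in> M" using T by (simp add: T'_def)
    ultimately have "T' \<in> {T \<in> M. \<psi> T \<in> ball 0 1}" using U(2) by blast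
    then have "cmod (\<psi> T') < 1" by simp
    moreover have "\<psi> T' = of_real (d / (2 * norm T)) * \<psi> T" by (simp only: T'_def scale[OF T])
    ultimately have "d / (2 * norm T) * cmod (\<psi> T) < 1" using d by (simp add: norm_mult norm_divide)
    then show ?thesis using d False by (simp add: field_simps)
  qed (simp add: zero)
  then show ?thesis using d by (intro exI[of _ "2 / d"]) auto
qed

text \<open>The rough constant \<open>C\<close> serves only to show that the supremum in
  \<open>functional_norm\<close> is taken over a bounded set; homogeneity does the rest.\<close>

lemma functional_norm_bound:
  assumes b: "\<forall>T\<in>M. cmod (\<psi> T) \<le> C * norm T" and scale: "\<And>c T. T \<in> M \<Longrightarrow> \<psi> (scale_op c T) = c * \<psi> T" and T: "T \<in> M"
  shows "cmod (\<psi> T) \<le> functional_norm M \<psi> * norm T"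
proof (cases "T = 0")
  case False
  have bdd: "bdd_above ((\<lambda>T. cmod (\<psi> T)) ` {T \<in> M. norm T \<le> 1})"
  proof (intro bdd_aboveI2)
    fix T assume "T \<in> {T \<in> M. norm T \<le> 1}"
    then have "cmod (\<psi> T) \<le> C * norm T" "norm T \<le> 1" using b by auto
    then show "cmod (\<psi> T) \<le> \<bar>C\<bar>"
      by (meson abs_ge_self abs_ge_zero mult_left_le mult_right_mono norm_ge_zero order.trans)
  qed
  define T' where "T' = scale_op (of_real (1 / norm T)) T"
  have "T' = (1 / norm T) *\<^sub>R T" unfolding T'_def by (rule scale_op_of_real)
  then have "norm T' \<le> 1" using False by simp
  moreover have "T' \<in> M" using T by (simp add: T'_def)
  ultimately have "T' \<in> {T \<in> M. norm T \<le> 1}" by simp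
  then have "cmod (\<psi> T') \<le> functional_norm M \<psi>"
    unfolding functional_norm_def using bdd by (intro cSUP_upper) auto
  moreover have "cmod (\<psi> T') = cmod (\<psi> T) / norm T"
    unfolding T'_def scale[OF T] norm_mult norm_of_real by simp
  ultimately show ?thesis using False by (simp add: field_simps)
qed (use scale[OF M_zero, of 0] in simp)

text \<open>Left multiplication by the adjoint of \<open>x\<close> moves \<open>x\<close> to the
  second vectors of the pairing, and applying \<open>x\<close> keeps a sequence square-summable.
  Translation thus permutes ultraweak coordinates and is ultraweakly continuous.\<close>

lemma normal_left_translate:
  assumes x: "x \<in> M" and \<psi>: "normal_functional M \<psi>"
  shows "normal_functional M (\<lambda>T. \<psi> (adjoint_op x o\<^sub>L T))"
proof -
  interpret complex_star_algebra "operator_algebra M" by (rule complex_star_operator_algebra)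
  have lin: "linear_functional (operator_algebra M) (\<lambda>T. \<psi> (adjoint_op x o\<^sub>L T))"
    using \<psi> x A_r_distr[of _ _ "adjoint_op x"] smult_mult_right[of "adjoint_op x"]
    by (simp add: normal_functional_def linear_functional_def)
  define F where "F z = (\<lambda>(a, b). if square_summable a \<and> square_summable b then z (a, \<lambda>k. x (b k)) else 0)"
    for z :: "(nat \<Rightarrow> 'h) \<times> (nat \<Rightarrow> 'h) \<Rightarrow> complex"
  have pF: "pairing (adjoint_op x o\<^sub>L T) = F (pairing T)" for T
  proof (rule HOL.ext)
    fix p :: "(nat \<Rightarrow> 'h) \<times> (nat \<Rightarrow> 'h)"
    obtain a b where p: "p = (a, b)" by (cases p)
    have "square_summable (\<lambda>k. x (b k))" if "square_summable b"
      unfolding square_summable_def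
    proof (rule summable_comparison_test'[where N = 0])
      show "summable (\<lambda>k. (norm x)\<^sup>2 * (norm (b k))\<^sup>2)" using that by (simp add: square_summable_def summable_mult)
      show "norm ((norm (x (b k)))\<^sup>2) \<le> (norm x)\<^sup>2 * (norm (b k))\<^sup>2" for k
        using power_mono[OF norm_blinfun[of x "b k"], of 2] by (simp add: power_mult_distrib)
    qed
    then show "pairing (adjoint_op x o\<^sub>L T) p = F (pairing T) p"
      using adj(2)[OF x] by (auto simp: p pairing_def F_def)
  qed
  have "continuous_on UNIV F"
  proof (rule continuous_on_coordinatewise_then_product)
    show "continuous_on UNIV (\<lambda>z. F z p)" for p
    proof (cases p)
      case (Pair a b)
      then show ?thesis
        by (cases "square_summable a \<and> square_summable b") (auto simp: F_def)
    qed
  qed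
  then have "continuous_map euclidean euclidean F" by simp
  then have "continuous_map ultraweak_topology euclidean (F \<circ> pairing)"
    unfolding ultraweak_eq by (rule continuous_map_pullback)
  then have "continuous_map ultraweak_topology euclidean (pairing \<circ> (\<lambda>T. adjoint_op x o\<^sub>L T))"
    by (simp add: comp_def pF)
  then have "continuous_map ultraweak_topology ultraweak_topology (\<lambda>T. adjoint_op x o\<^sub>L T)"
    by (subst (2) ultraweak_eq, intro continuous_map_pullback') auto
  then have "continuous_map (subtopology ultraweak_topology M) (subtopology ultraweak_topology M) (\<lambda>T. adjoint_op x o\<^sub>L T)"
    using x by (auto simp: continuous_map_in_subtopology continuous_map_from_subtopology)
  moreover have "continuous_map (subtopology ultraweak_topology M) euclidean \<psi>"
    using \<psi> by (simp add: normal_functional_def)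
  ultimately have "continuous_map (subtopology ultraweak_topology M) euclidean (\<lambda>T. \<psi> (adjoint_op x o\<^sub>L T))"
    using continuous_map_compose[of _ _ "\<lambda>T. adjoint_op x o\<^sub>L T" _ \<psi>] by (simp add: comp_def)
  then show ?thesis using lin by (simp add: normal_functional_def)
qed

end

section \<open>Density and convergence in 2-norm\<close>

locale tracial_vn = vn_algebra M for M :: "('h::complex_hilbert_space \<Rightarrow>\<^sub>L 'h) set" +
  fixes \<tau> :: "('h \<Rightarrow>\<^sub>L 'h) \<Rightarrow> complex"
  assumes fnt: "faithful_normal_tracial_state M \<tau>" and sep: "separable_predual M"
begin

sublocale tracial_algebra "operator_algebra M" \<tau>
  using fnt by (intro tracial_algebra.intro complex_star_operator_algebra tracial_algebra_axioms.intro)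
    (simp add: faithful_normal_tracial_state_def)

lemma tau_normal: "normal_functional M \<tau>"
  using fnt by (simp add: faithful_normal_tracial_state_def)

definition L2norm :: "('h \<Rightarrow>\<^sub>L 'h) \<Rightarrow> real" where
  "L2norm T = sqrt (Re (\<tau> (adjoint_op T o\<^sub>L T)))"

lemma L2norm_sq: "T \<in> M \<Longrightarrow> \<tau> (adjoint_op T o\<^sub>L T) = of_real ((L2norm T)\<^sup>2)"
  and L2norm_nonneg [simp]: "T \<in> M \<Longrightarrow> 0 \<le> L2norm T"
  using tr_real_pos[of T] by (auto simp: L2norm_def)

lemma diff_star: "x \<in> M \<Longrightarrow> y \<in> M \<Longrightarrow> adjoint_op (x - y) = adjoint_op x - adjoint_op y"
  using star_add[of x "- y"] star_smult[of y "-1"] by (simp add: scale_op_minus)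

lemma tau_diff: "x \<in> M \<Longrightarrow> y \<in> M \<Longrightarrow> \<tau> (x - y) = \<tau> x - \<tau> y"
  using tr_add[of x "- y"] tr_smult[of y "-1"] by (simp add: scale_op_minus)

text \<open>The trace embeds \<open>M\<close> into its predual by sending \<open>x\<close> to the
  functional \<open>f x\<close>. If \<open>x\<close> and \<open>y\<close> in the ball of radius
  \<open>N\<close> have functionals within \<open>\<delta>\<close> of the same \<rho>, then the
  squared 2-norm of \<open>y - x\<close>, which is \<open>f y - f x\<close> evaluated at
  \<open>y - x\<close>, is at most \<open>4 * N * \<delta>\<close>. So one element for each radius,
  \<rho> and tolerance suffices.\<close>

lemma dense_sequence:
  "\<exists>g :: nat \<Rightarrow> 'h \<Rightarrow>\<^sub>L 'h. g 0 = 0 \<and> (\<forall>j. g j \<in> M) \<and>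
     (\<forall>x\<in>M. \<forall>\<epsilon>>0. \<exists>j. norm (g j) \<le> norm x + 1 \<and> L2norm (g j - x) < \<epsilon>)"
proof -
  obtain D where D: "countable D" "D \<subseteq> predual M"
    "\<forall>\<psi>\<in>predual M. \<forall>\<epsilon>>0. \<exists>\<rho>\<in>D. functional_norm M (\<lambda>T. \<psi> T - \<rho> T) < \<epsilon>"
    using sep unfolding separable_predual_def by blast
  define f where "f x = restrict (\<lambda>T. \<tau> (adjoint_op x o\<^sub>L T)) M" for x
  have fM: "f x \<in> predual M" if x: "x \<in> M" for x
  proof -
    have "normal_functional M (\<lambda>T. \<tau> (adjoint_op x o\<^sub>L T))" by (rule normal_left_translate[OF x tau_normal])
    then have "linear_functional (operator_algebra M) (f x)"
      "continuous_map (subtopology ultraweak_topology M) euclidean (f x)"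
      unfolding normal_functional_def linear_functional_def f_def
      by (auto elim!: continuous_map_eq)
    then show ?thesis by (simp add: predual_def normal_functional_def f_def)
  qed
  define P where "P = (\<lambda>(N::nat, \<rho>, k::nat) x. x \<in> M \<and> norm x \<le> real N \<and> functional_norm M (\<lambda>T. f x T - \<rho> T) < 1 / real (Suc k))"
  define pick where "pick i = (if \<exists>x. P i x then SOME x. P i x else 0)" for i
  define G where "G = pick ` (UNIV \<times> D \<times> UNIV)"
  have pickP: "P i (pick i)" if "P i x" for i x
    using someI[of "P i" x] that by (auto simp: pick_def)
  have pickM: "pick i \<in> M" for i
  proof (cases "\<exists>x. P i x")
    case True
    then have "P i (pick i)" using pickP by blast
    then show ?thesis by (cases i) (simp add: P_def)
  qed (simp add: pick_def)
  have "countable G" unfolding G_def using D(1) by (intro countable_image countable_SIGMA) auto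
  moreover have "G \<noteq> {}"
    using D(3) fM[OF M_zero] by (force simp: G_def intro: zero_less_one)
  ultimately have G: "range (from_nat_into G) = G" by (rule range_from_nat_into[rotated])
  \<comment> \<open>The value 0 comes first, so that a candidate of admissible norm is available
    from the first stage on.\<close>
  define g where "g = case_nat 0 (from_nat_into G)"
  have "from_nat_into G k \<in> M" for k
    using from_nat_into[OF \<open>G \<noteq> {}\<close>, of k] pickM by (auto simp: G_def)
  then have "g j \<in> M" for j
    by (cases j) (auto simp: g_def)
  moreover have "\<exists>j. norm (g j) \<le> norm x + 1 \<and> L2norm (g j - x) < \<epsilon>" if x: "x \<in> M" and e: "\<epsilon> > 0" for x \<epsilon>
  proof -
    define N where "N = nat \<lceil>norm x\<rceil>"
    have "0 \<le> \<lceil>norm x\<rceil>" using norm_ge_zero[of x] by linarith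
    then have N: "norm x \<le> real N" "real N \<le> norm x + 1" unfolding N_def by linarith+
    \<comment> \<open>The denominator is a bound for twice the norm \<open>2 * real N\<close> of the
      difference \<open>d\<close>, made positive by adding 1.\<close>
    obtain k where k: "1 / real (Suc k) < \<epsilon>\<^sup>2 / (4 * (real N + 1))"
      using nat_approx_posE[of "\<epsilon>\<^sup>2 / (4 * (real N + 1))"] e by auto
    obtain \<rho> where \<rho>: "\<rho> \<in> D" "functional_norm M (\<lambda>T. f x T - \<rho> T) < 1 / real (Suc k)"
      using D(3) fM[OF x] by (metis of_nat_0_less_iff zero_less_Suc zero_less_divide_1_iff)
    let ?i = "(N, \<rho>, k)"
    have "P ?i x" using x N \<rho> by (simp add: P_def)
    then have "P ?i (pick ?i)" by (rule pickP)
    then have y: "pick ?i \<in> M" "norm (pick ?i) \<le> real N" "functional_norm M (\<lambda>T. f (pick ?i) T - \<rho> T) < 1 / real (Suc k)"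
      by (auto simp: P_def)
    have "pick ?i \<in> G" using \<rho> by (auto simp: G_def)
    then obtain j where "from_nat_into G j = pick ?i" using G by (metis imageE)
    then have gj: "g (Suc j) = pick ?i" by (simp add: g_def)
    define d where "d = pick ?i - x"
    have d: "d \<in> M" "norm d \<le> 2 * real N" using x y N norm_triangle_ineq4[of "pick ?i" x] by (auto simp: d_def)
    have rho_normal: "normal_functional M \<rho>" using \<rho> D(2) by (auto simp: predual_def)
    have bound: "cmod (f z d - \<rho> d) \<le> 1 / real (Suc k) * (2 * real N)"
      if z: "z \<in> M" "functional_norm M (\<lambda>T. f z T - \<rho> T) < 1 / real (Suc k)" for z
    proof -
      have fn: "normal_functional M (f z)" using fM[OF z(1)] by (simp add: predual_def)
      obtain C1 C2 where C: "\<forall>T\<in>M. cmod (f z T) \<le> C1 * norm T" "\<forall>T\<in>M. cmod (\<rho> T) \<le> C2 * norm T"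
        using normal_functional_bounded[OF fn] normal_functional_bounded[OF rho_normal] by blast
      have "\<forall>T\<in>M. cmod (f z T - \<rho> T) \<le> (C1 + C2) * norm T"
      proof
        fix T assume "T \<in> M"
        then have "cmod (f z T) \<le> C1 * norm T" "cmod (\<rho> T) \<le> C2 * norm T" using C by auto
        then show "cmod (f z T - \<rho> T) \<le> (C1 + C2) * norm T"
          using norm_triangle_ineq4[of "f z T" "\<rho> T"] by (simp add: distrib_right)
      qed
      then have "cmod (f z d - \<rho> d) \<le> functional_norm M (\<lambda>T. f z T - \<rho> T) * norm d"
        using fn rho_normal d by (intro functional_norm_bound) (auto simp: normal_functional_def linear_functional_def right_diff_distrib)
      also have "\<dots> \<le> 1 / real (Suc k) * (2 * real N)"
        using z(2) d by (intro order.trans[OF mult_right_mono mult_left_mono]) auto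
      finally show ?thesis .
    qed
    have "(L2norm d)\<^sup>2 = cmod (\<tau> (adjoint_op d o\<^sub>L d))" using L2norm_sq[OF d(1)] by (simp del: of_real_power)
    also have "\<tau> (adjoint_op d o\<^sub>L d) = f (pick ?i) d - f x d"
    proof -
      have "adjoint_op d o\<^sub>L d = (adjoint_op (pick ?i) o\<^sub>L d) - (adjoint_op x o\<^sub>L d)"
        using x y by (simp add: d_def diff_star bounded_bilinear.diff_left[OF bounded_bilinear_blinfun_compose])
      then show ?thesis using x y d by (simp add: f_def tau_diff)
    qed
    also have "\<dots> = (f (pick ?i) d - \<rho> d) - (f x d - \<rho> d)" by simp
    also have "cmod \<dots> \<le> 1 / real (Suc k) * (2 * real N) + 1 / real (Suc k) * (2 * real N)"
      by (rule order.trans[OF norm_triangle_ineq4 add_mono[OF bound[OF y(1,3)] bound[OF x \<rho>(2)]]])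
    also have "\<dots> = 1 / real (Suc k) * (4 * real N)" unfolding distrib_left[symmetric] by simp
    also have "\<dots> \<le> 1 / real (Suc k) * (4 * (real N + 1))" by (intro mult_left_mono) auto
    also have "\<dots> < \<epsilon>\<^sup>2" using k by (simp add: pos_less_divide_eq)
    finally have "L2norm d < \<epsilon>" using e by (simp add: power_less_imp_less_base)
    then show ?thesis using gj y N by (intro exI[of _ "Suc j"]) (auto simp: d_def)
  qed
  ultimately show ?thesis by (intro exI[of _ g]) (auto simp: g_def)
qed


lemma L2norm_bound: "\<exists>C\<ge>0. \<forall>T\<in>M. L2norm T \<le> C * norm T"
proof -
  obtain C where C: "C \<ge> 0" "\<forall>T\<in>M. cmod (\<tau> T) \<le> C * norm T"
    using normal_functional_bounded[OF tau_normal] by blast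
  have "L2norm T \<le> sqrt C * norm T" if T: "T \<in> M" for T
  proof -
    have "Re (\<tau> (adjoint_op T o\<^sub>L T)) \<le> cmod (\<tau> (adjoint_op T o\<^sub>L T))" by (rule complex_Re_le_cmod)
    also have "\<dots> \<le> C * norm (adjoint_op T o\<^sub>L T)" using C T by simp
    also have "\<dots> \<le> C * (norm T * norm T)"
      using C(1) order.trans[OF norm_blinfun_compose mult_right_mono[OF norm_adjoint[OF lin[OF T]] norm_ge_zero]]
      by (intro mult_left_mono) auto
    finally show ?thesis unfolding L2norm_def by (intro real_le_lsqrt) (use C in \<open>auto simp: power_mult_distrib power2_eq_square[of "norm T"]\<close>)
  qed
  then show ?thesis using C by (intro exI[of _ "sqrt C"]) auto
qed

lemma tau_cs: "x \<in> M \<Longrightarrow> y \<in> M \<Longrightarrow> cmod (\<tau> (adjoint_op x o\<^sub>L y)) \<le> L2norm x * L2norm y"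
  using tr_cs[of x y] by (simp add: L2norm_def)

lemma L2norm_scale: "x \<in> M \<Longrightarrow> L2norm (scale_op c x) = cmod c * L2norm x"
proof -
  assume x: "x \<in> M"
  have "\<tau> (adjoint_op (scale_op c x) o\<^sub>L scale_op c x) = cnj c * c * \<tau> (adjoint_op x o\<^sub>L x)"
    using x star_smult[of x c] smult_mult_left[of "adjoint_op x" "scale_op c x" "cnj c"] smult_mult_right[of "adjoint_op x" x c]
      tr_smult by simp
  also have "\<dots> = of_real ((cmod c * L2norm x)\<^sup>2)"
    using x complex_norm_square[of c] by (simp add: L2norm_sq power_mult_distrib mult.commute)
  finally have e: "\<tau> (adjoint_op (scale_op c x) o\<^sub>L scale_op c x) = of_real ((cmod c * L2norm x)\<^sup>2)" .
  have "L2norm (scale_op c x) = sqrt ((cmod c * L2norm x)\<^sup>2)"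
    unfolding L2norm_def[of "scale_op c x"] e Re_complex_of_real ..
  then show ?thesis using L2norm_nonneg[OF x] by (simp add: abs_mult)
qed

lemma L2norm_star: "x \<in> M \<Longrightarrow> L2norm (adjoint_op x) = L2norm x"
  using tr_comm[of x "adjoint_op x"] star_star[of x] by (simp add: L2norm_def)

lemma L2norm_triangle:
  assumes "x \<in> M" "y \<in> M" shows "L2norm (x + y) \<le> L2norm x + L2norm y"
proof (rule power2_le_imp_le)
  have "\<tau> (adjoint_op (x + y) o\<^sub>L (x + y)) = \<tau> (adjoint_op x o\<^sub>L x) + \<tau> (adjoint_op x o\<^sub>L y) + \<tau> (adjoint_op y o\<^sub>L x) + \<tau> (adjoint_op y o\<^sub>L y)"
    using tr_expand[of x y 1] cscale_one[of y] assms by simp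
  then have "(L2norm (x + y))\<^sup>2 = (L2norm x)\<^sup>2 + Re (\<tau> (adjoint_op x o\<^sub>L y)) + Re (\<tau> (adjoint_op y o\<^sub>L x)) + (L2norm y)\<^sup>2"
    using L2norm_sq[of "x + y"] assms by (simp add: L2norm_sq complex_eq_iff)
  also have "\<dots> \<le> (L2norm x)\<^sup>2 + L2norm x * L2norm y + L2norm y * L2norm x + (L2norm y)\<^sup>2"
    using tau_cs[of x y] tau_cs[of y x] assms order.trans[OF complex_Re_le_cmod] by (intro add_mono) auto
  finally show "(L2norm (x + y))\<^sup>2 \<le> (L2norm x + L2norm y)\<^sup>2" by (simp add: power2_sum algebra_simps)
qed (use assms in simp)

text \<open>Convergence in 2-norm inside some operator norm ball. The uniform bound is what makes
  multiplication continuous.\<close>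

definition conv :: "(nat \<Rightarrow> 'h \<Rightarrow>\<^sub>L 'h) \<Rightarrow> ('h \<Rightarrow>\<^sub>L 'h) \<Rightarrow> bool" where
  "conv u x \<longleftrightarrow> (\<forall>n. u n \<in> M) \<and> x \<in> M \<and> (\<exists>N. \<forall>n. norm (u n) \<le> N) \<and> (\<lambda>n. L2norm (u n - x)) \<longlonglongrightarrow> 0"

lemma convD: "conv u x \<Longrightarrow> u n \<in> M" "conv u x \<Longrightarrow> x \<in> M" "conv u x \<Longrightarrow> (\<lambda>n. L2norm (u n - x)) \<longlonglongrightarrow> 0"
  by (auto simp: conv_def)

lemma conv_const: "x \<in> M \<Longrightarrow> conv (\<lambda>n. x) x"
  using tr_zero by (auto simp: conv_def L2norm_def)

lemma conv_add:
  assumes u: "conv u x" and v: "conv v y" shows "conv (\<lambda>n. u n + v n) (x + y)"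
proof -
  have "(\<lambda>n. L2norm (u n + v n - (x + y))) \<longlonglongrightarrow> 0"
  proof (rule tendsto_sandwich[OF _ _ tendsto_const tendsto_add_zero[OF convD(3)[OF u] convD(3)[OF v]]])
    have "L2norm (u n + v n - (x + y)) \<le> L2norm (u n - x) + L2norm (v n - y)" for n
      using L2norm_triangle[of "u n - x" "v n - y"] convD[OF u] convD[OF v] by (simp add: algebra_simps)
    then show "\<forall>\<^sub>F n in sequentially. L2norm (u n + v n - (x + y)) \<le> L2norm (u n - x) + L2norm (v n - y)" by simp
  qed (use convD[OF u] convD[OF v] in simp)
  moreover obtain N1 N2 where "\<forall>n. norm (u n) \<le> N1" "\<forall>n. norm (v n) \<le> N2" using u v by (auto simp: conv_def)
  then have "\<forall>n. norm (u n + v n) \<le> N1 + N2" by (meson add_mono norm_triangle_ineq order.trans)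
  ultimately show ?thesis using convD[OF u] convD[OF v] by (auto simp: conv_def)
qed

lemma conv_scale:
  assumes u: "conv u x" shows "conv (\<lambda>n. scale_op c (u n)) (scale_op c x)"
proof -
  have d: "scale_op c S - scale_op c T = scale_op c (S - T)" for S T :: "'h \<Rightarrow>\<^sub>L 'h"
  proof (rule blinfun_eqI)
    show "(scale_op c S - scale_op c T) z = scale_op c (S - T) z" for z
      using scaleC_add_right[of c "S z - T z" "T z"] by (simp add: blinfun.diff_left)
  qed
  have "(\<lambda>n. L2norm (scale_op c (u n) - scale_op c x)) \<longlonglongrightarrow> 0"
    using tendsto_mult_right_zero[OF convD(3)[OF u], of "cmod c"] convD[OF u] by (simp add: d L2norm_scale)
  moreover obtain N where "\<forall>n. norm (u n) \<le> N" using u by (auto simp: conv_def)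
  then have "\<forall>n. norm (scale_op c (u n)) \<le> cmod c * N" by (meson norm_scale_op mult_left_mono norm_ge_zero order.trans)
  ultimately show ?thesis using convD[OF u] by (auto simp: conv_def)
qed

lemma conv_diff: "conv u x \<Longrightarrow> conv v y \<Longrightarrow> conv (\<lambda>n. u n - v n) (x - y)"
  using conv_add[of u x "\<lambda>n. scale_op (-1) (v n)" "scale_op (-1) y"] conv_scale[of v y "-1"] by (simp add: scale_op_minus)

lemma conv_star:
  assumes u: "conv u x" shows "conv (\<lambda>n. adjoint_op (u n)) (adjoint_op x)"
proof -
  have "(\<lambda>n. L2norm (adjoint_op (u n) - adjoint_op x)) \<longlonglongrightarrow> 0"
    using convD[OF u] by (simp add: L2norm_star flip: diff_star)
  moreover obtain N where "\<forall>n. norm (u n) \<le> N" using u by (auto simp: conv_def)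
  then have "\<forall>n. norm (adjoint_op (u n)) \<le> N" using norm_adjoint[OF lin[OF convD(1)[OF u]]] order.trans by blast
  ultimately show ?thesis using convD[OF u] by (auto simp: conv_def)
qed

text \<open>By Cauchy--Schwarz the squared 2-norm of \<open>a n o\<^sub>L b n\<close> is at most the
  2-norm of \<open>b n\<close> times that of
  \<open>adjoint_op (a n) o\<^sub>L (a n o\<^sub>L b n)\<close>; the latter is bounded because the
  operator norms are.\<close>

lemma conv_zero_mult_left:
  assumes b: "conv b 0" and a: "\<And>n. a n \<in> M" "\<And>n. norm (a n) \<le> N"
  shows "conv (\<lambda>n. a n o\<^sub>L b n) 0"
proof -
  obtain K where K: "\<And>n. norm (b n) \<le> K" using b by (auto simp: conv_def)
  obtain C where C: "C \<ge> 0" "\<forall>T\<in>M. L2norm T \<le> C * norm T" using L2norm_bound by blast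
  have N0: "N \<ge> 0" "K \<ge> 0" using a(2)[of 0] K[of 0] norm_ge_zero order.trans by blast+
  note bM = convD[OF b]
  have le: "(L2norm (a n o\<^sub>L b n))\<^sup>2 \<le> L2norm (b n) * (C * (N * N * K))" for n
  proof -
    have "of_real ((L2norm (a n o\<^sub>L b n))\<^sup>2) = \<tau> (adjoint_op (b n) o\<^sub>L (adjoint_op (a n) o\<^sub>L (a n o\<^sub>L b n)))"
      using L2norm_sq[of "a n o\<^sub>L b n"] star_mult[of "a n" "b n"] a bM(1)[of n] by (simp add: blinfun_comp_assoc)
    then have "(L2norm (a n o\<^sub>L b n))\<^sup>2 = cmod (\<tau> (adjoint_op (b n) o\<^sub>L (adjoint_op (a n) o\<^sub>L (a n o\<^sub>L b n))))"
      by (metis norm_of_real abs_power2)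
    also have "\<dots> \<le> L2norm (b n) * L2norm (adjoint_op (a n) o\<^sub>L (a n o\<^sub>L b n))"
      using a bM by (intro tau_cs) auto
    also have "\<dots> \<le> L2norm (b n) * (C * norm (adjoint_op (a n) o\<^sub>L (a n o\<^sub>L b n)))"
      using a bM C by (intro mult_left_mono) auto
    also have "\<dots> \<le> L2norm (b n) * (C * (N * N * K))"
    proof -
      have "norm (adjoint_op (a n) o\<^sub>L (a n o\<^sub>L b n)) \<le> norm (adjoint_op (a n)) * (norm (a n) * norm (b n))"
        by (meson norm_blinfun_compose mult_left_mono norm_ge_zero order.trans)
      also have "\<dots> \<le> N * (N * K)"
        using a(2)[of n] K[of n] N0 norm_adjoint[OF lin[OF a(1)[of n]]] by (intro mult_mono) auto
      finally show ?thesis using C bM by (intro mult_left_mono) (auto simp: mult.assoc)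
    qed
    finally show ?thesis .
  qed
  have "(\<lambda>n. (L2norm (a n o\<^sub>L b n))\<^sup>2) \<longlonglongrightarrow> 0"
    by (rule tendsto_sandwich[OF _ _ tendsto_const tendsto_mult_left_zero[OF bM(3), of "C * (N * N * K)"]])
       (use le in auto)
  then have "(\<lambda>n. L2norm (a n o\<^sub>L b n)) \<longlonglongrightarrow> 0"
    using tendsto_real_sqrt[of "\<lambda>n. (L2norm (a n o\<^sub>L b n))\<^sup>2" 0] a bM by simp
  moreover have "norm (a n o\<^sub>L b n) \<le> N * K" for n
    using norm_blinfun_compose[of "a n" "b n"] a(2)[of n] K[of n] N0 by (meson mult_mono norm_ge_zero order.trans)
  ultimately show ?thesis using a bM by (auto simp: conv_def)
qed

lemma conv_mult:
  assumes u: "conv u x" and v: "conv v y" shows "conv (\<lambda>n. u n o\<^sub>L v n) (x o\<^sub>L y)"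
proof -
  obtain N1 N2 where N: "\<And>n. norm (u n) \<le> N1" "\<And>n. norm (v n) \<le> N2" using u v by (auto simp: conv_def)
  have M: "u n \<in> M" "v n \<in> M" "x \<in> M" "y \<in> M" for n using convD[OF u] convD[OF v] by auto
  have "conv (\<lambda>n. v n - y) 0" using conv_diff[OF v conv_const[OF M(4)]] by simp
  then have 1: "conv (\<lambda>n. u n o\<^sub>L (v n - y)) 0" by (rule conv_zero_mult_left) (use M N in auto)
  \<comment> \<open>The other half, where the null sequence stands on the left, is reduced to the
    first by taking adjoints, which preserve the 2-norm.\<close>
  have "conv (\<lambda>n. adjoint_op (u n - x)) 0"
    using conv_star[OF conv_diff[OF u conv_const[OF M(3)]]] star_zero by simp
  then have "conv (\<lambda>n. adjoint_op y o\<^sub>L adjoint_op (u n - x)) 0"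
    by (rule conv_zero_mult_left[where N = "norm (adjoint_op y)"]) (use M in auto)
  then have 2: "conv (\<lambda>n. (u n - x) o\<^sub>L y) 0"
    using conv_star[of "\<lambda>n. adjoint_op y o\<^sub>L adjoint_op (u n - x)" 0] M star_zero
       star_mult[of "adjoint_op y" "adjoint_op (u _ - x)"] star_star[of y] star_star[of "u _ - x"] by simp
  have "conv (\<lambda>n. (u n o\<^sub>L (v n - y)) + ((u n - x) o\<^sub>L y) + (x o\<^sub>L y)) (0 + 0 + (x o\<^sub>L y))"
    by (intro conv_add 1 2 conv_const) (use M in auto)
  moreover have "(u n o\<^sub>L (v n - y)) + ((u n - x) o\<^sub>L y) + (x o\<^sub>L y) = u n o\<^sub>L v n" for n
    by (simp add: bounded_bilinear.diff_left[OF bounded_bilinear_blinfun_compose] bounded_bilinear.diff_right[OF bounded_bilinear_blinfun_compose])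
  ultimately show ?thesis by simp
qed

lemma conv_tau:
  assumes u: "conv u x" shows "(\<lambda>n. \<tau> (u n)) \<longlonglongrightarrow> \<tau> x"
proof -
  have "cmod (\<tau> (u n) - \<tau> x) \<le> L2norm id_blinfun * L2norm (u n - x)" for n
    using tau_cs[of id_blinfun "u n - x"] convD[OF u] star_one A_l_one[of "u n - x"] by (simp add: tau_diff)
  then have "(\<lambda>n. \<tau> (u n) - \<tau> x) \<longlonglongrightarrow> 0"
    by (intro Lim_null_comparison[OF _ tendsto_mult_right_zero[OF convD(3)[OF u], of "L2norm id_blinfun"]]) auto
  then show ?thesis by (simp add: LIM_zero_iff)
qed

text \<open>Take the best of the first \<open>n\<close> candidates of norm at most \<open>norm x + 1\<close>.\<close>

lemma slow_approximation:
  assumes g0: "g 0 = 0" and gM: "\<forall>j. g j \<in> M"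
    and dense: "\<forall>x\<in>M. \<forall>\<epsilon>>0. \<exists>j. norm (g j) \<le> norm x + 1 \<and> L2norm (g j - x) < \<epsilon>" and x: "x \<in> M"
  shows "\<exists>s :: nat \<Rightarrow> nat. (\<forall>n\<ge>1. s n < n) \<and> conv (\<lambda>n. g (s n)) x"
proof -
  define S where "S n = {j. j < n \<and> norm (g j) \<le> norm x + 1}" for n
  define s where "s n = (if n = 0 then 0 else arg_min_on (\<lambda>j. L2norm (g j - x)) (S n))" for n
  have fin: "finite (S n)" for n by (simp add: S_def)
  \<comment> \<open>Index 0 is always admissible, since \<open>g 0 = 0\<close> has norm at most
    \<open>norm x + 1\<close>.\<close>
  have ne: "S n \<noteq> {}" if "n \<ge> 1" for n using that g0 by (force simp: S_def)
  have s: "s n \<in> S n" "\<And>j. j \<in> S n \<Longrightarrow> L2norm (g (s n) - x) \<le> L2norm (g j - x)" if "n \<ge> 1" for n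
    using arg_min_if_finite(1)[OF fin ne[OF that], of "\<lambda>j. L2norm (g j - x)"] arg_min_least[OF fin ne[OF that], of _ "\<lambda>j. L2norm (g j - x)"] that
    by (auto simp: s_def)
  have "(\<lambda>n. L2norm (g (s n) - x)) \<longlonglongrightarrow> 0"
  proof (rule LIMSEQ_I)
    fix \<epsilon> :: real assume "\<epsilon> > 0"
    then obtain j where j: "norm (g j) \<le> norm x + 1" "L2norm (g j - x) < \<epsilon>" using dense x by blast
    have "norm (L2norm (g (s n) - x) - 0) < \<epsilon>" if "n \<ge> Suc j" for n
      using s(2)[of n j] that j gM x by (simp add: S_def)
    then show "\<exists>no. \<forall>n\<ge>no. norm (L2norm (g (s n) - x) - 0) < \<epsilon>" by blast
  qed
  moreover have "norm (g (s n)) \<le> norm x + 1" for n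
    using s(1)[of n] g0 by (cases "n = 0") (auto simp: S_def s_def)
  ultimately show ?thesis using s(1) gM x by (intro exI[of _ s]) (auto simp: conv_def S_def)
qed

end

section \<open>The embedding\<close>

text \<open>An ultrafilter containing a singleton is principal, so every point, and then every
  initial segment, can be removed. Ordinary limits of sequences are therefore limits along
  \<omega>.\<close>

lemma nonprincipal_le_sequentially:
  assumes ultra: "ultrafilter_on I \<omega>" and np: "nonprincipal \<omega>" shows "\<omega> \<le> (sequentially :: nat filter)"
proof -
  have ne: "\<omega> \<noteq> bot" and um: "eventually P \<omega> \<or> eventually (\<lambda>i. \<not> P i) \<omega>" for P
    using ultra by (auto simp: ultrafilter_on_def)
  have ev: "eventually (\<lambda>i. i \<noteq> k) \<omega>" for k
  proof (rule ccontr)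
    assume "\<not> eventually (\<lambda>i. i \<noteq> k) \<omega>"
    then have k: "eventually (\<lambda>i. i = k) \<omega>" using um[of "\<lambda>i. i \<noteq> k"] by simp
    have "eventually P \<omega> \<longleftrightarrow> P k" for P
    proof
      assume "eventually P \<omega>"
      with k have "eventually (\<lambda>i. P k) \<omega>" by eventually_elim simp
      then show "P k" using ne by simp
    next
      assume "P k" with k show "eventually P \<omega>" by (auto elim: eventually_mono)
    qed
    then have "\<omega> = principal {k}" by (auto simp: filter_eq_iff eventually_principal)
    then show False using np by (auto simp: nonprincipal_def)
  qed
  have "eventually (\<lambda>i. i \<ge> N) \<omega>" for N
  proof (induction N)
    case (Suc N)
    then show ?case using ev[of N] by eventually_elim simp
  qed simp
  then show ?thesis unfolding le_sequentially by blast
qed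

text \<open>It converts an error bound on single words into one for the linear extension, and it is
  submultiplicative, so bounds survive products.\<close>

definition l1_norm :: "free \<Rightarrow> real" where
  "l1_norm f = (\<Sum>w\<in>keys f. cmod (lookup f w))"

lemma l1_norm_superset: "finite S \<Longrightarrow> keys f \<subseteq> S \<Longrightarrow> l1_norm f = (\<Sum>w\<in>S. cmod (lookup f w))"
  unfolding l1_norm_def by (intro sum.mono_neutral_left) (auto simp: in_keys_iff)

lemma l1_norm_nonneg: "0 \<le> l1_norm f"
  by (simp add: l1_norm_def sum_nonneg)

lemma l1_norm_single [simp]: "l1_norm (Poly_Mapping.single w c) = cmod c"
  by (simp add: l1_norm_def)

lemma l1_norm_zero [simp]: "l1_norm 0 = 0"
  by (simp add: l1_norm_def)

lemma l1_norm_add: "l1_norm (f + g) \<le> l1_norm f + l1_norm g"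
proof -
  let ?S = "keys f \<union> keys g"
  have "l1_norm (f + g) = (\<Sum>w\<in>?S. cmod (lookup (f + g) w))"
    by (intro l1_norm_superset) (auto simp: Poly_Mapping.keys_add)
  also have "\<dots> \<le> (\<Sum>w\<in>?S. cmod (lookup f w)) + (\<Sum>w\<in>?S. cmod (lookup g w))"
    unfolding sum.distrib[symmetric] by (intro sum_mono) (simp add: lookup_add norm_triangle_ineq)
  also have "\<dots> = l1_norm f + l1_norm g" by (simp add: l1_norm_superset[of ?S])
  finally show ?thesis .
qed

lemma l1_norm_sum: "l1_norm (sum f S) \<le> (\<Sum>i\<in>S. l1_norm (f i))"
  by (induction S rule: infinite_finite_induct) (auto intro: order.trans[OF l1_norm_add])

lemma l1_norm_mult: "l1_norm (f * g) \<le> l1_norm f * l1_norm g"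
proof -
  have "f * g = (\<Sum>u\<in>keys f. \<Sum>v\<in>keys g. Poly_Mapping.single (u + v) (lookup f u * lookup g v))"
    using arg_cong2[OF free_sum[of f] free_sum[of g], of "(*)"] by (simp add: sum_product mult_single)
  then have "l1_norm (f * g) \<le> (\<Sum>u\<in>keys f. \<Sum>v\<in>keys g. cmod (lookup f u) * cmod (lookup g v))"
    by (auto intro!: order.trans[OF l1_norm_sum] sum_mono simp: norm_mult)
  then show ?thesis by (simp add: l1_norm_def sum_product)
qed

lemma keys_fstar: "keys (fstar f) = word_star ` keys f"
  by (auto simp: in_keys_iff fstar.rep_eq intro: image_eqI[of _ _ "word_star _"])

lemma l1_norm_fstar: "l1_norm (fstar f) = l1_norm f"
proof -
  have "inj word_star" by (metis injI word_star_star)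
  then show ?thesis unfolding l1_norm_def keys_fstar by (subst sum.reindex) (auto simp: fstar.rep_eq intro: inj_on_subset)
qed

text \<open>The degree bound \<open>k\<close> stays fixed while \<open>n\<close> grows; once
  \<open>n > k\<close>, every word of \<open>f\<close> lies in the set \<open>W\<close> of stage
  \<open>n\<close>.\<close>

definition supported :: "nat \<Rightarrow> nat \<Rightarrow> free \<Rightarrow> bool" where
  "supported n k f \<longleftrightarrow> (\<forall>w\<in>keys f. set (letters w) \<subseteq> {..<n} \<times> UNIV \<and> wlen w \<le> k)"

lemma supported_add: "supported n k f \<Longrightarrow> supported n l g \<Longrightarrow> supported n (max k l) (f + g)"
  using Poly_Mapping.keys_add[of f g] unfolding supported_def by (fastforce simp: le_max_iff_disj)

lemma supported_mult: "supported n k f \<Longrightarrow> supported n l g \<Longrightarrow> supported n (k + l) (f * g)"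
  using keys_mult[of f g] unfolding supported_def by (fastforce intro: add_mono)

lemma supported_fstar: "supported n k f \<Longrightarrow> supported n k (fstar f)"
proof -
  have "set (letters (word_star w)) \<subseteq> {..<n} \<times> UNIV" if "set (letters w) \<subseteq> {..<n} \<times> UNIV" for w
    using that by (auto simp: word_star_def letter_star_def)
  then show "supported n k f \<Longrightarrow> supported n k (fstar f)"
    unfolding supported_def keys_fstar by simp
qed

section \<open>Evaluating polynomials at the dense sequence\<close>

context tracial_vn
begin

context
  fixes g :: "nat \<Rightarrow> 'h \<Rightarrow>\<^sub>L 'h"
  assumes gM: "\<And>j. g j \<in> M"
begin

definition gen :: "nat \<Rightarrow> letter \<Rightarrow> 'h \<Rightarrow>\<^sub>L 'h" where
  "gen n x = (if fst x < n then if snd x then g (fst x) else adjoint_op (g (fst x)) else 0)"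

definition word_op :: "nat \<Rightarrow> letter list \<Rightarrow> 'h \<Rightarrow>\<^sub>L 'h" where
  "word_op n xs = foldr (\<lambda>x T. gen n x o\<^sub>L T) xs id_blinfun"

lemma gen_M [simp]: "gen n x \<in> M"
  by (simp add: gen_def gM)

lemma gen_star: "gen n (letter_star x) = adjoint_op (gen n x)"
  using star_star gM star_zero by (auto simp: gen_def letter_star_def)

lemma word_op_simps [simp]: "word_op n [] = id_blinfun" "word_op n (x # xs) = gen n x o\<^sub>L word_op n xs"
  by (simp_all add: word_op_def)

lemma word_op_M [simp]: "word_op n xs \<in> M"
  by (induction xs) auto

lemma comp_id [simp]: "id_blinfun o\<^sub>L T = T" "T o\<^sub>L id_blinfun = T" for T :: "'h \<Rightarrow>\<^sub>L 'h"
  by (auto intro: blinfun_eqI)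

lemma word_op_append: "word_op n (xs @ ys) = word_op n xs o\<^sub>L word_op n ys"
  by (induction xs) (auto simp: blinfun_comp_assoc)

lemma word_op_star: "word_op n (rev (map letter_star xs)) = adjoint_op (word_op n xs)"
proof (induction xs)
  case Nil
  then show ?case using star_one by simp
next
  case (Cons x xs)
  then show ?case using star_mult[of "gen n x" "word_op n xs"] by (simp add: word_op_append gen_star)
qed

lemma word_op_zero: "\<not> fst ` set xs \<subseteq> {..<n} \<Longrightarrow> word_op n xs = 0"
proof (induction xs)
  case (Cons x xs)
  show ?case
  proof (cases "fst x < n")
    case True
    then have "word_op n xs = 0" using Cons by auto
    then show ?thesis by (auto intro: blinfun_eqI)
  next
    case False
    then show ?thesis by (auto simp: gen_def intro: blinfun_eqI)
  qed
qed simp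

definition free_op :: "nat \<Rightarrow> free \<Rightarrow> 'h \<Rightarrow>\<^sub>L 'h" where
  "free_op n f = (\<Sum>w\<in>keys f. scale_op (lookup f w) (word_op n (letters w)))"

lemma free_op_superset: "finite S \<Longrightarrow> keys f \<subseteq> S \<Longrightarrow> free_op n f = (\<Sum>w\<in>S. scale_op (lookup f w) (word_op n (letters w)))"
  unfolding free_op_def by (intro sum.mono_neutral_left) (auto simp: in_keys_iff)

lemma free_op_zero [simp]: "free_op n 0 = 0"
  by (simp add: free_op_def)

lemma free_op_single [simp]: "free_op n (Poly_Mapping.single w c) = scale_op c (word_op n (letters w))"
  by (simp add: free_op_def)

lemma free_op_add: "free_op n (f + h) = free_op n f + free_op n h"
proof -
  let ?S = "keys f \<union> keys h"
  have "free_op n (f + h) = (\<Sum>w\<in>?S. scale_op (lookup (f + h) w) (word_op n (letters w)))"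
    by (intro free_op_superset) (auto simp: Poly_Mapping.keys_add)
  also have "\<dots> = (\<Sum>w\<in>?S. scale_op (lookup f w) (word_op n (letters w))) + (\<Sum>w\<in>?S. scale_op (lookup h w) (word_op n (letters w)))"
    unfolding sum.distrib[symmetric]
    by (intro sum.cong refl blinfun_eqI) (simp add: lookup_add scaleC_add_left blinfun.add_left)
  also have "\<dots> = free_op n f + free_op n h" by (simp add: free_op_superset[of ?S])
  finally show ?thesis .
qed

lemma free_op_M [simp]: "free_op n f \<in> M"
  by (induction f rule: free_induct) (auto simp: free_op_add)

lemma comp_add: "S o\<^sub>L (T + R) = (S o\<^sub>L T) + (S o\<^sub>L R)" "(T + R) o\<^sub>L S = (T o\<^sub>L S) + (R o\<^sub>L S)" for S T R :: "'h \<Rightarrow>\<^sub>L 'h"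
  by (auto intro!: blinfun_eqI simp: blinfun.add_left blinfun.add_right)

lemma free_op_mult: "free_op n (f * h) = free_op n f o\<^sub>L free_op n h"
proof -
  have z: "T o\<^sub>L 0 = 0" "0 o\<^sub>L T = 0" for T :: "'h \<Rightarrow>\<^sub>L 'h" by (auto intro: blinfun_eqI)
  have "free_op n (Poly_Mapping.single u c * h) = free_op n (Poly_Mapping.single u c) o\<^sub>L free_op n h" for u c
  proof (induction h rule: free_induct)
    case (single w d)
    have "scale_op (c * d) (word_op n (letters u) o\<^sub>L word_op n (letters w)) = scale_op c (word_op n (letters u)) o\<^sub>L scale_op d (word_op n (letters w))"
      using smult_mult_left[of "word_op n (letters u)" "scale_op d (word_op n (letters w))" c]
        smult_mult_right[of "word_op n (letters u)" "word_op n (letters w)" d] cscale_assoc by simp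
    then show ?case by (simp add: mult_single word_op_append)
  qed (simp_all add: z distrib_left free_op_add comp_add)
  then show ?thesis
    by (induction f rule: free_induct) (simp_all add: z distrib_right free_op_add comp_add)
qed

lemma free_op_star: "free_op n (fstar f) = adjoint_op (free_op n f)"
proof (induction f rule: free_induct)
  case zero
  then show ?case using star_zero by simp
next
  case (single w c)
  then show ?case using star_smult[of "word_op n (letters w)" c] by (simp add: fstar_single word_star_def word_op_star)
next
  case (add f h)
  then show ?case using star_add[of "free_op n f" "free_op n h"] by (simp add: fstar_add free_op_add)
qed

definition \<theta> :: "nat \<Rightarrow> word \<Rightarrow> complex" where
  "\<theta> n w = \<tau> (word_op n (letters w))"

lemma ext_theta: "ext (\<theta> n) f = \<tau> (free_op n f)"
proof (induction f rule: free_induct)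
  case zero
  then show ?case using tr_zero by simp
next
  case (single w c)
  then show ?case using tr_smult[of "word_op n (letters w)" c] by (simp add: \<theta>_def)
next
  case (add f h)
  then show ?case using tr_add[of "free_op n f" "free_op n h"] by (simp add: ext_add free_op_add)
qed

text \<open>\<open>\<theta> n\<close> extends to \<open>\<tau>\<close> pulled back along the
  star-homomorphism \<open>free_op n\<close>, which gives everything but the last condition; that
  one holds because letters of index at least \<open>n\<close> act by 0.\<close>

lemma truncated_theta:
  assumes "n \<ge> 1" shows "truncated_trace n (\<theta> n)"
proof
  show "\<theta> n 0 = 1" using tr_one by (simp add: \<theta>_def)
  show "\<theta> n (u + v) = \<theta> n (v + u)" for u v
    using tr_comm[of "word_op n (letters u)" "word_op n (letters v)"] by (simp add: \<theta>_def word_op_append)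
  show "\<theta> n (word_star u) = cnj (\<theta> n u)" for u
    using tr_star[of "word_op n (letters u)"] by (simp add: \<theta>_def word_star_def word_op_star)
  show "0 \<le> Re (ext (\<theta> n) (fstar f * f))" for f
    using tr_real_pos(1)[of "free_op n f"] by (simp add: ext_theta free_op_mult free_op_star)
  show "\<theta> n u = 0" if "\<not> fst ` set (letters u) \<subseteq> {..<n}" for u
    using word_op_zero[OF that] tr_zero by (simp add: \<theta>_def)
qed (rule assms)

text \<open>Polynomial sequences with coefficient norm and degree bounded uniformly in
  \<open>n\<close> whose values at stage \<open>n\<close> converge to \<open>x\<close>. They are
  closed under all operations, so every defect of the embedding tracks 0. The separate sequence
  \<open>u\<close> leaves the stage \<open>n = 0\<close> unconstrained, whereas \<open>conv\<close>
  speaks of all indices.\<close>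

definition track :: "(nat \<Rightarrow> free) \<Rightarrow> ('h \<Rightarrow>\<^sub>L 'h) \<Rightarrow> bool" where
  "track P x \<longleftrightarrow> (\<exists>B k u. (\<forall>n\<ge>1. l1_norm (P n) \<le> B \<and> supported n k (P n) \<and> free_op n (P n) = u n) \<and> conv u x)"

lemma track_add:
  assumes "track P x" "track Q y" shows "track (\<lambda>n. P n + Q n) (x + y)"
proof -
  obtain B k u where 1: "\<forall>n\<ge>1. l1_norm (P n) \<le> B \<and> supported n k (P n) \<and> free_op n (P n) = u n" "conv u x"
    using assms by (auto simp: track_def)
  obtain C l v where 2: "\<forall>n\<ge>1. l1_norm (Q n) \<le> C \<and> supported n l (Q n) \<and> free_op n (Q n) = v n" "conv v y"
    using assms by (auto simp: track_def)
  have "l1_norm (P n + Q n) \<le> B + C" if "n \<ge> 1" for n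
    using that 1 2 order.trans[OF l1_norm_add add_mono] by blast
  then show ?thesis unfolding track_def using 1 2 supported_add free_op_add conv_add
    by (intro exI[of _ "B + C"] exI[of _ "max k l"] exI[of _ "\<lambda>n. u n + v n"]) auto
qed

lemma track_mult:
  assumes "track P x" "track Q y" shows "track (\<lambda>n. P n * Q n) (x o\<^sub>L y)"
proof -
  obtain B k u where 1: "\<forall>n\<ge>1. l1_norm (P n) \<le> B \<and> supported n k (P n) \<and> free_op n (P n) = u n" "conv u x"
    using assms by (auto simp: track_def)
  obtain C l v where 2: "\<forall>n\<ge>1. l1_norm (Q n) \<le> C \<and> supported n l (Q n) \<and> free_op n (Q n) = v n" "conv v y"
    using assms by (auto simp: track_def)
  have "l1_norm (P n * Q n) \<le> B * C" if "n \<ge> 1" for n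
    using that 1 2 l1_norm_nonneg[of "P n"] l1_norm_nonneg[of "Q n"]
    by (intro order.trans[OF l1_norm_mult mult_mono]) (auto intro: order.trans)
  then show ?thesis unfolding track_def using 1 2 supported_mult free_op_mult conv_mult
    by (intro exI[of _ "B * C"] exI[of _ "k + l"] exI[of _ "\<lambda>n. u n o\<^sub>L v n"]) auto
qed

lemma track_star:
  assumes "track P x" shows "track (\<lambda>n. fstar (P n)) (adjoint_op x)"
proof -
  obtain B k u where 1: "\<forall>n\<ge>1. l1_norm (P n) \<le> B \<and> supported n k (P n) \<and> free_op n (P n) = u n" "conv u x"
    using assms by (auto simp: track_def)
  then show ?thesis unfolding track_def using supported_fstar free_op_star conv_star l1_norm_fstar
    by (intro exI[of _ B] exI[of _ k] exI[of _ "\<lambda>n. adjoint_op (u n)"]) auto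
qed

lemma track_const: "track (\<lambda>n. Poly_Mapping.single 0 c) (scale_op c id_blinfun)"
  unfolding track_def using conv_const[of "scale_op c id_blinfun"]
  by (intro exI[of _ "cmod c"] exI[of _ 0] exI[of _ "\<lambda>n. scale_op c id_blinfun"]) (auto simp: supported_def split: if_splits)

lemma track_one: "track (\<lambda>n. 1) id_blinfun"
  using track_const[of 1] cscale_one[of id_blinfun] by simp

lemma track_scale: "track P x \<Longrightarrow> x \<in> M \<Longrightarrow> track (\<lambda>n. fscale c (P n)) (scale_op c x)"
  using track_mult[OF track_const, of P x c] smult_mult_left[of id_blinfun x c] by (simp add: fscale_def)

lemma track_pow: "track P x \<Longrightarrow> \<exists>y. track (\<lambda>n. P n ^ m) y"
proof (induction m)
  case 0
  show ?case using track_one by auto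
next
  case (Suc m)
  then show ?case using track_mult by fastforce
qed

text \<open>The inequality \<open>s n < n\<close> says that the letter \<open>s n\<close> is already
  active at stage \<open>n\<close>, so it acts by \<open>g (s n)\<close> and not by 0.\<close>

lemma track_gen:
  assumes "\<forall>n\<ge>1. s n < n" "conv (\<lambda>n. g (s n)) x"
  shows "track (\<lambda>n. Poly_Mapping.single (Word [(s n, True)]) 1) x"
proof -
  have "scale_op 1 T = T" if "T \<in> M" for T using cscale_one[of T] that by simp
  then show ?thesis unfolding track_def using assms gM
    by (intro exI[of _ 1] exI[of _ 1] exI[of _ "\<lambda>n. g (s n)"]) (auto simp: supported_def gen_def)
qed

text \<open>For \<open>n > k\<close> all words of \<open>P n\<close> lie in \<open>W\<close>, so the
  values of \<open>\<phi> n\<close> and \<open>\<theta> n\<close> differ by at most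
  \<open>B / n\<close>; and \<open>\<tau>\<close> is continuous for \<open>conv\<close>.\<close>

lemma track_limit:
  assumes P: "track P x"
    and \<phi>: "\<And>n v. n \<ge> 1 \<Longrightarrow> letters v \<in> truncated_trace.W n \<Longrightarrow> cmod (\<phi> n v - \<theta> n v) \<le> 1 / real n"
  shows "(\<lambda>n. ext (\<phi> n) (P n)) \<longlonglongrightarrow> \<tau> x"
proof -
  obtain B k u where 1: "\<forall>n\<ge>1. l1_norm (P n) \<le> B \<and> supported n k (P n) \<and> free_op n (P n) = u n" "conv u x"
    using P by (auto simp: track_def)
  have close: "cmod (ext (\<phi> n) (P n) - \<tau> (u n)) \<le> B * (1 / real n)" if nk: "n \<ge> k + 1" for n
  proof -
    interpret truncated_trace n "\<theta> n" by (rule truncated_theta) (use nk in simp)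
    have "ext (\<phi> n) (P n) - \<tau> (u n) = (\<Sum>w\<in>keys (P n). lookup (P n) w * (\<phi> n w - \<theta> n w))"
      using 1(1) nk ext_theta[of n "P n"] by (simp add: ext_def right_diff_distrib sum_subtractf)
    also have "cmod \<dots> \<le> (\<Sum>w\<in>keys (P n). cmod (lookup (P n) w) * (1 / real n))"
    proof (rule order.trans[OF norm_sum sum_mono])
      fix w assume w: "w \<in> keys (P n)"
      have "set (letters w) \<subseteq> {..<n} \<times> UNIV \<and> wlen w \<le> k"
      proof -
        have "n \<ge> 1" using nk by simp
        then show ?thesis using 1(1) w unfolding supported_def by blast
      qed
      then have "letters w \<in> W" using nk by (auto simp: W_def D_def)
      then show "cmod (lookup (P n) w * (\<phi> n w - \<theta> n w)) \<le> cmod (lookup (P n) w) * (1 / real n)"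
        unfolding norm_mult using \<phi> nk by (intro mult_left_mono) auto
    qed
    also have "\<dots> = l1_norm (P n) * (1 / real n)" by (simp only: l1_norm_def sum_distrib_right)
    also have "\<dots> \<le> B * (1 / real n)" using 1(1) nk by (intro mult_right_mono) auto
    finally show ?thesis .
  qed
  have "(\<lambda>n. ext (\<phi> n) (P n) - \<tau> (u n)) \<longlonglongrightarrow> 0"
  proof (rule Lim_null_comparison)
    show "\<forall>\<^sub>F n in sequentially. cmod (ext (\<phi> n) (P n) - \<tau> (u n)) \<le> B * (1 / real n)"
      using close by (auto simp: eventually_sequentially)
    show "(\<lambda>n. B * (1 / real n)) \<longlonglongrightarrow> 0"
      by (rule tendsto_mult_right_zero[OF lim_1_over_n])
  qed
  then have "(\<lambda>n. (ext (\<phi> n) (P n) - \<tau> (u n)) + \<tau> (u n)) \<longlonglongrightarrow> 0 + \<tau> x"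
    by (intro tendsto_add conv_tau[OF 1(2)])
  then show ?thesis by simp
qed

end

end

theorem mainTheorem1:
  fixes M :: "('h::complex_hilbert_space \<Rightarrow>\<^sub>L 'h) set"
    and \<tau> :: "('h \<Rightarrow>\<^sub>L 'h) \<Rightarrow> complex"
    and \<omega> :: "nat filter"
  assumes "finite_von_neumann_algebra M"
    and "separable_predual M"
    and "faithful_normal_tracial_state M \<tau>"
    and "ultrafilter_on {1..} \<omega>"
    and "nonprincipal \<omega>"
  shows "\<exists>(A :: nat \<Rightarrow> point star_algebra) (t :: nat \<Rightarrow> point \<Rightarrow> complex).
           (\<forall>n\<ge>1. trace_reduced (A n) (t n)) \<and>
           (\<forall>n\<ge>1. \<exists>C :: (complex, point) module. Module.algebra complex_ring C \<and>
              (\<exists>h. complex_alg_embedding (A n) (matrix_algebra n C) h)) \<and>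
           (\<exists>\<iota>. trace_preserving_embedding (operator_algebra M) \<tau>
                 (metric_ultraproduct {1..} \<omega> A t) (metric_ultraproduct_trace \<omega> t) \<iota>)"
proof -
  interpret tracial_vn M \<tau>
    using assms by unfold_locales (auto simp: finite_von_neumann_algebra_def)
  note ultra = assms(4) and np = assms(5)
  obtain g :: "nat \<Rightarrow> 'h \<Rightarrow>\<^sub>L 'h" where g: "g 0 = 0" "\<forall>j. g j \<in> M"
    "\<forall>x\<in>M. \<forall>\<epsilon>>0. \<exists>j. norm (g j) \<le> norm x + 1 \<and> L2norm (g j - x) < \<epsilon>"
    using dense_sequence by blast
  have gM: "\<And>j. g j \<in> M" using g(2) by blast
  obtain s where s: "\<And>x. x \<in> M \<Longrightarrow> (\<forall>n\<ge>1. s x n < n) \<and> conv (\<lambda>n. g (s x n)) x"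
    using slow_approximation[OF g] by metis
  have "\<exists>\<phi>. n \<ge> 1 \<longrightarrow> positive_trace free_star_algebra (ext \<phi>) \<and>
     (\<forall>v. letters v \<in> truncated_trace.W n \<longrightarrow> cmod (\<phi> v - \<theta> g n v) \<le> 1 / real n) \<and>
     (\<forall>f. ext \<phi> (fstar f * f) = 0 \<longleftrightarrow> (\<forall>s. \<forall>e\<in>truncated_trace.E n. ext (truncated_trace.entry n e) (component s f) = 0))" for n
  proof (cases "n \<ge> 1")
    case True
    then show ?thesis using truncated_trace.approximating_trace[OF truncated_theta[OF gM True], of "1 / real n"] by auto
  qed auto
  then obtain \<phi> where \<phi>: "\<And>n. n \<ge> 1 \<Longrightarrow> positive_trace free_star_algebra (ext (\<phi> n))"
    "\<And>n v. n \<ge> 1 \<Longrightarrow> letters v \<in> truncated_trace.W n \<Longrightarrow> cmod (\<phi> n v - \<theta> g n v) \<le> 1 / real n"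
    "\<And>n f. n \<ge> 1 \<Longrightarrow> ext (\<phi> n) (fstar f * f) = 0 \<longleftrightarrow> (\<forall>s. \<forall>e\<in>truncated_trace.E n. ext (truncated_trace.entry n e) (component s f) = 0)"
    by metis
  define A where "A n = free_trace.alg (\<phi> n)" for n
  define t where "t n = free_trace.tr (\<phi> n)" for n
  define q where "q n = free_trace.q (\<phi> n)" for n
  have ft: "free_trace (\<phi> n)" if "n \<ge> 1" for n using \<phi>(1)[OF that] by (rule free_trace.intro)
  note A_simps = free_trace.alg_simps[OF ft, folded A_def t_def q_def]
  have reduced: "trace_reduced (A n) (t n)" if "n \<ge> 1" for n
    unfolding A_def t_def by (rule free_trace.alg_trace_reduced[OF ft[OF that]])
  have matrices: "\<exists>h. complex_alg_embedding (A n) (matrix_algebra n point_algebra) h" if "n \<ge> 1" for n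
    unfolding A_def by (rule truncated_trace.matrix_embedding[OF truncated_theta[OF gM that] \<phi>(1)[OF that] \<phi>(3)[OF that]])
  interpret U: tracial_ultraproduct "{1..}" A t \<omega>
  proof (intro tracial_ultraproduct.intro tracial_family.intro tracial_ultraproduct_axioms.intro ultra)
    show "tracial_algebra (A i) (t i)" if "i \<in> {1..}" for i
      using reduced[of i] that by (simp add: trace_reduced_def tracial_star_algebra_def tracial_algebra_def tracial_algebra_axioms_def)
  qed
  \<comment> \<open>The only place where nonprincipality of \<omega> enters.\<close>
  have limit: "((\<lambda>n. ext (\<phi> n) (P n)) \<longlongrightarrow> \<tau> x) \<omega>" if "track g P x" for P x
    by (rule filterlim_mono[OF track_limit[OF gM that \<phi>(2)] order_refl nonprincipal_le_sequentially[OF ultra np]])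
  \<comment> \<open>The coordinate at stage \<open>n\<close> is a single generator, chosen by
    \<open>s x\<close>; different elements of \<open>M\<close> get unrelated letters, so the
    algebraic relations hold only in the limit.\<close>
  define X where "X x n = Poly_Mapping.single (Word [(s x n, True)]) (1 :: complex)" for x n
  have X: "track g (X x) x" if "x \<in> M" for x
    unfolding X_def[abs_def] using s[OF that] by (intro track_gen[OF gM]) auto
  define r where "r x = (\<lambda>n\<in>{1..}. q n (X x n))" for x
  have mom: "U.moment m n (q n f) = ext (\<phi> n) ((fstar f * f) ^ m)" if "n \<in> {1..}" for m n f
    using that free_trace.alg_pow[OF ft, of n "fstar f * f" m] by (simp add: A_simps flip: A_def q_def)
  have rb: "r x \<in> bounded_families {1..} A t" if x: "x \<in> M" for x
    unfolding U.bounded_families_iff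
  proof (intro conjI allI impI)
    show "r x \<in> (\<Pi>\<^sub>E i\<in>{1..}. carrier (A i))" by (auto simp: r_def A_simps)
    fix m :: nat
    \<comment> \<open>Each power of the square tracks some element, so its traces converge and form
      a bounded sequence; the bound depends on \<open>m\<close>.\<close>
    obtain y where "track g (\<lambda>n. (fstar (X x n) * X x n) ^ m) y"
      using track_pow[OF gM track_mult[OF gM track_star[OF gM X[OF x]] X[OF x]]] by blast
    then have "Bseq (\<lambda>n. ext (\<phi> n) ((fstar (X x n) * X x n) ^ m))"
      using track_limit[OF gM _ \<phi>(2)] convergentI convergent_imp_Bseq by blast
    then obtain K where "\<And>n. cmod (ext (\<phi> n) ((fstar (X x n) * X x n) ^ m)) \<le> K" by (auto simp: Bseq_def)
    then show "\<exists>K. \<forall>i\<in>{1..}. cmod (U.moment m i (r x i)) \<le> K"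
      using mom by (intro exI[of _ K]) (auto simp: r_def)
  qed
  \<comment> \<open>A sequence tracking 0 has a square tracking 0, so its 2-norms under the
    approximating traces tend to 0.\<close>
  have vanish: "((\<lambda>n. U.moment 1 n (y n)) \<longlongrightarrow> 0) \<omega>"
    if P: "track g P 0" "\<And>n. n \<ge> 1 \<Longrightarrow> y n = q n (P n)" for P y
  proof -
    have "track g (\<lambda>n. fstar (P n) * P n) (adjoint_op 0 o\<^sub>L 0)" by (rule track_mult[OF gM track_star[OF gM P(1)] P(1)])
    moreover have "adjoint_op 0 o\<^sub>L 0 = (0 :: 'h \<Rightarrow>\<^sub>L 'h)" by (rule blinfun_eqI) simp
    ultimately have "((\<lambda>n. ext (\<phi> n) (fstar (P n) * P n)) \<longlongrightarrow> \<tau> 0) \<omega>" using limit by simp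
    moreover have "eventually (\<lambda>n. ext (\<phi> n) (fstar (P n) * P n) = U.moment 1 n (y n)) \<omega>"
      using U.eventually_I by eventually_elim (use P(2) mom[where m = "Suc 0"] in simp)
    ultimately show ?thesis using tr_zero by (auto elim: Lim_transform_eventually)
  qed
  \<comment> \<open>All defects have this shape: two sequences tracking the same operator, one a
    single letter and the other built from letters by the operation in question.\<close>
  have minus: "track g (\<lambda>n. P n + fscale (-1) (Q n)) 0" if "track g P x" "track g Q x" "x \<in> M" for P Q x
    using track_add[OF gM that(1) track_scale[OF gM that(2,3), of "-1"]] by (simp add: scale_op_minus)
  have "\<exists>\<iota>. trace_preserving_embedding (operator_algebra M) \<tau> (metric_ultraproduct {1..} \<omega> A t) (metric_ultraproduct_trace \<omega> t) \<iota>"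
  proof (rule U.ultraproduct_embedding[where r = r])
    show "tracial_algebra (operator_algebra M) \<tau>" by (rule tracial_algebra_axioms)
    show "faithful (operator_algebra M) \<tau>" using fnt by (simp add: faithful_normal_tracial_state_def)
    show "r x \<in> bounded_families {1..} A t" if "x \<in> carrier (operator_algebra M)" for x
      using rb that by simp
    show "((\<lambda>n. U.moment 1 n (r (x \<oplus>\<^bsub>operator_algebra M\<^esub> y) n \<oplus>\<^bsub>A n\<^esub> (-1) \<odot>\<^bsub>A n\<^esub> (r x n \<oplus>\<^bsub>A n\<^esub> r y n))) \<longlongrightarrow> 0) \<omega>"
      if "x \<in> carrier (operator_algebra M)" "y \<in> carrier (operator_algebra M)" for x y
      by (rule vanish[OF minus[OF X track_add[OF gM X X]]]) (use that in \<open>auto simp: r_def A_simps\<close>)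
    show "((\<lambda>n. U.moment 1 n (r (x \<otimes>\<^bsub>operator_algebra M\<^esub> y) n \<oplus>\<^bsub>A n\<^esub> (-1) \<odot>\<^bsub>A n\<^esub> (r x n \<otimes>\<^bsub>A n\<^esub> r y n))) \<longlongrightarrow> 0) \<omega>"
      if "x \<in> carrier (operator_algebra M)" "y \<in> carrier (operator_algebra M)" for x y
      by (rule vanish[OF minus[OF X track_mult[OF gM X X]]]) (use that in \<open>auto simp: r_def A_simps\<close>)
    show "((\<lambda>n. U.moment 1 n (r (c \<odot>\<^bsub>operator_algebra M\<^esub> x) n \<oplus>\<^bsub>A n\<^esub> (-1) \<odot>\<^bsub>A n\<^esub> (c \<odot>\<^bsub>A n\<^esub> r x n))) \<longlongrightarrow> 0) \<omega>"
      if "x \<in> carrier (operator_algebra M)" for c x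
      by (rule vanish[OF minus[OF X track_scale[OF gM X]]]) (use that in \<open>auto simp: r_def A_simps\<close>)
    show "((\<lambda>n. U.moment 1 n (r (star (operator_algebra M) x) n \<oplus>\<^bsub>A n\<^esub> (-1) \<odot>\<^bsub>A n\<^esub> star (A n) (r x n))) \<longlongrightarrow> 0) \<omega>"
      if "x \<in> carrier (operator_algebra M)" for x
      by (rule vanish[OF minus[OF X track_star[OF gM X]]]) (use that in \<open>auto simp: r_def A_simps\<close>)
    show "((\<lambda>n. U.moment 1 n (r \<one>\<^bsub>operator_algebra M\<^esub> n \<oplus>\<^bsub>A n\<^esub> (-1) \<odot>\<^bsub>A n\<^esub> \<one>\<^bsub>A n\<^esub>)) \<longlongrightarrow> 0) \<omega>"
      by (rule vanish[OF minus[OF X track_one[OF gM]]]) (auto simp: r_def A_simps)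
    show "((\<lambda>n. t n (r x n)) \<longlongrightarrow> \<tau> x) \<omega>" if "x \<in> carrier (operator_algebra M)" for x
    proof (rule Lim_transform_eventually[OF limit[OF X]])
      show "eventually (\<lambda>n. ext (\<phi> n) (X x n) = t n (r x n)) \<omega>"
        using U.eventually_I by eventually_elim (simp add: r_def A_simps)
    qed (use that in simp)
  qed
  then show ?thesis using reduced matrices algebra_point_algebra by blast
qed

end
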